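(* Let $n$ be a positive integer, $\epsilon>0$, and $p$ any prime greater than $16(n^2+3n)/\epsilon$. Fix integers $0\le e_1\le e_2\le\cdots\le e_n$, let $m$ be an integer with $m\ge e_1+\cdots+e_n+1$, and let $S=\operatorname{diag}(p^{e_1},\ldots,p^{e_n})\in\mathbb{Z}^{n\times n}$. Then the number of matrices in $\mathfrak{S}_S^m$ which are $p$-characterized, and hence $p$-correspondent, is at least $(1-\epsilon)\cdot|\mathfrak{S}_S^m|$.
   Context: $\mathfrak{S}_S^m\subseteq\mathbb{Z}^{n\times n}$ denotes the set of integer matrices with all entries in $\{0,1,\ldots,p^m-1\}$ whose Smith normal form $\operatorname{diag}(s_1,\ldots,s_n)$ over $\mathbb{Z}$ satisfies $v_p(s_i)=e_i$ for all $i\in\{1,\ldots,n\}$. $v_p$ denotes the $p$-adic valuation on $\mathbb{Q}_p\supseteq\mathbb{Q}$ (with $v_p(0)=\infty$), extended to any finite-degree extension $K_p$ of $\mathbb{Q}_p$ as follows: if $a\in K_p$ has minimal polynomial $x^{d}+a_{d-1}x^{d-1}+\cdots+a_0$ over $\mathbb{Q}_p$, then $v_p(a)=\frac1d v_p(a_0)$. Let $A\in\mathbb{Z}^{n\times n}$ have rank $r$. Its Smith normal form over $\mathbb{Z}$ is $\operatorname{diag}(s_1,\ldots,s_r,0,\ldots,0)$ with nonzero invariant factors $s_1\mid s_2\mid\cdots\mid s_r$. The $i$th determinantal divisor $\Delta_i$ is the GCD of all $i\times i$ minors of $A$; for $1\le i\le r$, $\Delta_i=s_1\cdots s_i$ (up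 to sign). Write the characteristic polynomial of $A$ as $\det(xI-A)=x^n+f_1x^{n-1}+\cdots+f_r x^{n-r}$ (coefficients $f_i$ with $i>r$ vanish). $A$ is called $p$-characterized if $v_p(f_i)=v_p(\Delta_i)$ for all $i\in\{1,\ldots,r\}$. $A$ is called $p$-correspondent if $A$ has exactly $r$ non-zero eigenvalues (counted with algebraic multiplicity) $\lambda_1,\ldots,\lambda_r$ in a finite-degree extension $K_p$ of $\mathbb{Q}_p$ and, when they are ordered so that $v_p(\lambda_1)\le\cdots\le v_p(\lambda_r)$, one has $v_p(s_i)=v_p(\lambda_i)$ for all $i\in\{1,\ldots,r\}$. *)

theory Defs
  imports
    "HOL-Algebra.Finite_Extensions"
    "HOL-Algebra.QuotRing"
    "HOL-Library.Extended_Real"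
    "Jordan_Normal_Form.Char_Poly"
    "Jordan_Normal_Form.DL_Rank"
    "Jordan_Normal_Form.DL_Submatrix"
begin

definition rat_val :: "nat \<Rightarrow> rat \<Rightarrow> ereal" where
  "rat_val p q =
     (if q = 0 then \<infinity>
      else ereal (real (multiplicity (int p) (fst (quotient_of q)))
                - real (multiplicity (int p) (snd (quotient_of q)))))"

text \<open>The field of \<open>p\<close>-adic numbers is the completion of the rationals: the ring of \<open>p\<close>-adic
  Cauchy sequences modulo the ideal of null sequences. Both conditions are expressed
  through the valuation instead of the absolute value \<open>p powr (- v)\<close>.\<close>

definition padic_Cauchy :: "nat \<Rightarrow> (nat \<Rightarrow> rat) \<Rightarrow> bool" where
  "padic_Cauchy p u \<longleftrightarrow>
     (\<forall>k::nat. \<exists>N. \<forall>i\<ge>N. \<forall>j\<ge>N. ereal (real k) \<le> rat_val p (u i - u j))"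

definition padic_null :: "nat \<Rightarrow> (nat \<Rightarrow> rat) \<Rightarrow> bool" where
  "padic_null p u \<longleftrightarrow> (\<forall>k::nat. \<exists>N. \<forall>i\<ge>N. ereal (real k) \<le> rat_val p (u i))"

definition padic_Cauchy_ring :: "nat \<Rightarrow> (nat \<Rightarrow> rat) ring" where
  "padic_Cauchy_ring p =
     \<lparr> carrier = {u. padic_Cauchy p u},
       monoid.mult = (\<lambda>u w i. u i * w i), one = (\<lambda>_. 1),
       zero = (\<lambda>_. 0), add = (\<lambda>u w i. u i + w i) \<rparr>"

type_synonym padic = "(nat \<Rightarrow> rat) set"

definition padic_field :: "nat \<Rightarrow> padic ring" where
  "padic_field p = padic_Cauchy_ring p Quot {u. padic_null p u}"

text \<open>The valuation on the completion is the limit of the valuations along any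
  representing sequence.\<close>

definition padic_val :: "nat \<Rightarrow> padic \<Rightarrow> ereal" where
  "padic_val p x = (THE v. \<forall>u\<in>x. (\<lambda>i. rat_val p (u i)) \<longlonglongrightarrow> v)"

text \<open>A finite-degree extension is a field \<open>K\<close> together with an embedding \<open>\<phi>\<close> of the \<open>p\<close>-adic
  numbers such that \<open>K\<close> has finite dimension over the image of \<open>\<phi>\<close>. The type of the elements
  of \<open>K\<close> is the one used for algebraic closures in \<open>HOL-Algebra\<close>. It contains
  a copy of an algebraic closure of the \<open>p\<close>-adic numbers, hence an isomorphic copy of every
  finite-degree extension, so fixing it loses no generality.\<close>

type_synonym padic_ext = "(padic list \<times> nat) multiset \<Rightarrow> padic"

definition finite_padic_extension :: "nat \<Rightarrow> padic_ext ring \<Rightarrow> (padic \<Rightarrow> padic_ext) \<Rightarrow> bool" where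
  "finite_padic_extension p K \<phi> \<longleftrightarrow>
     field K \<and> \<phi> \<in> Ring.ring_hom (padic_field p) K \<and>
     ring.finite_dimension K (\<phi> ` carrier (padic_field p)) (carrier K)"

text \<open>Polynomials over a \<open>HOL-Algebra\<close> ring are coefficient lists with the leading coefficient
  first, so \<open>last\<close> selects the constant coefficient. \<open>ring.Irr\<close> is the minimal polynomial.\<close>

definition ext_val :: "nat \<Rightarrow> padic_ext ring \<Rightarrow> (padic \<Rightarrow> padic_ext) \<Rightarrow> padic_ext \<Rightarrow> ereal" where
  "ext_val p K \<phi> a =
     (let f = ring.Irr K (\<phi> ` carrier (padic_field p)) a
      in padic_val p (inv_into (carrier (padic_field p)) \<phi> (last f)) / ereal (real (length f - 1)))"

text \<open>Normalized to non-negative diagonal entries, hence unique.\<close>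

definition smith_normal_form :: "int mat \<Rightarrow> int mat \<Rightarrow> bool" where
  "smith_normal_form A D \<longleftrightarrow>
     D \<in> carrier_mat (dim_row A) (dim_col A) \<and> diagonal_mat D \<and>
     (\<forall>i < min (dim_row A) (dim_col A). 0 \<le> D $$ (i, i)) \<and>
     (\<forall>i. Suc i < min (dim_row A) (dim_col A) \<longrightarrow> D $$ (i, i) dvd D $$ (Suc i, Suc i)) \<and>
     (\<exists>P Q. P \<in> carrier_mat (dim_row A) (dim_row A) \<and> invertible_mat P \<and>
            Q \<in> carrier_mat (dim_col A) (dim_col A) \<and> invertible_mat Q \<and>
            D = P * A * Q)"

definition int_mat_rank :: "int mat \<Rightarrow> nat" where
  "int_mat_rank A = vec_space.rank (dim_row A) (map_mat rat_of_int A)"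

definition determinantal_divisor :: "int mat \<Rightarrow> nat \<Rightarrow> int" where
  "determinantal_divisor A i =
     Gcd {det (submatrix A I J) | I J.
            I \<subseteq> {..<dim_row A} \<and> J \<subseteq> {..<dim_col A} \<and> card I = i \<and> card J = i}"

definition p_characterized :: "nat \<Rightarrow> int mat \<Rightarrow> bool" where
  "p_characterized p A \<longleftrightarrow>
     (\<forall>i\<in>{1..int_mat_rank A}.
        rat_val p (rat_of_int (poly.coeff (char_poly A) (dim_row A - i)))
        = rat_val p (rat_of_int (determinantal_divisor A i)))"

definition char_poly_over :: "('a, 'b) ring_scheme \<Rightarrow> int mat \<Rightarrow> 'a list" where
  "char_poly_over K A = map (\<lambda>c. [c] \<cdot>\<^bsub>K\<^esub> \<one>\<^bsub>K\<^esub>) (rev (coeffs (char_poly A)))"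

text \<open>The list \<open>ls\<close> enumerates the non-zero eigenvalues in \<open>K\<close> with algebraic multiplicity.
  Indices are shifted to start at \<open>0\<close>.\<close>

definition p_correspondent :: "nat \<Rightarrow> int mat \<Rightarrow> bool" where
  "p_correspondent p A \<longleftrightarrow>
     (\<exists>D K \<phi> ls.
        smith_normal_form A D \<and> finite_padic_extension p K \<phi> \<and>
        mset ls = {#x \<in># ring.roots K (char_poly_over K A). x \<noteq> \<zero>\<^bsub>K\<^esub>#} \<and>
        length ls = int_mat_rank A \<and>
        sorted (map (ext_val p K \<phi>) ls) \<and>
        (\<forall>i < int_mat_rank A.
           rat_val p (rat_of_int (D $$ (i, i))) = ext_val p K \<phi> (ls ! i)))"

text \<open>The integer matrices with entries in \<open>{0..p^m-1}\<close> whose Smith normal form has the same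
  valuations on the diagonal as \<open>diag(p^e\<^sub>1, \<dots>, p^e\<^sub>n)\<close>, where \<open>es = [e\<^sub>1, \<dots>, e\<^sub>n]\<close>.\<close>

definition smith_class :: "nat \<Rightarrow> nat \<Rightarrow> nat list \<Rightarrow> int mat set" where
  "smith_class p m es =
     {A \<in> carrier_mat (length es) (length es).
        (\<forall>i < length es. \<forall>j < length es. A $$ (i, j) \<in> {0..int p ^ m - 1}) \<and>
        (\<exists>D. smith_normal_form A D \<and>
             (\<forall>i < length es. rat_val p (rat_of_int (D $$ (i, i))) = ereal (real (es ! i))))}"

end

theory Submission
  imports
    Defs
    "HOL-Algebra.Algebraic_Closure"
    "HOL-Computational_Algebra.Polynomial"
    "HOL-Number_Theory.Cong"
begin

text \<open>Let \<open>S = diag(p\<^bsup>e\<^sub>1\<^esup>, \<dots>, p\<^bsup>e\<^sub>n\<^esup>)\<close> and \<open>E\<^sub>k = e\<^sub>1 + \<dots> + e\<^sub>k\<close>. There are two independent parts: the count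
  of the \<open>p\<close>-characterized matrices, and the implication to \<open>p\<close>-correspondence.

  The count. The \<open>k\<close>-th determinantal divisor of a matrix of the class has valuation \<open>E\<^sub>k\<close>, and
  all \<open>E\<^sub>k\<close> are smaller than \<open>m\<close>. So membership in the class and being \<open>p\<close>-characterized are both
  conditions modulo \<open>p\<^sup>m\<close> (\<open>smith_class_iff\<close>, \<open>p_characterized_iff_coeff_val\<close>). Call an integer
  matrix a unit if \<open>p\<close> does not divide its determinant. Right multiplication by a unit \<open>W\<close>,
  reduced modulo \<open>p\<^sup>m\<close>, permutes the class. A matrix \<open>A\<close> of the class can be
  written as \<open>U S V\<close> with \<open>U\<close> unimodular and \<open>V\<close> a unit, and then \<open>A W\<close> is similar to
  \<open>S (V W U)\<close>, where \<open>V W U\<close> runs through all units when \<open>W\<close> does. Hence the proportion of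
  \<open>p\<close>-characterized matrices in the class is the proportion of those units \<open>Y\<close> for which
  \<open>S Y\<close> has the right coefficients (\<open>card_exact_coeffs_mult_card_units\<close>). The coefficients of the
  characteristic polynomial are signed sums of principal minors, and a principal minor of \<open>S Y\<close>
  is the one of \<open>Y\<close> times the selected entries of \<open>S\<close>. So the \<open>k\<close>-th coefficient is
  \<open>\<plusminus> p\<^bsup>E\<^sub>k\<^esup>\<close> times an integer polynomial in the entries of \<open>Y\<close>, in which the leading principal minor of
  size \<open>k\<close> has coefficient \<open>1\<close>. On every line in the direction \<open>diag(1, \<dots>, 1, 0, \<dots>, 0)\<close> with \<open>k\<close>
  ones this polynomial is nonzero modulo \<open>p\<close> of degree \<open>k\<close>, so it has at most \<open>k\<close> roots
  modulo \<open>p\<close> there (\<open>card_line_reduced_coeff_le\<close>). Averaging over the lines and summing over \<open>k\<close>,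
  at most the proportion \<open>n\<^sup>2 / p\<close> of all \<open>Y\<close> fails for some \<open>k\<close>. A \<open>Y\<close> that does not fail is a
  unit, since the polynomial for \<open>k = n\<close> is the determinant.

  The implication. The characteristic polynomial of a \<open>p\<close>-characterized matrix of the class has
  coefficients of absolute value \<open>b\<^sub>1 \<cdots> b\<^sub>k\<close> at \<open>x\<^bsup>n - k\<^esup>\<close>, where \<open>b\<^sub>i = p\<^bsup>- e\<^sub>i\<^esup>\<close>. So its Gauss norm for
  the radius \<open>\<sigma>\<close> is \<open>\<Prod> max b\<^sub>i \<sigma>\<close>. On the other hand, for every monic polynomial with
  nonzero constant coefficient which splits in an extension of \<open>Q\<^sub>p\<close>, the Gauss norm is \<open>\<Prod> max |\<lambda>| \<sigma>\<close> over its
  roots \<open>\<lambda>\<close> (\<open>cgauss_eq_prod_roots\<close>). The functions of \<open>\<sigma>\<close> determine the multisets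
  (\<open>multiset_eq_of_prod_max\<close>), so the absolute values of the eigenvalues are the \<open>b\<^sub>i\<close>. Here \<open>|\<lambda>|\<close> is
  defined from the constant coefficient of the minimal polynomial of \<open>\<lambda>\<close>. The formula for the
  Gauss norm follows from its multiplicativity over \<open>Q\<^sub>p\<close> and from its value on irreducible polynomials, which expresses that
  their Newton polygon is a single segment. That is where completeness enters: a polynomial with a
  vertex inside its Newton polygon is split by Newton's method (\<open>hensel_sequences\<close>,
  \<open>factor_at_dominant_index\<close>).\<close>

section \<open>Gauss norms of polynomials over a field with a nonarchimedean absolute value\<close>

hide_const (open) UnivPoly.monom UnivPoly.coeff

locale nonarch_field =
  fixes nrm :: "'a::field \<Rightarrow> real"
  assumes nrm_zero_iff [simp]: "nrm x = 0 \<longleftrightarrow> x = 0"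
    and nrm_nonneg [simp]: "0 \<le> nrm x"
    and nrm_mult: "nrm (x * y) = nrm x * nrm y"
    and nrm_add: "nrm (x + y) \<le> max (nrm x) (nrm y)"
begin

lemma nrm_zero [simp]: "nrm 0 = 0"
  by simp

lemma nrm_one [simp]: "nrm 1 = 1"
  using nrm_mult[of 1 1] nrm_zero_iff[of 1] by simp

lemma nrm_uminus [simp]: "nrm (- x) = nrm x"
proof -
  have "nrm (-1) * nrm (-1) = 1" using nrm_mult[of "-1" "-1"] by simp
  moreover have "nrm (-1) \<ge> 0" by simp
  ultimately have "nrm (-1) = 1"
    by (metis abs_of_nonneg abs_one power2_eq_square power2_eq_iff_nonneg zero_le_one mult_1)
  then show ?thesis using nrm_mult[of "-1" x] by simp
qed

lemma nrm_diff: "nrm (x - y) \<le> max (nrm x) (nrm y)"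
  using nrm_add[of x "- y"] by simp

lemma nrm_add_dominant: "nrm y < nrm x \<Longrightarrow> nrm (x + y) = nrm x"
  using nrm_add[of x y] nrm_diff[of "x + y" y] by auto

lemma nrm_sum_le: "(\<And>i. i \<in> I \<Longrightarrow> nrm (f i) \<le> B) \<Longrightarrow> 0 \<le> B \<Longrightarrow> nrm (sum f I) \<le> B"
proof (induction I rule: infinite_finite_induct)
  case (insert i I)
  then have "nrm (f i) \<le> B" "nrm (sum f I) \<le> B" by auto
  then show ?case using nrm_add[of "f i" "sum f I"] insert(1,2) by auto
qed auto

lemma nrm_sum_less: "(\<And>i. i \<in> I \<Longrightarrow> nrm (f i) < B) \<Longrightarrow> 0 < B \<Longrightarrow> nrm (sum f I) < B"
proof (induction I rule: infinite_finite_induct)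
  case (insert i I)
  then have "nrm (f i) < B" "nrm (sum f I) < B" by auto
  then show ?case using nrm_add[of "f i" "sum f I"] insert(1,2) by auto
qed auto

lemma nrm_divide: "nrm (x / y) = nrm x / nrm y"
proof (cases "y = 0")
  case False
  then show ?thesis using nrm_mult[of "x / y" y] by (simp add: field_simps)
qed auto

end

locale gauss_norm = nonarch_field nrm for nrm :: "'a::field \<Rightarrow> real" +
  fixes \<rho> :: real
  assumes rho_pos: "0 < \<rho>"
begin

text \<open>As a function of \<open>\<rho>\<close> this norm carries the Newton polygon of the polynomial: its logarithm
  is, up to signs, the Legendre transform of the polygon.\<close>

definition gauss :: "'a poly \<Rightarrow> real" where
  "gauss f = Max ((\<lambda>j. nrm (coeff f j) * \<rho> ^ j) ` {..degree f})"

lemma coeff_le_gauss: "nrm (coeff f j) * \<rho> ^ j \<le> gauss f"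
proof (cases "j \<le> degree f")
  case True
  then show ?thesis unfolding gauss_def by (intro Max_ge) auto
next
  case False
  have "0 \<le> nrm (coeff f 0) * \<rho> ^ 0" by simp
  also have "\<dots> \<le> gauss f" unfolding gauss_def by (intro Max_ge imageI) auto
  finally show ?thesis using False by (simp add: coeff_eq_0)
qed

lemma gauss_nonneg [simp]: "0 \<le> gauss f"
  using coeff_le_gauss[of f 0] order_trans[of 0 "nrm (coeff f 0)"] by simp

lemma gauss_leI: "(\<And>j. nrm (coeff f j) * \<rho> ^ j \<le> B) \<Longrightarrow> gauss f \<le> B"
  unfolding gauss_def by (subst Max_le_iff) auto

lemma gauss_attained: obtains j where "j \<le> degree f" "gauss f = nrm (coeff f j) * \<rho> ^ j"
proof -
  have "gauss f \<in> (\<lambda>j. nrm (coeff f j) * \<rho> ^ j) ` {..degree f}"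
    unfolding gauss_def by (intro Max_in) auto
  then show ?thesis using that by auto
qed

lemma gauss_eq_0_iff [simp]: "gauss f = 0 \<longleftrightarrow> f = 0"
proof
  assume "gauss f = 0"
  then have "nrm (coeff f j) * \<rho> ^ j \<le> 0" for j using coeff_le_gauss[of f j] by simp
  moreover have "nrm (coeff f j) * \<rho> ^ j \<ge> 0" for j using rho_pos by simp
  ultimately have "nrm (coeff f j) * \<rho> ^ j = 0" for j by (meson antisym)
  then show "f = 0" using rho_pos by (simp add: poly_eq_iff)
qed (simp add: gauss_def)

lemma gauss_zero [simp]: "gauss 0 = 0"
  by simp

lemma gauss_pos: "f \<noteq> 0 \<Longrightarrow> 0 < gauss f"
  using gauss_nonneg[of f] gauss_eq_0_iff[of f] by linarith

lemma gauss_uminus [simp]: "gauss (- f) = gauss f"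
  unfolding gauss_def by simp

lemma gauss_add: "gauss (f + g) \<le> max (gauss f) (gauss g)"
proof (rule gauss_leI)
  fix j
  have "nrm (coeff (f + g) j) * \<rho> ^ j \<le> max (nrm (coeff f j)) (nrm (coeff g j)) * \<rho> ^ j"
    using nrm_add rho_pos by (intro mult_right_mono) auto
  then show "nrm (coeff (f + g) j) * \<rho> ^ j \<le> max (gauss f) (gauss g)"
    using coeff_le_gauss[of f j] coeff_le_gauss[of g j] by (auto simp: max_def split: if_splits)
qed

lemma gauss_diff: "gauss (f - g) \<le> max (gauss f) (gauss g)"
  using gauss_add[of f "- g"] by simp

lemma gauss_add_dominant: "gauss g < gauss f \<Longrightarrow> gauss (f + g) = gauss f"
  using gauss_add[of f g] gauss_diff[of "f + g" g] by auto

text \<open>Let \<open>i\<close> and \<open>j\<close> be the last indices at which \<open>f\<close> and \<open>g\<close> attain their norms. In the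
  coefficient of index \<open>i + j\<close> of the product every term other than \<open>f\<^sub>i g\<^sub>j\<close> contains a
  coefficient beyond \<open>i\<close> or beyond \<open>j\<close>, hence is strictly smaller and cannot cancel it.\<close>

lemma gauss_mult: "gauss (f * g) = gauss f * gauss g"
proof (cases "f = 0 \<or> g = 0")
  case True
  then show ?thesis by auto
next
  case False
  have last_index: "\<exists>i. nrm (coeff h i) * \<rho> ^ i = gauss h
      \<and> (\<forall>k>i. nrm (coeff h k) * \<rho> ^ k < gauss h)" if "h \<noteq> 0" for h
  proof -
    define S where "S = {i. i \<le> degree h \<and> nrm (coeff h i) * \<rho> ^ i = gauss h}"
    have fin: "finite S" by (simp add: S_def)
    have "S \<noteq> {}" using gauss_attained[of h] unfolding S_def by (metis (mono_tags, lifting) empty_iff mem_Collect_eq)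
    then have "Max S \<in> S" using fin by simp
    moreover have "nrm (coeff h k) * \<rho> ^ k < gauss h" if "k > Max S" for k
    proof (cases "k \<le> degree h")
      case True
      have "k \<notin> S" using fin that Max_ge by fastforce
      then show ?thesis using True coeff_le_gauss[of h k] unfolding S_def by auto
    qed (use gauss_pos[OF \<open>h \<noteq> 0\<close>] in \<open>simp add: coeff_eq_0\<close>)
    ultimately show ?thesis unfolding S_def by blast
  qed
  obtain i where i: "nrm (coeff f i) * \<rho> ^ i = gauss f"
    "\<And>k. k > i \<Longrightarrow> nrm (coeff f k) * \<rho> ^ k < gauss f" using last_index False by blast
  obtain j where j: "nrm (coeff g j) * \<rho> ^ j = gauss g"
    "\<And>k. k > j \<Longrightarrow> nrm (coeff g k) * \<rho> ^ k < gauss g" using last_index False by blast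
  have term_eq: "nrm (coeff f k * coeff g (n - k)) * \<rho> ^ n
      = (nrm (coeff f k) * \<rho> ^ k) * (nrm (coeff g (n - k)) * \<rho> ^ (n - k))" if "k \<le> n" for k n
  proof -
    have "\<rho> ^ n = \<rho> ^ k * \<rho> ^ (n - k)" using that by (simp flip: power_add)
    then show ?thesis by (simp add: nrm_mult)
  qed
  have pos: "0 < gauss f" "0 < gauss g" using False gauss_pos by auto
  have nn: "0 \<le> nrm (coeff h k) * \<rho> ^ k" for h k using rho_pos by simp
  show ?thesis
  proof (rule antisym)
    show "gauss (f * g) \<le> gauss f * gauss g"
    proof (rule gauss_leI)
      fix n
      have "nrm (coeff f k * coeff g (n - k)) \<le> gauss f * gauss g / \<rho> ^ n" if "k \<in> {..n}" for k
        using term_eq[of k n] that coeff_le_gauss[of f k] coeff_le_gauss[of g "n - k"] rho_pos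
        by (simp add: pos_le_divide_eq mult_mono nn)
      then have "nrm (\<Sum>k\<le>n. coeff f k * coeff g (n - k)) \<le> gauss f * gauss g / \<rho> ^ n"
        using rho_pos by (intro nrm_sum_le) auto
      then show "nrm (coeff (f * g) n) * \<rho> ^ n \<le> gauss f * gauss g"
        using rho_pos by (simp add: coeff_mult pos_le_divide_eq)
    qed
  next
    define n where "n = i + j"
    define B where "B = gauss f * gauss g / \<rho> ^ n"
    have "nrm (coeff f i * coeff g (n - i)) * \<rho> ^ n = gauss f * gauss g"
      using term_eq[of i n] i(1) j(1) by (simp add: n_def)
    then have B: "nrm (coeff f i * coeff g (n - i)) = B"
      using rho_pos by (simp add: B_def field_simps)
    have small: "nrm (coeff f k * coeff g (n - k)) < B" if "k \<in> {..n} - {i}" for k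
    proof -
      have "(nrm (coeff f k) * \<rho> ^ k) * (nrm (coeff g (n - k)) * \<rho> ^ (n - k)) < gauss f * gauss g"
      proof (cases "k > i")
        case True
        then show ?thesis
          using i(2) coeff_le_gauss[of g "n - k"] nn pos
          by (meson mult_less_le_imp_less order_less_imp_le mult_strict_right_mono order_le_less_trans mult_left_mono)
      next
        case False
        then have "n - k > j" using that n_def by auto
        then have "nrm (coeff g (n - k)) * \<rho> ^ (n - k) < gauss g" using j(2) by blast
        then show ?thesis
          using coeff_le_gauss[of f k] nn pos
          by (meson mult_strict_left_mono order_le_less_trans mult_right_mono)
      qed
      then show ?thesis
        using term_eq[of k n] that rho_pos by (simp add: B_def pos_less_divide_eq)
    qed
    have "coeff (f * g) n = coeff f i * coeff g (n - i)
        + (\<Sum>k\<in>{..n} - {i}. coeff f k * coeff g (n - k))"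
      by (simp add: coeff_mult n_def sum.remove[of _ i])
    moreover have "nrm (\<Sum>k\<in>{..n} - {i}. coeff f k * coeff g (n - k)) < B"
      using small pos rho_pos by (intro nrm_sum_less) (auto simp: B_def)
    ultimately have "nrm (coeff (f * g) n) = B"
      using B by (simp add: nrm_add_dominant)
    then show "gauss f * gauss g \<le> gauss (f * g)"
      using coeff_le_gauss[of "f * g" n] rho_pos by (simp add: B_def)
  qed
qed

lemma gauss_one [simp]: "gauss 1 = 1"
  using gauss_mult[of 1 1] gauss_eq_0_iff[of 1] by simp

text \<open>Cancelling the leading term of \<open>f\<close> subtracts a multiple of \<open>g\<close> whose norm is that of the
  leading term, because \<open>g\<close> attains its norm at its leading coefficient. So no step of the
  division algorithm increases the norm.\<close>

lemma gauss_mod_le: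
  assumes "g \<noteq> 0" and lead: "nrm (lead_coeff g) * \<rho> ^ degree g = gauss g"
  shows "gauss (f mod g) \<le> gauss f"
proof (induction "if f = 0 then 0 else Suc (degree f)" arbitrary: f rule: less_induct)
  case less
  show ?case
  proof (cases "f = 0 \<or> degree f < degree g")
    case True
    then show ?thesis by (auto simp: mod_poly_less)
  next
    case False
    define m where "m = monom (lead_coeff f / lead_coeff g) (degree f - degree g)"
    define f' where "f' = f - m * g"
    have "lead_coeff f / lead_coeff g \<noteq> 0" using False assms(1) by auto
    then have m: "m \<noteq> 0" "degree m = degree f - degree g"
      unfolding m_def by (simp_all only: monom_eq_0_iff degree_monom_eq not_False_eq_True)
    have deg: "degree (m * g) = degree f" using m assms(1) False by (simp add: degree_mult_eq)
    have lc: "lead_coeff (m * g) = lead_coeff f"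
      using assms(1) unfolding lead_coeff_mult m(2) by (simp add: m_def)
    have cf: "coeff f' (degree f) = 0" using deg lc by (simp add: f'_def)
    have "degree f' \<le> degree f" using deg by (simp add: f'_def degree_diff_le)
    then have dec: "f' = 0 \<or> degree f' < degree f"
      using cf by (metis le_neq_implies_less leading_coeff_0_iff)
    have "gauss m \<le> nrm (lead_coeff f / lead_coeff g) * \<rho> ^ (degree f - degree g)"
      by (rule gauss_leI) (use rho_pos in \<open>auto simp: m_def\<close>)
    then have "gauss (m * g) \<le> nrm (lead_coeff f / lead_coeff g) * \<rho> ^ (degree f - degree g)
        * (nrm (lead_coeff g) * \<rho> ^ degree g)"
      unfolding gauss_mult lead by (intro mult_right_mono) auto
    also have "\<dots> = nrm (lead_coeff f) * (\<rho> ^ (degree f - degree g) * \<rho> ^ degree g)"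
      using assms(1) by (simp add: nrm_divide)
    also have "\<dots> = nrm (lead_coeff f) * \<rho> ^ degree f"
      using False by (simp flip: power_add)
    also have "\<dots> \<le> gauss f" by (rule coeff_le_gauss)
    finally have "gauss f' \<le> gauss f" using gauss_diff[of f "m * g"] by (simp add: f'_def)
    moreover have "gauss (f' mod g) \<le> gauss f'"
      by (rule less) (use False dec in auto)
    moreover have "f mod g = f' mod g"
      by (simp add: f'_def mod_diff_eq[symmetric, of f "m * g"] mod_mult_self2_is_0)
    ultimately show ?thesis by simp
  qed
qed

lemma gauss_div_le:
  assumes "g \<noteq> 0" and "nrm (lead_coeff g) * \<rho> ^ degree g = gauss g"
  shows "gauss (f div g) * gauss g \<le> gauss f"
proof -
  have "f div g * g = f - f mod g" by (simp add: minus_mod_eq_div_mult)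
  then have "gauss (f div g) * gauss g = gauss (f - f mod g)" by (metis gauss_mult)
  also have "\<dots> \<le> gauss f" using gauss_diff[of f "f mod g"] gauss_mod_le[OF assms, of f] by simp
  finally show ?thesis .
qed

text \<open>Newton's method for the equation \<open>F = G Q\<close>: if \<open>r = F mod G\<close> then
  \<open>F - (G + r) Q = - r (Q - 1)\<close>, which is smaller than \<open>r\<close> because \<open>Q\<close> is close to \<open>1\<close>. The target
  is a sequence \<open>F\<close>, so that a polynomial over the completion of \<open>'a\<close> can be treated through
  its approximations over \<open>'a\<close>; the drift of \<open>F\<close> is absorbed as long as it is of the size of the
  next error.\<close>

lemma hensel_sequences:
  fixes F :: "nat \<Rightarrow> 'a poly"
  assumes \<delta>: "0 < \<delta>" "\<delta> < 1" and M: "0 < M"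
    and F_norm: "\<And>i. gauss (F i) = M"
    and F_k: "nrm (coeff (F 0) k) * \<rho> ^ k = M"
    and F_high: "\<And>j. j > k \<Longrightarrow> nrm (coeff (F 0) j) * \<rho> ^ j \<le> \<delta> * M"
    and F_step: "\<And>i. gauss (F (Suc i) - F i) \<le> \<delta> ^ (i + 2) * M"
  obtains G Q where
    "\<And>i. degree (G i) = k" "\<And>i. coeff (G i) k = coeff (F 0) k"
    "\<And>i. gauss (G (Suc i) - G i) \<le> \<delta> ^ (i + 1) * M"
    "\<And>i. gauss (Q (Suc i) - Q i) \<le> \<delta> ^ (i + 1)"
    "\<And>i. gauss (F i - G i * Q i) \<le> \<delta> ^ (i + 1) * M"
    "\<And>i. degree (Q i) \<le> degree (F i) - k"
proof -
  define c where "c = coeff (F 0) k"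
  define G0 where "G0 = poly_cutoff (Suc k) (F 0)"
  \<comment> \<open>Each step adds the remainder. The degree stays \<open>k\<close> and so does the coefficient there, so
    every \<open>G i\<close> attains its norm at its leading coefficient, as the division bounds require.\<close>
  define G where "G = rec_nat G0 (\<lambda>i g. g + F i mod g)"
  define r where "r i = F i mod G i" for i
  have G_0: "G 0 = G0" and G_Suc: "G (Suc i) = G i + r i" for i by (simp_all add: G_def r_def)
  define Q where "Q i = F i div G i" for i
  have F_eq: "F i = G i * Q i + r i" for i by (simp add: Q_def r_def)
  have c: "nrm c * \<rho> ^ k = M" using F_k by (simp add: c_def)
  then have c0: "c \<noteq> 0" using M by auto
  have \<delta>_pow: "\<delta> ^ (i + 1) \<le> \<delta>" for i using \<delta> by (simp add: power_le_one mult_left_le)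
  have F0_G0: "gauss (F 0 - G0) \<le> \<delta> * M"
    by (rule gauss_leI) (use F_high \<delta> M in \<open>auto simp: G0_def coeff_poly_cutoff\<close>)
  have F_drift: "gauss (F i - F 0) \<le> \<delta> * M" for i
  proof (induction i)
    case (Suc i)
    have "gauss (F (Suc i) - F i) \<le> \<delta> * M"
      using F_step[of i] \<delta>_pow[of "Suc i"] M by (simp add: order_trans[OF _ mult_right_mono])
    then show ?case using Suc gauss_add[of "F (Suc i) - F i" "F i - F 0"] by simp
  qed (use \<delta> M in auto)
  have invariant: "degree (G i) = k \<and> coeff (G i) k = c \<and> gauss (G i - G0) \<le> \<delta> * M
      \<and> gauss (r i) \<le> \<delta> ^ (i + 1) * M" for i
  proof (induction i)
    case 0
    have "degree G0 \<le> k" by (rule degree_le) (simp add: G0_def coeff_poly_cutoff)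
    moreover have ck: "coeff G0 k = c" by (simp add: G0_def coeff_poly_cutoff c_def)
    ultimately have deg: "degree G0 = k" using c0 by (metis le_degree le_antisym)
    have "gauss G0 \<le> M"
      by (rule gauss_leI)
        (use coeff_le_gauss[of "F 0"] F_norm[of 0] M in \<open>auto simp: G0_def coeff_poly_cutoff\<close>)
    moreover have "M \<le> gauss G0" using coeff_le_gauss[of G0 k] ck c by simp
    ultimately have g: "gauss G0 = M" by simp
    have "r 0 = (F 0 - G0) mod G0" unfolding r_def G_0 by simp
    then have "gauss (r 0) \<le> gauss (F 0 - G0)"
      using gauss_mod_le[of G0 "F 0 - G0"] ck c c0 deg g by auto
    then show ?case using F0_G0 deg ck G_0 \<delta> M by simp
  next
    case (Suc i)
    then have IH: "degree (G i) = k" "coeff (G i) k = c" "gauss (G i - G0) \<le> \<delta> * M"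
      "gauss (r i) \<le> \<delta> ^ (i + 1) * M" by auto
    have Gi: "G i \<noteq> 0" using IH(2) c0 by auto
    have near: "gauss (F i - G i) \<le> \<delta> * M"
    proof -
      have "F i - G i = (F i - F 0) + ((F 0 - G0) - (G i - G0))" by simp
      then have "gauss (F i - G i) \<le> max (gauss (F i - F 0)) (gauss ((F 0 - G0) - (G i - G0)))"
        using gauss_add by metis
      then show ?thesis
        using F_drift[of i] F0_G0 IH(3) gauss_diff[of "F 0 - G0" "G i - G0"] by linarith
    qed
    have \<delta>M: "\<delta> * M < M" using \<delta> M by simp
    then have "gauss (- (F i - G i)) < gauss (F i)"
      using near F_norm[of i] by (simp only: gauss_uminus)
    from gauss_add_dominant[OF this] have Gi_norm: "gauss (G i) = M"
      using F_norm[of i] by simp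
    have deg_r: "degree (r i) < k \<or> r i = 0"
      using degree_mod_less[OF Gi, of "F i"] IH(1) by (auto simp: r_def)
    have rk: "coeff (r i) k = 0" using deg_r by (auto simp: coeff_eq_0)
    have deg': "degree (G (Suc i)) = k"
    proof -
      have "degree (G (Suc i)) \<le> k" using deg_r IH(1) by (auto simp: G_Suc intro: degree_add_le)
      moreover have "coeff (G (Suc i)) k \<noteq> 0" using IH(2) rk c0 by (simp add: G_Suc)
      ultimately show ?thesis by (simp add: le_antisym le_degree)
    qed
    have ck': "coeff (G (Suc i)) k = c" using IH(2) rk by (simp add: G_Suc)
    have r_small: "gauss (r i) \<le> \<delta> * M"
      using IH(4) \<delta>_pow[of i] M by (meson mult_right_mono order_less_imp_le order_trans)
    have drift': "gauss (G (Suc i) - G0) \<le> \<delta> * M"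
    proof -
      have eq: "G (Suc i) - G0 = (G i - G0) + r i" by (simp add: G_Suc)
      show ?thesis unfolding eq using gauss_add[of "G i - G0" "r i"] IH(3) r_small by linarith
    qed
    have norm': "gauss (G (Suc i)) = M"
      using gauss_add_dominant[of "r i" "G i"] Gi_norm r_small \<delta>M
      unfolding G_Suc by linarith
    have Q1: "gauss (Q i - 1) \<le> \<delta>"
    proof -
      have "Q i - 1 = (F i - G i) div G i"
        using Gi by (simp add: Q_def poly_div_diff_left)
      then have "gauss (Q i - 1) * M \<le> \<delta> * M"
        using gauss_div_le[OF Gi, of "F i - G i"] near IH(1,2) c Gi_norm by simp
      then show ?thesis using M by simp
    qed
    \<comment> \<open>\<open>e\<close> is the new error before reduction: the drift of the target and a product of two small
      factors.\<close>
    define e where "e = (F (Suc i) - F i) - r i * (Q i - 1)"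
    have e: "F (Suc i) = Q i * G (Suc i) + e"
      using F_eq[of i] by (simp add: e_def G_Suc algebra_simps)
    have "gauss (r i * (Q i - 1)) \<le> (\<delta> ^ (i + 1) * M) * \<delta>"
      unfolding gauss_mult using IH(4) Q1 \<delta> M by (intro mult_mono) auto
    then have "gauss e \<le> \<delta> ^ (Suc i + 1) * M"
      unfolding e_def using gauss_diff[of "F (Suc i) - F i" "r i * (Q i - 1)"] F_step[of i]
      by (simp add: algebra_simps)
    moreover have "r (Suc i) = e mod G (Suc i)" by (simp add: r_def e)
    ultimately have "gauss (r (Suc i)) \<le> \<delta> ^ (Suc i + 1) * M"
      using gauss_mod_le[of "G (Suc i)" e] deg' ck' c c0 norm' by fastforce
    then show ?case using deg' ck' drift' by simp
  qed
  have G_norm: "gauss (G i) = M" for i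
  proof -
    have "gauss (G0 - G i) \<le> \<delta> * M" using invariant[of i] gauss_uminus[of "G i - G0"] by simp
    moreover have "\<delta> * M < M" using \<delta> M by simp
    moreover have "gauss (F 0 - G i) \<le> max (gauss (F 0 - G0)) (gauss (G0 - G i))"
      using gauss_add[of "F 0 - G0" "G0 - G i"] by simp
    ultimately have "gauss (- (F 0 - G i)) < gauss (F 0)" using F0_G0 F_norm[of 0] by (simp only: gauss_uminus)
    then show ?thesis using gauss_add_dominant[of "- (F 0 - G i)" "F 0"] F_norm[of 0] by simp
  qed
  have Q_step: "gauss (Q (Suc i) - Q i) \<le> \<delta> ^ (i + 1)" for i
  proof -
    have ne: "G (Suc i) \<noteq> 0" using invariant[of "Suc i"] c0 by auto
    have "(Q (Suc i) - Q i) * G (Suc i) = (F (Suc i) - F i) - r (Suc i) + (r i - Q i * (G (Suc i) - G i))"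
      using F_eq[of i] F_eq[of "Suc i"] by (simp add: algebra_simps)
    also have "r i - Q i * (G (Suc i) - G i) = - (r i * (Q i - 1))"
      by (simp add: G_Suc algebra_simps)
    finally have eq: "(Q (Suc i) - Q i) * G (Suc i) = (F (Suc i) - F i) - r (Suc i) + - (r i * (Q i - 1))" .
    have nQ: "gauss (Q i) \<le> 1"
    proof -
      have "gauss (Q i) * M \<le> M"
        using gauss_div_le[of "G i" "F i"] invariant[of i] c c0 G_norm[of i] F_norm[of i] by (auto simp: Q_def)
      then show ?thesis using M by simp
    qed
    have "gauss (Q i - 1) \<le> 1"
      using gauss_diff[of "Q i" 1] nQ by simp
    then have "gauss (r i * (Q i - 1)) \<le> (\<delta> ^ (i + 1) * M) * 1"
      unfolding gauss_mult using invariant[of i] \<delta> M by (intro mult_mono) auto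
    moreover have "\<delta> ^ (Suc i + 1) * M \<le> \<delta> ^ (i + 1) * M" using \<delta> M by (simp add: mult_left_le_one_le)
    ultimately have "gauss ((Q (Suc i) - Q i) * G (Suc i)) \<le> \<delta> ^ (i + 1) * M"
      unfolding eq
      using gauss_add[of "(F (Suc i) - F i) - r (Suc i)" "- (r i * (Q i - 1))"]
        gauss_diff[of "F (Suc i) - F i" "r (Suc i)"] F_step[of i] invariant[of "Suc i"]
      unfolding gauss_uminus by fastforce
    then show ?thesis using G_norm[of "Suc i"] M by (simp add: gauss_mult)
  qed
  have Q_deg: "degree (Q i) \<le> degree (F i) - k" for i
  proof (cases "Q i = 0")
    case False
    have G: "G i \<noteq> 0" "degree (G i) = k" using invariant[of i] c0 by auto
    have r: "r i = 0 \<or> degree (r i) < k" using degree_mod_less[OF G(1), of "F i"] G(2) by (auto simp: r_def)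
    have "degree (G i * Q i) = k + degree (Q i)" using G False by (simp add: degree_mult_eq)
    then have "degree (F i) = k + degree (Q i)"
      unfolding F_eq using r by (auto simp: degree_add_eq_left)
    then show ?thesis by simp
  qed auto
  show thesis
  proof (rule that[of G Q])
    fix i
    show "degree (G i) = k" "coeff (G i) k = coeff (F 0) k"
      using invariant[of i] by (simp_all add: c_def)
    show "gauss (G (Suc i) - G i) \<le> \<delta> ^ (i + 1) * M"
      unfolding G_Suc using invariant[of i] by simp
    have "F i - G i * Q i = r i" using F_eq[of i] by simp
    then show "gauss (F i - G i * Q i) \<le> \<delta> ^ (i + 1) * M" using invariant[of i] by simp
  qed (rule Q_step Q_deg)+
qed

end

section \<open>Cauchy sequences and null sequences\<close>

context nonarch_field begin

definition cauchy :: "(nat \<Rightarrow> 'a) \<Rightarrow> bool" where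
  "cauchy u \<longleftrightarrow> (\<forall>e>0. \<exists>N. \<forall>i\<ge>N. \<forall>j\<ge>N. nrm (u i - u j) < e)"

definition null :: "(nat \<Rightarrow> 'a) \<Rightarrow> bool" where
  "null u \<longleftrightarrow> (\<lambda>i. nrm (u i)) \<longlonglongrightarrow> 0"

lemma nrm_reverse_triangle: "\<bar>nrm x - nrm y\<bar> \<le> nrm (x - y)"
proof -
  have "max a b \<le> a + b" if "0 \<le> a" "0 \<le> b" for a b :: real using that by auto
  then have "nrm (x - y + y) \<le> nrm (x - y) + nrm y" "nrm (x - (x - y)) \<le> nrm x + nrm (x - y)"
    using nrm_add[of "x - y" y] nrm_diff[of x "x - y"] nrm_nonneg order_trans by blast+
  then show ?thesis by simp
qed

lemma nullI: "(\<And>e. e > 0 \<Longrightarrow> \<exists>N. \<forall>i\<ge>N. nrm (u i) < e) \<Longrightarrow> null u"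
  unfolding null_def lim_sequentially by (simp add: dist_real_def)

lemma nullD: "null u \<Longrightarrow> e > 0 \<Longrightarrow> \<exists>N. \<forall>i\<ge>N. nrm (u i) < e"
  unfolding null_def lim_sequentially by (simp add: dist_real_def)

lemma cauchyD:
  fixes e :: real assumes "cauchy u" "e > 0"
  shows "\<exists>N. \<forall>i j. N \<le> i \<longrightarrow> N \<le> j \<longrightarrow> nrm (u i - u j) < e"
proof -
  from assms obtain N where "\<forall>i\<ge>N. \<forall>j\<ge>N. nrm (u i - u j) < e" unfolding cauchy_def by auto
  then show ?thesis by (intro exI[of _ N]) simp
qed

lemma cauchy_const [simp]: "cauchy (\<lambda>_. c)"
  by (simp add: cauchy_def)

lemma null_zero [simp]: "null (\<lambda>_. 0)"
  by (simp add: null_def)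

lemma null_const_iff [simp]: "null (\<lambda>_. c) \<longleftrightarrow> c = 0"
  by (auto simp: null_def tendsto_const_iff)

lemma cauchy_add:
  assumes "cauchy u" "cauchy w" shows "cauchy (\<lambda>i. u i + w i)"
  unfolding cauchy_def
proof (intro allI impI)
  fix e :: real assume "e > 0"
  obtain M where MN1: "\<And>i j. i \<ge> M \<Longrightarrow> j \<ge> M \<Longrightarrow> nrm (u i - u j) < e"
    using cauchyD[OF assms(1) \<open>e > 0\<close>] by blast
  obtain N where MN2: "\<And>i j. i \<ge> N \<Longrightarrow> j \<ge> N \<Longrightarrow> nrm (w i - w j) < e"
    using cauchyD[OF assms(2) \<open>e > 0\<close>] by blast
  have "nrm (u i + w i - (u j + w j)) < e" if "i \<ge> max M N" "j \<ge> max M N" for i j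
    using nrm_add[of "u i - u j" "w i - w j"] MN1[of i j] MN2[of i j] that
    by (simp add: algebra_simps)
  then show "\<exists>N. \<forall>i\<ge>N. \<forall>j\<ge>N. nrm (u i + w i - (u j + w j)) < e" by blast
qed

lemma cauchy_uminus: "cauchy u \<Longrightarrow> cauchy (\<lambda>i. - u i)"
  unfolding cauchy_def by (metis minus_diff_minus nrm_uminus)

lemma cauchy_bounded:
  assumes "cauchy u" obtains B where "B > 0" "\<And>i. nrm (u i) \<le> B"
proof -
  obtain N where N: "\<And>i j. i \<ge> N \<Longrightarrow> j \<ge> N \<Longrightarrow> nrm (u i - u j) < 1"
    using cauchyD[OF assms(1), of 1] by auto
  define B where "B = Max ((\<lambda>i. nrm (u i)) ` {..N}) + 1"
  have le: "nrm (u i) \<le> B - 1" if "i \<le> N" for i unfolding B_def using that by simp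
  have "B > 0" using le[of 0] nrm_nonneg[of "u 0"] by linarith
  moreover have "nrm (u i) \<le> B" for i
  proof (cases "i \<le> N")
    case False
    then have "nrm (u i) \<le> max (nrm (u i - u N)) (nrm (u N))" using nrm_add[of "u i - u N" "u N"] by simp
    moreover have "nrm (u i - u N) < 1" using N False by simp
    moreover have "1 \<le> B" using le[of N] nrm_nonneg[of "u N"] by linarith
    ultimately show ?thesis using le[of N] by simp
  qed (use le[of i] in simp)
  ultimately show ?thesis using that by blast
qed

lemma cauchy_mult:
  assumes "cauchy u" "cauchy w" shows "cauchy (\<lambda>i. u i * w i)"
  unfolding cauchy_def
proof (intro allI impI)
  fix e :: real assume e: "e > 0"
  obtain B where B: "B > 0" "\<And>i. nrm (u i) \<le> B" using cauchy_bounded assms by blast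
  obtain C where C: "C > 0" "\<And>i. nrm (w i) \<le> C" using cauchy_bounded assms by blast
  have eC: "e / C > 0" and eB: "e / B > 0" using e B C by simp_all
  obtain M where M: "\<And>i j. i \<ge> M \<Longrightarrow> j \<ge> M \<Longrightarrow> nrm (u i - u j) < e / C"
    using cauchyD[OF assms(1) eC] by blast
  obtain N where N: "\<And>i j. i \<ge> N \<Longrightarrow> j \<ge> N \<Longrightarrow> nrm (w i - w j) < e / B"
    using cauchyD[OF assms(2) eB] by blast
  have "nrm (u i * w i - u j * w j) < e" if "i \<ge> max M N" "j \<ge> max M N" for i j
  proof -
    have "nrm ((u i - u j) * w i) \<le> nrm (u i - u j) * C"
      unfolding nrm_mult using C by (intro mult_left_mono) auto
    also have "\<dots> < e / C * C" using M[of i j] that C by (intro mult_strict_right_mono) auto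
    finally have 1: "nrm ((u i - u j) * w i) < e" using C by simp
    have "nrm (u j * (w i - w j)) \<le> B * nrm (w i - w j)"
      unfolding nrm_mult using B by (intro mult_right_mono) auto
    also have "\<dots> < B * (e / B)" using N[of i j] that B by (intro mult_strict_left_mono) auto
    finally have 2: "nrm (u j * (w i - w j)) < e" using B by simp
    have "u i * w i - u j * w j = (u i - u j) * w i + u j * (w i - w j)" by (simp add: algebra_simps)
    then show ?thesis using nrm_add[of "(u i - u j) * w i" "u j * (w i - w j)"] 1 2 by simp
  qed
  then show "\<exists>N. \<forall>i\<ge>N. \<forall>j\<ge>N. nrm (u i * w i - u j * w j) < e" by blast
qed

lemma null_imp_cauchy:
  assumes "null u" shows "cauchy u"
  unfolding cauchy_def
proof (intro allI impI)
  fix e :: real assume "e > 0"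
  then obtain N where "\<And>i. i \<ge> N \<Longrightarrow> nrm (u i) < e" using nullD[OF assms] by blast
  then have "nrm (u i - u j) < e" if "i \<ge> N" "j \<ge> N" for i j
    using nrm_diff[of "u i" "u j"] that by (smt (verit))
  then show "\<exists>N. \<forall>i\<ge>N. \<forall>j\<ge>N. nrm (u i - u j) < e" by blast
qed

lemma null_add:
  assumes "null u" "null w" shows "null (\<lambda>i. u i + w i)"
proof (rule nullI)
  fix e :: real assume "e > 0"
  obtain M where M: "\<And>i. i \<ge> M \<Longrightarrow> nrm (u i) < e" using nullD[OF assms(1) \<open>e > 0\<close>] by blast
  obtain N where N: "\<And>i. i \<ge> N \<Longrightarrow> nrm (w i) < e" using nullD[OF assms(2) \<open>e > 0\<close>] by blast
  have "nrm (u i + w i) < e" if "i \<ge> max M N" for i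
    using nrm_add[of "u i" "w i"] M[of i] N[of i] that by auto
  then show "\<exists>N. \<forall>i\<ge>N. nrm (u i + w i) < e" by blast
qed

lemma null_uminus: "null u \<Longrightarrow> null (\<lambda>i. - u i)"
  by (simp add: null_def)

lemma null_mult:
  assumes "cauchy u" "null w" shows "null (\<lambda>i. u i * w i)"
proof -
  obtain B where B: "B > 0" "\<And>i. nrm (u i) \<le> B" using cauchy_bounded assms by blast
  have "(\<lambda>i. B * nrm (w i)) \<longlonglongrightarrow> B * 0"
    using assms(2) unfolding null_def by (intro tendsto_intros)
  then have "(\<lambda>i. B * nrm (w i)) \<longlonglongrightarrow> 0" by simp
  moreover have "nrm (u i * w i) \<le> B * nrm (w i)" for i
    unfolding nrm_mult using B by (intro mult_right_mono) auto
  ultimately show ?thesis unfolding null_def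
    using real_tendsto_sandwich[of "\<lambda>_. 0" "\<lambda>i. nrm (u i * w i)" sequentially "\<lambda>i. B * nrm (w i)" 0]
    by simp
qed

lemma cauchy_sum: "(\<And>k. k \<in> I \<Longrightarrow> cauchy (f k)) \<Longrightarrow> cauchy (\<lambda>i. \<Sum>k\<in>I. f k i)"
proof (induction I rule: infinite_finite_induct)
  case (insert k I)
  then show ?case using cauchy_add[of "f k" "\<lambda>i. \<Sum>k\<in>I. f k i"] by simp
qed simp_all

lemma nrm_convergent:
  assumes "cauchy u" shows "(\<lambda>i. nrm (u i)) \<longlonglongrightarrow> lim (\<lambda>i. nrm (u i))"
proof -
  have "Cauchy (\<lambda>i. nrm (u i))"
    unfolding Cauchy_def dist_real_def
  proof (intro allI impI)
    fix e :: real assume "e > 0"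
    then obtain N where "\<And>i j. i \<ge> N \<Longrightarrow> j \<ge> N \<Longrightarrow> nrm (u i - u j) < e"
      using cauchyD[OF assms] by blast
    then have "\<forall>i\<ge>N. \<forall>j\<ge>N. \<bar>nrm (u i) - nrm (u j)\<bar> < e"
      using order_le_less_trans[OF nrm_reverse_triangle] by simp
    then show "\<exists>N. \<forall>i\<ge>N. \<forall>j\<ge>N. \<bar>nrm (u i) - nrm (u j)\<bar> < e" by (intro exI[of _ N])
  qed
  then show ?thesis by (simp add: Cauchy_convergent_iff convergent_LIMSEQ_iff)
qed

text \<open>Once the terms are closer to each other than they are to zero, the ultrametric inequality
  makes their norms equal.\<close>

lemma nrm_eventually_constant:
  assumes u: "cauchy u" "\<not> null u"
  obtains c N where "c > 0" "\<And>i. i \<ge> N \<Longrightarrow> nrm (u i) = c"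
proof -
  define L where "L = lim (\<lambda>i. nrm (u i))"
  have lim: "(\<lambda>i. nrm (u i)) \<longlonglongrightarrow> L" unfolding L_def by (rule nrm_convergent[OF u(1)])
  have "L \<ge> 0" by (rule LIMSEQ_le_const[OF lim]) auto
  then have L: "L > 0" using lim u(2) unfolding null_def by (cases "L = 0") auto
  obtain M where M: "\<And>i. i \<ge> M \<Longrightarrow> nrm (u i) > L / 2"
    using order_tendstoD(1)[OF lim, of "L / 2"] L unfolding eventually_sequentially by auto
  obtain N where N: "\<And>i j. i \<ge> N \<Longrightarrow> j \<ge> N \<Longrightarrow> nrm (u i - u j) < L / 2"
    using cauchyD[OF u(1), of "L / 2"] L by auto
  define c where "c = nrm (u (max M N))"
  have "nrm (u i) = c" if "i \<ge> max M N" for i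
  proof -
    have "nrm (u i - u (max M N)) < nrm (u (max M N))"
      using N[of i "max M N"] M[of "max M N"] that by simp
    from nrm_add_dominant[OF this] show ?thesis by (simp add: c_def)
  qed
  moreover have "c > 0" using M[of "max M N"] L by (simp add: c_def)
  ultimately show ?thesis using that by blast
qed

lemma cauchy_inverse:
  assumes u: "cauchy u" "\<not> null u"
  obtains w where "cauchy w" "null (\<lambda>i. u i * w i - 1)"
proof -
  obtain c M where c: "c > 0" "\<And>i. i \<ge> M \<Longrightarrow> nrm (u i) = c" using nrm_eventually_constant[OF u] by blast
  have ne: "u i \<noteq> 0" if "i \<ge> M" for i using c(2)[OF that] c(1) by auto
  have "cauchy (\<lambda>i. inverse (u i))"
    unfolding cauchy_def
  proof (intro allI impI)
    fix e :: real assume "e > 0"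
    then have "e * (c * c) > 0" using c(1) by simp
    then obtain N where N: "\<And>i j. i \<ge> N \<Longrightarrow> j \<ge> N \<Longrightarrow> nrm (u i - u j) < e * (c * c)"
      using cauchyD[OF u(1)] by blast
    have "nrm (inverse (u i) - inverse (u j)) < e" if "i \<ge> max M N" "j \<ge> max M N" for i j
    proof -
      have "inverse (u i) - inverse (u j) = (u j - u i) / (u i * u j)"
        using ne[of i] ne[of j] that by (simp add: field_simps)
      then have "nrm (inverse (u i) - inverse (u j)) = nrm (u j - u i) / (c * c)"
        using c(2)[of i] c(2)[of j] that by (simp add: nrm_divide nrm_mult)
      also have "\<dots> < e" using N[of j i] that c(1) by (simp add: pos_divide_less_eq)
      finally show ?thesis .
    qed
    then show "\<exists>N. \<forall>i\<ge>N. \<forall>j\<ge>N. nrm (inverse (u i) - inverse (u j)) < e" by blast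
  qed
  moreover have "null (\<lambda>i. u i * inverse (u i) - 1)"
    by (rule nullI) (use ne in \<open>auto intro!: exI[of _ M]\<close>)
  ultimately show ?thesis using that by blast
qed

lemma cauchy_of_geometric_steps:
  assumes "0 < \<delta>" "\<delta> < 1" and step: "\<And>i. nrm (u (Suc i) - u i) \<le> C * \<delta> ^ i"
  shows "cauchy u"
  unfolding cauchy_def
proof (intro allI impI)
  fix e :: real assume e: "e > 0"
  have "(\<lambda>i. C * \<delta> ^ i) \<longlonglongrightarrow> C * 0"
    using assms by (intro tendsto_intros LIMSEQ_realpow_zero) auto
  then obtain N where N: "\<And>i. i \<ge> N \<Longrightarrow> C * \<delta> ^ i < e"
    using e order_tendstoD(2)[of "\<lambda>i. C * \<delta> ^ i" 0 sequentially e] unfolding eventually_sequentially by auto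
  have near: "nrm (u (N + k) - u N) < e" for k
  proof (induction k)
    case (Suc k)
    have "nrm (u (Suc (N + k)) - u (N + k)) < e" using step[of "N + k"] N[of "N + k"] by simp
    then show ?case
      using nrm_add[of "u (Suc (N + k)) - u (N + k)" "u (N + k) - u N"] Suc by simp
  qed (use e in simp)
  have "nrm (u i - u j) < e" if "i \<ge> N" "j \<ge> N" for i j
    using nrm_diff[of "u i - u N" "u j - u N"] near[of "i - N"] near[of "j - N"] that by simp
  then show "\<exists>N. \<forall>i\<ge>N. \<forall>j\<ge>N. nrm (u i - u j) < e" by blast
qed

lemma null_subsequence_diff:
  assumes "cauchy u" "\<And>i. i \<le> s i"
  shows "null (\<lambda>i. u (s i) - u i)"
proof (rule nullI)
  fix e :: real assume "e > 0"
  then obtain N where N: "\<And>i j. i \<ge> N \<Longrightarrow> j \<ge> N \<Longrightarrow> nrm (u i - u j) < e"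
    using cauchyD[OF assms(1)] by blast
  have "nrm (u (s i) - u i) < e" if "i \<ge> N" for i
    using N[of "s i" i] assms(2)[of i] that by simp
  then show "\<exists>N. \<forall>i\<ge>N. nrm (u (s i) - u i) < e" by blast
qed

lemma cauchy_of_null_diff: "cauchy u \<Longrightarrow> null (\<lambda>i. w i - u i) \<Longrightarrow> cauchy w"
  using cauchy_add[of u "\<lambda>i. w i - u i"] null_imp_cauchy by simp

end

section \<open>Polynomials over a completion and their approximations\<close>

text \<open>A map \<open>\<psi>\<close> that sends Cauchy sequences to elements of a field, compatibly with the operations and
  with the null sequences as kernel, identifies the completion with the subfield \<open>F\<close> of its
  values. Everything about the completion can then be said inside \<open>L\<close>, which may be any extension
  of it, and the norm is only needed on sequences.\<close>

locale completion_embedding = nonarch_field nrm + field L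
  for nrm :: "'a::field \<Rightarrow> real" and L :: "('b, 'c) ring_scheme" (structure) +
  fixes \<psi> :: "(nat \<Rightarrow> 'a) \<Rightarrow> 'b"
  assumes \<psi>_closed [simp]: "cauchy u \<Longrightarrow> \<psi> u \<in> carrier L"
    and \<psi>_add: "cauchy u \<Longrightarrow> cauchy w \<Longrightarrow> \<psi> (\<lambda>i. u i + w i) = \<psi> u \<oplus> \<psi> w"
    and \<psi>_mult: "cauchy u \<Longrightarrow> cauchy w \<Longrightarrow> \<psi> (\<lambda>i. u i * w i) = \<psi> u \<otimes> \<psi> w"
    and \<psi>_one: "\<psi> (\<lambda>_. 1) = \<one>"
    and \<psi>_zero_iff: "cauchy u \<Longrightarrow> \<psi> u = \<zero> \<longleftrightarrow> null u"
begin

definition F :: "'b set" where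
  "F = \<psi> ` {u. cauchy u}"

lemma \<psi>_in_F [simp]: "cauchy u \<Longrightarrow> \<psi> u \<in> F"
  by (simp add: F_def)

lemma F_E: assumes "y \<in> F" obtains u where "cauchy u" "\<psi> u = y"
  using assms by (auto simp: F_def)

lemma \<psi>_zero: "\<psi> (\<lambda>_. 0) = \<zero>"
  by (simp add: \<psi>_zero_iff)

lemma \<psi>_uminus: assumes "cauchy u" shows "\<psi> (\<lambda>i. - u i) = \<ominus> \<psi> u"
proof -
  have "\<psi> (\<lambda>i. - u i) \<oplus> \<psi> u = \<psi> (\<lambda>i. - u i + u i)"
    using assms cauchy_uminus by (intro \<psi>_add[symmetric]) auto
  also have "\<dots> = \<zero>" by (simp add: \<psi>_zero)
  finally show ?thesis using assms cauchy_uminus[OF assms] by (intro minus_equality[symmetric]) auto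
qed

lemma \<psi>_eqI:
  assumes "cauchy u" "null (\<lambda>i. w i - u i)" shows "\<psi> w = \<psi> u"
proof -
  have n: "cauchy (\<lambda>i. w i - u i)" using null_imp_cauchy[OF assms(2)] .
  have "\<psi> w = \<psi> (\<lambda>i. (w i - u i) + u i)" by simp
  also have "\<dots> = \<psi> (\<lambda>i. w i - u i) \<oplus> \<psi> u" by (rule \<psi>_add[OF n assms(1)])
  also have "\<psi> (\<lambda>i. w i - u i) = \<zero>" using \<psi>_zero_iff[OF n] assms(2) by simp
  finally show ?thesis using assms(1) by simp
qed

lemma null_diff_of_\<psi>_eq:
  assumes "cauchy u" "cauchy w" "\<psi> w = \<psi> u" shows "null (\<lambda>i. w i - u i)"
proof -
  have c: "cauchy (\<lambda>i. w i + - u i)" by (intro cauchy_add cauchy_uminus assms)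
  have "\<psi> (\<lambda>i. w i + - u i) = \<psi> w \<oplus> \<ominus> \<psi> u"
    using \<psi>_add[OF assms(2) cauchy_uminus[OF assms(1)]] \<psi>_uminus[OF assms(1)] by simp
  also have "\<dots> = \<zero>" using assms by (simp add: r_neg)
  finally show ?thesis using \<psi>_zero_iff[OF c] by simp
qed

lemma \<psi>_sum:
  assumes "finite I" "\<And>k. k \<in> I \<Longrightarrow> cauchy (f k)"
  shows "\<psi> (\<lambda>i. \<Sum>k\<in>I. f k i) = (\<Oplus>k\<in>I. \<psi> (f k))"
  using assms
proof (induction I rule: finite_induct)
  case (insert k I)
  have "\<psi> (\<lambda>i. f k i + (\<Sum>k\<in>I. f k i)) = \<psi> (f k) \<oplus> \<psi> (\<lambda>i. \<Sum>k\<in>I. f k i)"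
    by (intro \<psi>_add cauchy_sum insert.prems) auto
  then show ?case using insert by (simp add: Pi_def)
qed (simp add: \<psi>_zero)

lemma subfield_F: "subfield F L"
proof (rule subfieldI'[OF subringI])
  show "F \<subseteq> carrier L" by (auto simp: F_def)
  show "\<one> \<in> F" using \<psi>_one \<psi>_in_F[of "\<lambda>_. 1"] by simp
next
  fix x assume "x \<in> F"
  then obtain u where "cauchy u" "\<psi> u = x" by (rule F_E)
  then show "\<ominus> x \<in> F" using \<psi>_uminus \<psi>_in_F[OF cauchy_uminus] by metis
next
  fix x y assume "x \<in> F" "y \<in> F"
  then obtain u w where uw: "cauchy u" "\<psi> u = x" "cauchy w" "\<psi> w = y" by (metis F_E)
  show "x \<otimes> y \<in> F" using uw \<psi>_mult[OF uw(1,3)] \<psi>_in_F[OF cauchy_mult[OF uw(1,3)]] by simp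
  show "x \<oplus> y \<in> F" using uw \<psi>_add[OF uw(1,3)] \<psi>_in_F[OF cauchy_add[OF uw(1,3)]] by simp
next
  fix x assume "x \<in> F - {\<zero>}"
  then obtain u where u: "cauchy u" "\<psi> u = x" "\<not> null u" using F_E \<psi>_zero_iff by (metis DiffE singletonI)
  obtain w where w: "cauchy w" "null (\<lambda>i. u i * w i - 1)" using cauchy_inverse[OF u(1,3)] .
  have "\<psi> (\<lambda>i. u i * w i) = \<psi> (\<lambda>_. 1)" by (rule \<psi>_eqI) (use w in auto)
  then have "x \<otimes> \<psi> w = \<one>" using \<psi>_mult[OF u(1) w(1)] u(2) \<psi>_one by simp
  moreover have "x \<in> carrier L" using u by auto
  ultimately have "inv x = \<psi> w" using w(1) comm_inv_char by auto
  then show "inv x \<in> F" using w(1) by simp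
qed

lemma subring_F: "subring F L"
  using subfieldE(1)[OF subfield_F] .

text \<open>The norm of an element of the completion is the limit along any representing sequence.\<close>

definition cnrm :: "'b \<Rightarrow> real" where
  "cnrm y = lim (\<lambda>i. nrm ((SOME u. cauchy u \<and> \<psi> u = y) i))"

lemma nrm_tendsto_cnrm:
  assumes u: "cauchy u" shows "(\<lambda>i. nrm (u i)) \<longlonglongrightarrow> cnrm (\<psi> u)"
proof -
  define w where "w = (SOME w. cauchy w \<and> \<psi> w = \<psi> u)"
  have w: "cauchy w \<and> \<psi> w = \<psi> u" unfolding w_def by (rule someI[of _ u]) (use u in simp)
  have lim: "(\<lambda>i. nrm (w i)) \<longlonglongrightarrow> cnrm (\<psi> u)"
    unfolding cnrm_def w_def[symmetric] by (rule nrm_convergent) (use w in simp)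
  have "null (\<lambda>i. u i - w i)" using null_diff_of_\<psi>_eq[of w u] w u by simp
  then have "(\<lambda>i. nrm (u i - w i)) \<longlonglongrightarrow> 0" unfolding null_def .
  then have "(\<lambda>i. nrm (u i) - nrm (w i)) \<longlonglongrightarrow> 0"
    by (rule tendsto_0_le[of _ _ _ 1]) (simp add: nrm_reverse_triangle)
  from tendsto_add[OF this lim] show ?thesis by simp
qed

lemma cnrm_unique: "cauchy u \<Longrightarrow> (\<lambda>i. nrm (u i)) \<longlonglongrightarrow> c \<Longrightarrow> cnrm (\<psi> u) = c"
  by (rule LIMSEQ_unique[OF nrm_tendsto_cnrm])

lemma cnrm_nonneg: assumes "y \<in> F" shows "0 \<le> cnrm y"
proof -
  obtain u where u: "cauchy u" "\<psi> u = y" using assms by (rule F_E)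
  show ?thesis using LIMSEQ_le_const[OF nrm_tendsto_cnrm[OF u(1)], of 0] u(2) by auto
qed

lemma cnrm_const [simp]: "cnrm (\<psi> (\<lambda>_. c)) = nrm c"
  by (rule cnrm_unique) auto

lemma cnrm_zero [simp]: "cnrm \<zero> = 0"
  using cnrm_const[of 0] by (simp add: \<psi>_zero)

lemma cnrm_one [simp]: "cnrm \<one> = 1"
  using cnrm_const[of 1] by (simp add: \<psi>_one)

lemma cnrm_pos: assumes "y \<in> F" "y \<noteq> \<zero>" shows "0 < cnrm y"
proof -
  obtain u where u: "cauchy u" "\<psi> u = y" using assms by (metis F_E)
  have "\<not> null u" using u assms(2) \<psi>_zero_iff by blast
  obtain c N where c: "c > 0" "\<And>i. i \<ge> N \<Longrightarrow> nrm (u i) = c"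
    using nrm_eventually_constant[OF u(1) \<open>\<not> null u\<close>] by blast
  have "(\<lambda>i. nrm (u i)) \<longlonglongrightarrow> c"
    by (rule tendsto_eventually) (use c in \<open>auto simp: eventually_sequentially\<close>)
  then show ?thesis using cnrm_unique[OF u(1)] u(2) c(1) by simp
qed

lemma nrm_eventually_eq_cnrm:
  assumes u: "cauchy u" "\<psi> u \<noteq> \<zero>" shows "\<forall>\<^sub>F i in sequentially. nrm (u i) = cnrm (\<psi> u)"
proof -
  have "\<not> null u" using u \<psi>_zero_iff by blast
  obtain c N where c: "c > 0" "\<And>i. i \<ge> N \<Longrightarrow> nrm (u i) = c"
    using nrm_eventually_constant[OF u(1) \<open>\<not> null u\<close>] by blast
  have ev: "\<forall>\<^sub>F i in sequentially. nrm (u i) = c" using c by (auto simp: eventually_sequentially)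
  then have "cnrm (\<psi> u) = c" by (intro cnrm_unique[OF u(1)] tendsto_eventually)
  then show ?thesis using ev by simp
qed

text \<open>Through such sequences, division with remainder and Gauss norms are only needed for polynomials
  over \<open>'a\<close>.\<close>

definition approx :: "(nat \<Rightarrow> 'a poly) \<Rightarrow> 'b list \<Rightarrow> bool" where
  "approx S P \<longleftrightarrow> (\<forall>j. cauchy (\<lambda>i. poly.coeff (S i) j) \<and> \<psi> (\<lambda>i. poly.coeff (S i) j) = coeff P j)"

lemma F_poly_in_carrier: "P \<in> carrier (F[X]) \<Longrightarrow> set P \<subseteq> carrier L"
  by (rule polynomial_in_carrier[OF subring_F]) (simp add: univ_poly_carrier)

lemma F_poly_coeff: "P \<in> carrier (F[X]) \<Longrightarrow> coeff P j \<in> F"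
proof -
  assume "P \<in> carrier (F[X])"
  then have "set P \<subseteq> F" using polynomial_incl[of F P] by (simp add: univ_poly_carrier)
  moreover have "coeff P j \<in> set P \<union> {\<zero>}" unfolding coeff_img(3)[of P, symmetric] by (rule rangeI)
  ultimately show ?thesis using subringE(2)[OF subring_F] by auto
qed

lemma approx_unique:
  assumes "approx S P" "approx S R" "P \<in> carrier (F[X])" "R \<in> carrier (F[X])" shows "P = R"
proof -
  have "coeff P j = coeff R j" for j using assms(1,2) unfolding approx_def by (metis (no_types))
  then have "coeff P = coeff R" by (rule ext)
  then show ?thesis using coeff_iff_polynomial_cond[of F P R] assms(3,4) by (simp add: univ_poly_carrier)
qed

lemma approx_null_diff:
  assumes "approx S P" "\<And>j. null (\<lambda>i. poly.coeff (T i) j - poly.coeff (S i) j)"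
  shows "approx T P"
  unfolding approx_def
proof
  fix j
  have S: "cauchy (\<lambda>i. poly.coeff (S i) j)" "\<psi> (\<lambda>i. poly.coeff (S i) j) = coeff P j"
    using assms(1) unfolding approx_def by blast+
  show "cauchy (\<lambda>i. poly.coeff (T i) j) \<and> \<psi> (\<lambda>i. poly.coeff (T i) j) = coeff P j"
    using cauchy_of_null_diff[OF S(1) assms(2)] \<psi>_eqI[OF S(1) assms(2)] S(2) by simp
qed

lemma approx_mult:
  assumes S: "approx S P" and T: "approx T R" and P: "P \<in> carrier (F[X])" and R: "R \<in> carrier (F[X])"
  shows "approx (\<lambda>i. S i * T i) (P \<otimes>\<^bsub>F[X]\<^esub> R)"
  unfolding approx_def
proof
  fix j
  have c: "cauchy (\<lambda>i. poly.coeff (S i) k * poly.coeff (T i) (j - k))" for k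
    using S T unfolding approx_def by (intro cauchy_mult) auto
  have eq: "\<psi> (\<lambda>i. poly.coeff (S i) k * poly.coeff (T i) (j - k)) = coeff P k \<otimes> coeff R (j - k)" for k
    using S T \<psi>_mult[of "\<lambda>i. poly.coeff (S i) k" "\<lambda>i. poly.coeff (T i) (j - k)"] unfolding approx_def by simp
  have "cauchy (\<lambda>i. \<Sum>k\<le>j. poly.coeff (S i) k * poly.coeff (T i) (j - k))"
    by (intro cauchy_sum c)
  moreover have "\<psi> (\<lambda>i. \<Sum>k\<le>j. poly.coeff (S i) k * poly.coeff (T i) (j - k)) = coeff (P \<otimes>\<^bsub>F[X]\<^esub> R) j"
    using poly_mult_coeff[OF F_poly_in_carrier[OF P] F_poly_in_carrier[OF R]]
    by (subst \<psi>_sum) (auto simp: c eq univ_poly_mult)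
  ultimately show "cauchy (\<lambda>i. poly.coeff (S i * T i) j) \<and> \<psi> (\<lambda>i. poly.coeff (S i * T i) j) = coeff (P \<otimes>\<^bsub>F[X]\<^esub> R) j"
    by (simp add: coeff_mult)
qed

lemma coeff_map_rev_upt: "coeff (map f (rev [0..<n])) j = (if j < n then f j else \<zero>)"
  by (induction n) (auto simp: less_Suc_eq)

lemma approx_limit_exists:
  assumes "\<And>j. cauchy (\<lambda>i. poly.coeff (S i) j)" "\<And>i. Polynomial.degree (S i) \<le> D"
  obtains P where "P \<in> carrier (F[X])" "approx S P" "length P \<le> Suc D"
proof -
  define P where "P = normalize (map (\<lambda>j. \<psi> (\<lambda>i. poly.coeff (S i) j)) (rev [0..<Suc D]))"
  have "P \<in> carrier (F[X])"
    unfolding P_def univ_poly_carrier[symmetric] by (rule normalize_gives_polynomial) (use assms in auto)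
  moreover have "length P \<le> Suc D"
    unfolding P_def using normalize_length_le[of "map (\<lambda>j. \<psi> (\<lambda>i. poly.coeff (S i) j)) (rev [0..<Suc D])"] by simp
  moreover have "approx S P"
    unfolding approx_def
  proof
    fix j
    have "coeff P j = (if j < Suc D then \<psi> (\<lambda>i. poly.coeff (S i) j) else \<zero>)"
      unfolding P_def normalize_coeff[symmetric] by (rule coeff_map_rev_upt)
    moreover have "poly.coeff (S i) j = 0" if "\<not> j < Suc D" for i
      using assms(2)[of i] that by (intro coeff_eq_0) simp
    ultimately show "cauchy (\<lambda>i. poly.coeff (S i) j) \<and> \<psi> (\<lambda>i. poly.coeff (S i) j) = coeff P j"
      using assms(1) by (auto simp: \<psi>_zero)
  qed
  ultimately show ?thesis using that by blast
qed

text \<open>The approximations are made monic, so that their degree does not depend on the index and the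
  leading coefficient survives in products.\<close>

lemma approx_exists:
  assumes P: "P \<in> carrier (F[X])" "P \<noteq> []" "hd P = \<one>"
  obtains S where "approx S P" "\<And>i. Polynomial.degree (S i) = length P - 1"
    "\<And>i. poly.coeff (S i) (length P - 1) = 1"
proof -
  define d where "d = length P - 1"
  define u where "u j = (SOME u. cauchy u \<and> \<psi> u = coeff P j)" for j
  have u: "cauchy (u j) \<and> \<psi> (u j) = coeff P j" for j
  proof -
    obtain w where "cauchy w" "\<psi> w = coeff P j" using F_poly_coeff[OF P(1)] by (rule F_E)
    then show ?thesis 
      unfolding u_def using someI[of "\<lambda>u. cauchy u \<and> \<psi> u = coeff P j" w] by blast
  qed
  define S :: "nat \<Rightarrow> 'a poly" where "S i = (\<Sum>j<d. Polynomial.monom (u j i) j) + Polynomial.monom 1 d" for i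
  have S: "poly.coeff (S i) j = (if j < d then u j i else if j = d then 1 else 0)" for i j
  proof -
    have "poly.coeff (\<Sum>j<d. Polynomial.monom (u j i) j) j = (\<Sum>l<d. if l = j then u l i else 0)"
      unfolding coeff_sum coeff_monom ..
    also have "\<dots> = (if j < d then u j i else 0)" by simp
    finally show ?thesis unfolding S_def coeff_add coeff_monom by simp
  qed
  have "approx S P"
    unfolding approx_def
  proof
    fix j
    consider "j < d" | "j = d" | "j > d" by linarith
    then show "cauchy (\<lambda>i. poly.coeff (S i) j) \<and> \<psi> (\<lambda>i. poly.coeff (S i) j) = coeff P j"
    proof cases
      case 1
      then show ?thesis using u[of j] by (simp add: S)
    next
      case 2
      then show ?thesis using lead_coeff_simp[OF P(2)] P(3) by (simp add: S \<psi>_one d_def)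
    next
      case 3
      then show ?thesis using coeff_degree[of P j] by (simp add: S \<psi>_zero d_def)
    qed
  qed
  moreover have "Polynomial.degree (S i) = d" for i
  proof (rule antisym)
    show "Polynomial.degree (S i) \<le> d" by (rule degree_le) (simp add: S)
    show "d \<le> Polynomial.degree (S i)" by (rule le_degree) (simp add: S)
  qed
  ultimately show ?thesis using that[of S] by (simp add: S d_def)
qed

text \<open>The index range ends one past the degree, where the coefficient is zero.\<close>

definition cgauss :: "real \<Rightarrow> 'b list \<Rightarrow> real" where
  "cgauss \<rho> P = Max ((\<lambda>j. cnrm (coeff P j) * \<rho> ^ j) ` {..length P})"

lemma tendsto_Max:
  fixes f :: "nat \<Rightarrow> nat \<Rightarrow> real"
  assumes "finite A" "A \<noteq> {}" "\<And>a. a \<in> A \<Longrightarrow> (\<lambda>i. f i a) \<longlonglongrightarrow> l a"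
  shows "(\<lambda>i. Max (f i ` A)) \<longlonglongrightarrow> Max (l ` A)"
  using assms
proof (induction A rule: finite_ne_induct)
  case (insert a A)
  have "(\<lambda>i. max (f i a) (Max (f i ` A))) \<longlonglongrightarrow> max (l a) (Max (l ` A))"
    by (intro tendsto_max insert) auto
  then show ?case using insert(1,2) by simp
qed simp

lemma Max_image_extend:
  fixes g :: "nat \<Rightarrow> real"
  assumes "m \<le> n" "\<And>j. 0 \<le> g j" "\<And>j. m < j \<Longrightarrow> g j = 0"
  shows "Max (g ` {..n}) = Max (g ` {..m})"
proof (rule antisym)
  have "g j \<le> Max (g ` {..m})" for j
  proof (cases "j \<le> m")
    case False
    then have "g j \<le> g 0" using assms by simp
    also have "\<dots> \<le> Max (g ` {..m})" by (intro Max_ge) auto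
    finally show ?thesis .
  qed simp
  then show "Max (g ` {..n}) \<le> Max (g ` {..m})" by (intro Max.boundedI) auto
  show "Max (g ` {..m}) \<le> Max (g ` {..n})" using assms(1) by (intro Max_mono) auto
qed

text \<open>With bounded degree the norm is a maximum over a fixed finite set of indices, and the limit can
  be taken under the maximum. This transfers multiplicativity to the completion.\<close>

lemma gauss_tendsto_cgauss:
  assumes \<rho>: "0 < \<rho>" and S: "approx S P" "\<And>i. Polynomial.degree (S i) \<le> D" and P: "P \<in> carrier (F[X])"
  shows "(\<lambda>i. gauss_norm.gauss nrm \<rho> (S i)) \<longlonglongrightarrow> cgauss \<rho> P"
proof -
  interpret G: gauss_norm nrm \<rho> by unfold_locales (rule \<rho>)
  define B where "B = max D (length P)"
  have "G.gauss (S i) = Max ((\<lambda>j. nrm (poly.coeff (S i) j) * \<rho> ^ j) ` {..B})" for i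
    unfolding G.gauss_def using S(2)[of i] \<rho>
    by (intro Max_image_extend[symmetric]) (auto simp: B_def coeff_eq_0)
  moreover have "cgauss \<rho> P = Max ((\<lambda>j. cnrm (coeff P j) * \<rho> ^ j) ` {..B})"
    unfolding cgauss_def using \<rho> cnrm_nonneg F_poly_coeff[OF P]
    by (intro Max_image_extend[symmetric]) (auto simp: B_def coeff_length)
  moreover have "(\<lambda>i. Max ((\<lambda>j. nrm (poly.coeff (S i) j) * \<rho> ^ j) ` {..B}))
      \<longlonglongrightarrow> Max ((\<lambda>j. cnrm (coeff P j) * \<rho> ^ j) ` {..B})"
  proof (rule tendsto_Max)
    fix j
    have "(\<lambda>i. nrm (poly.coeff (S i) j)) \<longlonglongrightarrow> cnrm (coeff P j)"
      using nrm_tendsto_cnrm[of "\<lambda>i. poly.coeff (S i) j"] S(1) unfolding approx_def by simp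
    then show "(\<lambda>i. nrm (poly.coeff (S i) j) * \<rho> ^ j) \<longlonglongrightarrow> cnrm (coeff P j) * \<rho> ^ j"
      by (intro tendsto_intros)
  qed auto
  ultimately show ?thesis by simp
qed

lemma cgauss_mult:
  assumes \<rho>: "0 < \<rho>" and P: "P \<in> carrier (F[X])" "P \<noteq> []" "hd P = \<one>"
    and R: "R \<in> carrier (F[X])" "R \<noteq> []" "hd R = \<one>"
  shows "cgauss \<rho> (P \<otimes>\<^bsub>F[X]\<^esub> R) = cgauss \<rho> P * cgauss \<rho> R"
proof -
  interpret G: gauss_norm nrm \<rho> by unfold_locales (rule \<rho>)
  interpret UP: domain "F[X]" by (rule univ_poly_is_domain[OF subring_F])
  obtain S where S: "approx S P" "\<And>i. Polynomial.degree (S i) = length P - 1"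
    "\<And>i. poly.coeff (S i) (length P - 1) = 1" by (rule approx_exists[OF P]) (rule that)
  obtain T where T: "approx T R" "\<And>i. Polynomial.degree (T i) = length R - 1"
    "\<And>i. poly.coeff (T i) (length R - 1) = 1" by (rule approx_exists[OF R]) (rule that)
  have "(\<lambda>i. G.gauss (S i * T i)) \<longlonglongrightarrow> cgauss \<rho> (P \<otimes>\<^bsub>F[X]\<^esub> R)"
  proof (rule gauss_tendsto_cgauss[OF \<rho> approx_mult[OF S(1) T(1) P(1) R(1)]])
    show "Polynomial.degree (S i * T i) \<le> (length P - 1) + (length R - 1)" for i
      using degree_mult_le[of "S i" "T i"] S(2) T(2) by simp
  qed (use P R in auto)
  moreover have "(\<lambda>i. G.gauss (S i) * G.gauss (T i)) \<longlonglongrightarrow> cgauss \<rho> P * cgauss \<rho> R"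
    using S T P R by (intro tendsto_mult gauss_tendsto_cgauss[OF \<rho>]) auto
  ultimately show ?thesis unfolding G.gauss_mult by (rule LIMSEQ_unique)
qed

end

section \<open>Newton polygons over a completion\<close>

context completion_embedding begin

lemma F_monic_mult:
  assumes P: "P \<in> carrier (F[X])" "P \<noteq> []" and R: "R \<in> carrier (F[X])" "R \<noteq> []"
  shows "length (P \<otimes>\<^bsub>F[X]\<^esub> R) - 1 = (length P - 1) + (length R - 1)"
    "hd (P \<otimes>\<^bsub>F[X]\<^esub> R) = hd P \<otimes> hd R"
  using poly_mult_degree_eq[OF subring_F, of P R] poly_mult_lead_coeff[OF subring_F, of P R] P R
  by (simp_all add: univ_poly_carrier univ_poly_mult)

text \<open>A polynomial which attains its Gauss norm at an interior index, and only at smaller ones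
  besides, splits off a factor of that degree: Newton's method converges to the factorization.\<close>

lemma factor_at_dominant_index:
  assumes P: "P \<in> carrier (F[X])" "P \<noteq> []" "hd P = \<one>" and \<rho>: "0 < \<rho>"
    and k: "k < length P - 1" and M: "0 < M" "cnrm (coeff P k) * \<rho> ^ k = M"
    and le: "\<And>j. cnrm (coeff P j) * \<rho> ^ j \<le> M"
    and less: "\<And>j. k < j \<Longrightarrow> cnrm (coeff P j) * \<rho> ^ j < M"
  obtains G Q where "G \<in> carrier (F[X])" "Q \<in> carrier (F[X])" "P = G \<otimes>\<^bsub>F[X]\<^esub> Q"
    "length G - 1 \<le> k" "length Q - 1 \<le> length P - 1 - k"
proof -
  interpret G: gauss_norm nrm \<rho> by unfold_locales (rule \<rho>)
  define d where "d = length P - 1"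
  obtain S where S_length: "approx S P" "\<And>i. Polynomial.degree (S i) = length P - 1"
    "\<And>i. poly.coeff (S i) (length P - 1) = 1"
    by (rule approx_exists[OF P]) (rule that)
  note S = S_length[folded d_def]
  have Sc: "cauchy (\<lambda>i. poly.coeff (S i) j)" "\<psi> (\<lambda>i. poly.coeff (S i) j) = coeff P j" for j
    using S(1) unfolding approx_def by blast+
  have lim: "(\<lambda>i. nrm (poly.coeff (S i) j) * \<rho> ^ j) \<longlonglongrightarrow> cnrm (coeff P j) * \<rho> ^ j" for j
    using nrm_tendsto_cnrm[OF Sc(1)[of j]] unfolding Sc(2) by (intro tendsto_intros)
  have nn: "0 \<le> cnrm (coeff P j)" for j using cnrm_nonneg[OF F_poly_coeff[OF P(1)]] .
  \<comment> \<open>Finitely many ratios are below \<open>1\<close>, so a common bound \<open>\<delta> < 1\<close> exists. The entry \<open>1/2\<close>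
    covers the case that there are none and keeps \<open>\<delta>\<close> positive.\<close>
  define A where "A = insert (1/2) ((\<lambda>j. cnrm (coeff P j) * \<rho> ^ j / M) ` {k<..d})"
  have A: "finite A" "A \<noteq> {}" by (auto simp: A_def)
  have "Max A < 1" using less M(1) by (subst Max_less_iff[OF A]) (auto simp: A_def)
  moreover have "1/2 \<le> Max A" using A by (intro Max_ge) (auto simp: A_def)
  moreover define \<delta> where "\<delta> = (1 + Max A) / 2"
  ultimately have \<delta>: "0 < \<delta>" "\<delta> < 1" "Max A < \<delta>" by auto
  have high: "cnrm (coeff P j) * \<rho> ^ j < \<delta> * M" if "k < j" "j \<le> d" for j
  proof -
    have "cnrm (coeff P j) * \<rho> ^ j / M \<le> Max A" using that A by (intro Max_ge) (auto simp: A_def)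
    then have "cnrm (coeff P j) * \<rho> ^ j / M < \<delta>" using \<delta>(3) by simp
    then show ?thesis using M(1) by (simp add: pos_divide_less_eq)
  qed
  have eventually_le: "\<forall>\<^sub>F i in sequentially. nrm (poly.coeff (S i) j) * \<rho> ^ j \<le> M" for j
  proof (cases "coeff P j = \<zero>")
    case True
    then have "(\<lambda>i. nrm (poly.coeff (S i) j) * \<rho> ^ j) \<longlonglongrightarrow> 0" using lim[of j] by simp
    then have "\<forall>\<^sub>F i in sequentially. nrm (poly.coeff (S i) j) * \<rho> ^ j < M" using M(1) by (rule order_tendstoD(2))
    then show ?thesis by (rule eventually_mono) simp
  next
    case False
    then have "\<forall>\<^sub>F i in sequentially. nrm (poly.coeff (S i) j) = cnrm (coeff P j)"
      using nrm_eventually_eq_cnrm[OF Sc(1)[of j]] Sc(2)[of j] by simp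
    then show ?thesis by (rule eventually_mono) (use le[of j] in simp)
  qed
  have "coeff P k \<noteq> \<zero>" using M by auto
  then have ev_k: "\<forall>\<^sub>F i in sequentially. nrm (poly.coeff (S i) k) = cnrm (coeff P k)"
    using nrm_eventually_eq_cnrm[OF Sc(1)[of k]] Sc(2)[of k] by simp
  have ev_le: "\<forall>\<^sub>F i in sequentially. \<forall>j\<in>{..d}. nrm (poly.coeff (S i) j) * \<rho> ^ j \<le> M"
    by (intro eventually_ball_finite ballI eventually_le) simp
  have ev_high: "\<forall>\<^sub>F i in sequentially. \<forall>j\<in>{k<..d}. nrm (poly.coeff (S i) j) * \<rho> ^ j < \<delta> * M"
    by (intro eventually_ball_finite ballI order_tendstoD(2)[OF lim]) (auto intro: high)
  obtain N0 where N0: "\<And>i. i \<ge> N0 \<Longrightarrow> nrm (poly.coeff (S i) k) = cnrm (coeff P k)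
      \<and> (\<forall>j\<in>{..d}. nrm (poly.coeff (S i) j) * \<rho> ^ j \<le> M)
      \<and> (\<forall>j\<in>{k<..d}. nrm (poly.coeff (S i) j) * \<rho> ^ j < \<delta> * M)"
    using eventually_conj[OF ev_k eventually_conj[OF ev_le ev_high]] unfolding eventually_sequentially by blast
  have "\<exists>N. \<forall>i\<ge>N. \<forall>l\<ge>N. G.gauss (S i - S l) \<le> \<delta> ^ (n + 2) * M" for n
  proof -
    have "\<exists>N. \<forall>i l. N \<le> i \<longrightarrow> N \<le> l \<longrightarrow> nrm (poly.coeff (S i) j - poly.coeff (S l) j) < \<delta> ^ (n + 2) * M / \<rho> ^ j" for j
      using \<delta>(1) M(1) \<rho> by (intro cauchyD[OF Sc(1)]) simp
    then obtain N where N: "\<And>j i l. N j \<le> i \<Longrightarrow> N j \<le> l \<Longrightarrow>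
        nrm (poly.coeff (S i) j - poly.coeff (S l) j) < \<delta> ^ (n + 2) * M / \<rho> ^ j" by metis
    have "G.gauss (S i - S l) \<le> \<delta> ^ (n + 2) * M" if "i \<ge> sum N {..d}" "l \<ge> sum N {..d}" for i l
    proof (rule G.gauss_leI)
      fix j
      show "nrm (poly.coeff (S i - S l) j) * \<rho> ^ j \<le> \<delta> ^ (n + 2) * M"
      proof (cases "j \<le> d")
        case True
        then have "N j \<le> sum N {..d}" by (intro member_le_sum) auto
        then have "nrm (poly.coeff (S i) j - poly.coeff (S l) j) < \<delta> ^ (n + 2) * M / \<rho> ^ j"
          using that by (intro N) auto
        then show ?thesis using \<rho> by (simp add: pos_less_divide_eq)
      next
        case False
        then have "poly.coeff (S i - S l) j = 0" using S(2) by (simp add: coeff_eq_0)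
        then show ?thesis using \<delta> M by simp
      qed
    qed
    then show ?thesis by blast
  qed
  then obtain N where N: "\<And>n i l. N n \<le> i \<Longrightarrow> N n \<le> l \<Longrightarrow> G.gauss (S i - S l) \<le> \<delta> ^ (n + 2) * M" by metis
  \<comment> \<open>The subsequence is chosen so fast that its steps satisfy the drift bound of Newton's method.\<close>
  define s where "s n = N0 + n + sum N {..n}" for n
  have s: "N0 \<le> s n" "n \<le> s n" "N n \<le> s n" "N n \<le> s (Suc n)" for n
    using member_le_sum[of n "{..n}" N] by (auto simp: s_def)
  define T where "T n = S (s n)" for n
  have T_norm: "G.gauss (T n) = M" for n
  proof (rule antisym)
    show "G.gauss (T n) \<le> M"
    proof (rule G.gauss_leI)
      fix j
      show "nrm (poly.coeff (T n) j) * \<rho> ^ j \<le> M"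
      proof (cases "j \<le> d")
        case True
        then show ?thesis using N0[OF s(1)[of n]] by (simp add: T_def)
      next
        case False
        then have "poly.coeff (T n) j = 0" using S(2) by (simp add: T_def coeff_eq_0)
        then show ?thesis using M(1) by simp
      qed
    qed
    show "M \<le> G.gauss (T n)"
      using G.coeff_le_gauss[of "T n" k] N0[OF s(1)[of n]] M(2) by (simp add: T_def)
  qed
  have T_k: "nrm (poly.coeff (T 0) k) * \<rho> ^ k = M" using N0[OF s(1)[of 0]] M(2) by (simp add: T_def)
  have T_high: "nrm (poly.coeff (T 0) j) * \<rho> ^ j \<le> \<delta> * M" if "k < j" for j
  proof (cases "j \<le> d")
    case True
    then have "nrm (poly.coeff (T 0) j) * \<rho> ^ j < \<delta> * M" using N0[OF s(1)[of 0]] that by (simp add: T_def)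
    then show ?thesis by simp
  next
    case False
    then have "poly.coeff (T 0) j = 0" using S(2) by (simp add: T_def coeff_eq_0)
    then show ?thesis using \<delta> M by simp
  qed
  have T_step: "G.gauss (T (Suc n) - T n) \<le> \<delta> ^ (n + 2) * M" for n
    unfolding T_def by (rule N[OF s(4) s(3)])
  obtain G Q where GQ: "\<And>i. Polynomial.degree (G i) = k"
    "\<And>i. G.gauss (G (Suc i) - G i) \<le> \<delta> ^ (i + 1) * M" "\<And>i. G.gauss (Q (Suc i) - Q i) \<le> \<delta> ^ (i + 1)"
    "\<And>i. G.gauss (T i - G i * Q i) \<le> \<delta> ^ (i + 1) * M"
    "\<And>i. Polynomial.degree (Q i) \<le> Polynomial.degree (T i) - k"
    using G.hensel_sequences[OF \<delta>(1,2) M(1) T_norm T_k T_high T_step] by metis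
  have coeff_cauchy: "cauchy (\<lambda>i. poly.coeff (H i) j)" if "\<And>i. G.gauss (H (Suc i) - H i) \<le> \<delta> ^ (i + 1) * C" for H C j
  proof (rule cauchy_of_geometric_steps[OF \<delta>(1,2)])
    fix i
    have "nrm (poly.coeff (H (Suc i) - H i) j) * \<rho> ^ j \<le> \<delta> ^ (i + 1) * C"
      using G.coeff_le_gauss[of "H (Suc i) - H i" j] that[of i] by simp
    then have "nrm (poly.coeff (H (Suc i) - H i) j) \<le> \<delta> ^ (i + 1) * C / \<rho> ^ j"
      using \<rho> by (simp add: pos_le_divide_eq)
    then show "nrm (poly.coeff (H (Suc i)) j - poly.coeff (H i) j) \<le> (\<delta> * C / \<rho> ^ j) * \<delta> ^ i"
      by (simp add: mult.commute mult.left_commute)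
  qed
  obtain g where g: "g \<in> carrier (F[X])" "approx G g" "length g \<le> Suc k"
    using approx_limit_exists[of G k] coeff_cauchy[OF GQ(2)] GQ(1) by auto
  have degQ: "Polynomial.degree (Q i) \<le> d - k" for i using GQ(5)[of i] S(2) by (simp add: T_def)
  obtain q where q: "q \<in> carrier (F[X])" "approx Q q" "length q \<le> Suc (d - k)"
    using approx_limit_exists[of Q "d - k"] coeff_cauchy[of Q 1] GQ(3) degQ by auto
  have TP: "approx T P"
    by (rule approx_null_diff[OF S(1)]) (use null_subsequence_diff[OF Sc(1) s(2)] in \<open>simp add: T_def\<close>)
  have "approx T (g \<otimes>\<^bsub>F[X]\<^esub> q)"
  proof (rule approx_null_diff[OF approx_mult[OF g(2) q(2) g(1) q(1)]])
    fix j
    have "(\<lambda>i. \<delta> * M / \<rho> ^ j * \<delta> ^ i) \<longlonglongrightarrow> \<delta> * M / \<rho> ^ j * 0"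
      using \<delta> by (intro tendsto_intros LIMSEQ_realpow_zero) auto
    then have lim0: "(\<lambda>i. \<delta> * M / \<rho> ^ j * \<delta> ^ i) \<longlonglongrightarrow> 0" by simp
    have le: "nrm (poly.coeff (T i) j - poly.coeff (G i * Q i) j) \<le> \<delta> * M / \<rho> ^ j * \<delta> ^ i" for i
    proof -
      have "nrm (poly.coeff (T i - G i * Q i) j) * \<rho> ^ j \<le> \<delta> ^ (i + 1) * M"
        using G.coeff_le_gauss[of "T i - G i * Q i" j] GQ(4)[of i] by linarith
      then have "nrm (poly.coeff (T i - G i * Q i) j) \<le> \<delta> ^ (i + 1) * M / \<rho> ^ j"
        using \<rho> by (simp add: pos_le_divide_eq)
      then show ?thesis by (simp add: mult.commute mult.left_commute)
    qed
    show "null (\<lambda>i. poly.coeff (T i) j - poly.coeff (G i * Q i) j)"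
      unfolding null_def
      by (rule real_tendsto_sandwich[OF _ _ tendsto_const lim0]) (use le in auto)
  qed
  interpret UP: domain "F[X]" by (rule univ_poly_is_domain[OF subring_F])
  have "P = g \<otimes>\<^bsub>F[X]\<^esub> q"
    using approx_unique[OF TP \<open>approx T (g \<otimes>\<^bsub>F[X]\<^esub> q)\<close> P(1)] g(1) q(1) by simp
  then show ?thesis using that[OF g(1) q(1)] g(3) q(3) by (simp add: d_def)
qed

text \<open>The Newton polygon of an irreducible polynomial is a single segment: if a coefficient exceeded
  the segment between the constant and the leading coefficient, the last index at which the Gauss
  norm is attained would lie strictly inside, and the polynomial would factor there.\<close>

lemma irreducible_coeff_le:
  assumes P: "P \<in> carrier (F[X])" "pirreducible F P" "hd P = \<one>" and \<rho>: "0 < \<rho>"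
    and const: "cnrm (coeff P 0) = \<rho> ^ (length P - 1)"
  shows "cnrm (coeff P j) * \<rho> ^ j \<le> \<rho> ^ (length P - 1)"
proof (rule ccontr)
  interpret UP: domain "F[X]" by (rule univ_poly_is_domain[OF subring_F])
  define d where "d = length P - 1"
  have ne: "P \<noteq> []" using pirreducibleE(1)[OF subring_F P(1,2)] .
  define a where "a j = cnrm (coeff P j) * \<rho> ^ j" for j
  define M where "M = Max (a ` {..d})"
  have a0: "a 0 = \<rho> ^ d" using const by (simp add: a_def d_def)
  have ad: "a d = \<rho> ^ d" using lead_coeff_simp[OF ne] P(3) by (simp add: a_def d_def)
  have a_high: "a i = 0" if "d < i" for i using coeff_degree[of P i] that by (simp add: a_def d_def)
  assume "\<not> cnrm (coeff P j) * \<rho> ^ j \<le> \<rho> ^ (length P - 1)"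
  then have j: "\<rho> ^ d < a j" by (simp add: a_def d_def)
  have "0 < \<rho> ^ d" using \<rho> by simp
  have "j \<le> d"
  proof (rule ccontr)
    assume "\<not> j \<le> d"
    then show False using a_high[of j] j \<open>0 < \<rho> ^ d\<close> by simp
  qed
  then have "a j \<le> M" by (simp add: M_def)
  then have M: "\<rho> ^ d < M" using j by simp
  then have M0: "0 < M" using \<open>0 < \<rho> ^ d\<close> by linarith
  have le: "a i \<le> M" for i
  proof (cases "i \<le> d")
    case False
    then show ?thesis using a_high[of i] M0 by simp
  qed (simp add: M_def)
  define K where "K = {i. i \<le> d \<and> a i = M}"
  have "M \<in> a ` {..d}" unfolding M_def by (intro Max_in) auto
  then have K: "finite K" "K \<noteq> {}" by (auto simp: K_def)
  define k where "k = Max K"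
  have "k \<in> K" using K by (simp add: k_def)
  then have k: "k \<le> d" "a k = M" by (auto simp: K_def)
  have "k \<noteq> 0" "k \<noteq> d" using k(2) a0 ad M by (metis less_irrefl)+
  then have k': "0 < k" "k < d" using k(1) by auto
  have less: "a i < M" if "k < i" for i
  proof (cases "i \<le> d")
    case True
    have "i \<notin> K" using that Max_ge[OF K(1), of i] by (auto simp: k_def)
    then show ?thesis using le[of i] True by (auto simp: K_def)
  next
    case False
    then show ?thesis using a_high[of i] M0 by simp
  qed
  have kk: "k < length P - 1" "cnrm (coeff P k) * \<rho> ^ k = M"
    and le': "\<And>i. cnrm (coeff P i) * \<rho> ^ i \<le> M" and less': "\<And>i. k < i \<Longrightarrow> cnrm (coeff P i) * \<rho> ^ i < M"
    using k'(2) k(2) le less by (simp_all add: d_def a_def)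
  obtain G Q where GQ: "G \<in> carrier (F[X])" "Q \<in> carrier (F[X])" "P = G \<otimes>\<^bsub>F[X]\<^esub> Q"
    "length G - 1 \<le> k" "length Q - 1 \<le> length P - 1 - k"
    by (rule factor_at_dominant_index[OF P(1) ne P(3) \<rho> kk(1) M0 kk(2) le'], erule less') (rule that)
  have "G \<noteq> []" "Q \<noteq> []"
    using GQ(3) ne UP.l_null[OF GQ(2)] UP.r_null[OF GQ(1)] by (auto simp: univ_poly_zero)
  then have deg: "d = (length G - 1) + (length Q - 1)"
    using F_monic_mult(1)[OF GQ(1) _ GQ(2)] GQ(3) by (simp add: d_def)
  have "G \<in> Units (F[X]) \<or> Q \<in> Units (F[X])"
    by (rule pirreducibleE(3)[OF subring_F P(1,2) GQ(1-3)])
  then have "length G - 1 = 0 \<or> length Q - 1 = 0"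
    using univ_poly_units'[OF subfield_F, of G] univ_poly_units'[OF subfield_F, of Q] by auto
  then show False using deg GQ(4,5) k' unfolding d_def by auto
qed

text \<open>Since no coefficient exceeds the segment, the maximum is attained at one of its two ends.\<close>

lemma cgauss_irreducible:
  assumes P: "P \<in> carrier (F[X])" "pirreducible F P" "hd P = \<one>" and \<rho>: "0 < \<rho>" and \<tau>: "0 < \<tau>"
    and const: "cnrm (coeff P 0) = \<rho> ^ (length P - 1)"
  shows "cgauss \<tau> P = max \<rho> \<tau> ^ (length P - 1)"
proof (rule antisym)
  define d where "d = length P - 1"
  have ne: "P \<noteq> []" using pirreducibleE(1)[OF subring_F P(1,2)] .
  show "cgauss \<tau> P \<le> max \<rho> \<tau> ^ (length P - 1)"
    unfolding cgauss_def
  proof (rule Max.boundedI)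
    fix x assume "x \<in> (\<lambda>j. cnrm (coeff P j) * \<tau> ^ j) ` {..length P}"
    then obtain j where x: "x = cnrm (coeff P j) * \<tau> ^ j" by auto
    show "x \<le> max \<rho> \<tau> ^ (length P - 1)"
    proof (cases "j \<le> d")
      case True
      have pow: "\<rho> ^ d = \<rho> ^ (d - j) * \<rho> ^ j" using True by (simp flip: power_add)
      have "cnrm (coeff P j) * \<rho> ^ j \<le> \<rho> ^ (d - j) * \<rho> ^ j"
        unfolding pow[symmetric] unfolding d_def by (rule irreducible_coeff_le[OF P \<rho> const])
      then have "cnrm (coeff P j) \<le> \<rho> ^ (d - j)" using \<rho> by simp
      then have "x \<le> \<rho> ^ (d - j) * \<tau> ^ j" unfolding x using \<tau> by (intro mult_right_mono) auto
      also have "\<dots> \<le> max \<rho> \<tau> ^ (d - j) * max \<rho> \<tau> ^ j"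
        using \<rho> \<tau> by (intro mult_mono power_mono) auto
      also have "\<dots> = max \<rho> \<tau> ^ d" using True by (simp flip: power_add)
      finally show ?thesis by (simp add: d_def)
    next
      case False
      then have "x = 0" using coeff_degree[of P j] by (simp add: x d_def)
      then show ?thesis using \<rho> by simp
    qed
  qed auto
  have le: "cnrm (coeff P j) * \<tau> ^ j \<le> cgauss \<tau> P" if "j \<le> length P" for j
    unfolding cgauss_def using that by (intro Max_ge) auto
  show "max \<rho> \<tau> ^ (length P - 1) \<le> cgauss \<tau> P"
    using le[of 0] le[of "length P - 1"] const lead_coeff_simp[OF ne] P(3) by (auto simp: max_def)
qed

lemma coeff_mult_zero:
  assumes "P \<in> carrier (F[X])" "R \<in> carrier (F[X])"
  shows "coeff (P \<otimes>\<^bsub>F[X]\<^esub> R) 0 = coeff P 0 \<otimes> coeff R 0"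
proof -
  have "coeff (poly_mult P R) 0 = (\<Oplus>k\<in>{..0}. coeff P k \<otimes> coeff R (0 - k))"
    using poly_mult_coeff[OF F_poly_in_carrier[OF assms(1)] F_poly_in_carrier[OF assms(2)]] by simp
  also have "\<dots> = coeff P 0 \<otimes> coeff R 0"
    using F_poly_in_carrier[OF assms(1)] F_poly_in_carrier[OF assms(2)] by simp
  finally show ?thesis by (simp add: univ_poly_mult)
qed

text \<open>The only value of a multiplicative norm on an algebraic element that is the same on all conjugates: up
  to sign the constant coefficient of the minimal polynomial is the product of the conjugates.\<close>

definition anrm :: "'b \<Rightarrow> real" where
  "anrm x = cnrm (coeff (Irr F x) 0) powr (1 / real (length (Irr F x) - 1))"

text \<open>Factor \<open>P\<close> into irreducible polynomials: each contributes its degree many roots with the same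
  minimal polynomial, and its Gauss norm is known.\<close>

lemma cgauss_eq_prod_roots:
  assumes "P \<in> carrier (F[X])" "P \<noteq> []" "hd P = \<one>" "coeff P 0 \<noteq> \<zero>" "splitted P" and \<tau>: "0 < \<tau>"
  shows "cgauss \<tau> P = (\<Prod>x\<in>#roots P. max (anrm x) \<tau>)"
  using assms(1-5)
proof (induction "length P" arbitrary: P rule: less_induct)
  case less
  note P = less.prems
  interpret UP: domain "F[X]" by (rule univ_poly_is_domain[OF subring_F])
  have Pc: "R \<in> carrier (poly_ring L)" if "R \<in> carrier (F[X])" for R
    using carrier_polynomial_shell[OF subring_F that] .
  show ?case
  proof (cases "length P - 1 = 0")
    case True
    then obtain c where "P = [c]" using P(2) by (cases P) auto
    then have "P = [\<one>]" using P(3) by simp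
    moreover have "roots P = {#}" using P(5) True by (simp add: splitted_def)
    moreover have "cgauss \<tau> [\<one>] = 1"
      using \<tau> by (simp add: cgauss_def atMost_Suc)
    ultimately show ?thesis by simp
  next
    case False
    then have "roots P \<noteq> {#}" using P(5) by (auto simp: splitted_def)
    then obtain x where "x \<in># roots P" by blast
    then have x: "x \<in> carrier L" "eval P x = \<zero>"
      using roots_mem_iff_is_root[OF Pc[OF P(1)]] unfolding is_root_def by auto
    have alg: "(algebraic over F) x" by (rule algebraicI[OF P(1,2) x(2)])
    define I where "I = Irr F x"
    have I: "I \<in> carrier (F[X])" "pirreducible F I" "hd I = \<one>" "eval I x = \<zero>"
      using IrrE[OF subfield_F x(1) alg] by (simp_all add: I_def)
    have In: "I \<noteq> []" using pirreducibleE(1)[OF subring_F I(1,2)] .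
    have "I pdivides P" unfolding I_def by (rule Irr_minimal[OF subfield_F x(1) alg P(1) x(2)])
    then have "I divides\<^bsub>F[X]\<^esub> P" using pdivides_iff_shell[OF subfield_F I(1) P(1)] by simp
    then obtain R where R: "R \<in> carrier (F[X])" "P = I \<otimes>\<^bsub>F[X]\<^esub> R" unfolding factor_def by auto
    have Rn: "R \<noteq> []" using R(2) P(2) UP.r_null[OF I(1)] by (auto simp: univ_poly_zero)
    have deg: "length P - 1 = (length I - 1) + (length R - 1)" and hd: "hd P = hd I \<otimes> hd R"
      using F_monic_mult[OF I(1) In R(1) Rn] R(2) by simp_all
    have hdR: "hd R = \<one>"
    proof -
      have "hd R \<in> carrier L" using F_poly_in_carrier[OF R(1)] Rn by (cases R) auto
      then show ?thesis using hd I(3) P(3) by simp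
    qed
    have dI: "1 \<le> length I - 1" by (rule pirreducible_degree[OF subfield_F I(1,2)])
    have mult: "P = I \<otimes>\<^bsub>poly_ring L\<^esub> R" using R(2) by (simp add: univ_poly_mult)
    have c0: "coeff P 0 = coeff I 0 \<otimes> coeff R 0" using coeff_mult_zero[OF I(1) R(1)] R(2) by simp
    have I0: "coeff I 0 \<noteq> \<zero>" and R0: "coeff R 0 \<noteq> \<zero>"
      using c0 P(4) F_poly_in_carrier[OF I(1)] F_poly_in_carrier[OF R(1)] by auto
    have splitI: "splitted I"
      using pdivides_imp_splitted[OF Pc[OF I(1)] Pc[OF P(1)] P(2,5)] \<open>I pdivides P\<close> by simp
    have "R pdivides P"
      unfolding pdivides_def mult
      using UP.m_comm[OF I(1) R(1)] Pc[OF I(1)] by (auto simp: factor_def univ_poly_mult)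
    then have splitR: "splitted R"
      using pdivides_imp_splitted[OF Pc[OF R(1)] Pc[OF P(1)] P(2,5)] by simp
    have roots: "roots P = roots I + roots R"
      unfolding mult by (rule associated_polynomials_imp_same_roots[OF Pc[OF I(1)] In Pc[OF R(1)] Rn])
    define \<rho> where "\<rho> = anrm x"
    have n0: "0 < cnrm (coeff I 0)" by (rule cnrm_pos[OF F_poly_coeff[OF I(1)] I0])
    then have \<rho>: "0 < \<rho>" by (simp add: \<rho>_def anrm_def I_def)
    have "\<rho> ^ (length I - 1) = cnrm (coeff I 0)"
      using n0 dI \<rho> by (simp add: \<rho>_def anrm_def I_def[symmetric] powr_powr flip: powr_realpow)
    then have gI: "cgauss \<tau> I = max \<rho> \<tau> ^ (length I - 1)"
      by (intro cgauss_irreducible[OF I(1-3) \<rho> \<tau>]) simp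
    have "anrm y = \<rho>" if "y \<in># roots I" for y
    proof -
      have y: "y \<in> carrier L" "eval I y = \<zero>"
        using that roots_mem_iff_is_root[OF Pc[OF I(1)], of y] by (simp_all add: is_root_def)
      have algy: "(algebraic over F) y" by (rule algebraicI[OF I(1) In y(2)])
      have "Irr F y = I"
        using minimal_polynomial_is_unique[OF subfield_F y(1) algy] IrrE[OF subfield_F y(1) algy] I y by blast
      then show ?thesis by (simp add: \<rho>_def anrm_def I_def)
    qed
    then have "(\<Prod>y\<in>#roots I. max (anrm y) \<tau>) = (\<Prod>y\<in>#roots I. max \<rho> \<tau>)"
      by (intro arg_cong[of _ _ prod_mset] image_mset_cong) simp
    also have "\<dots> = max \<rho> \<tau> ^ size (roots I)" by simp
    also have "\<dots> = cgauss \<tau> I" using gI splitI by (simp add: splitted_def)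
    finally have prodI: "(\<Prod>y\<in>#roots I. max (anrm y) \<tau>) = cgauss \<tau> I" .
    have "length R < length P" using deg dI Rn In P(2) by (cases R; cases P; cases I) auto
    then have "cgauss \<tau> R = (\<Prod>x\<in>#roots R. max (anrm x) \<tau>)"
      by (rule less.hyps[OF _ R(1) Rn hdR R0 splitR])
    then show ?thesis
      unfolding roots using prodI cgauss_mult[OF \<tau> I(1) In I(3) R(1) Rn hdR] R(2) by simp
  qed
qed

end

text \<open>The products determine the multiset: the largest element is the smallest \<open>\<rho>\<close> from which on
  the product is a pure power of \<open>\<rho>\<close>.\<close>

lemma multiset_eq_of_prod_max:
  fixes A B :: "real multiset"
  assumes "\<forall>x\<in>#A. 0 < x" "\<forall>x\<in>#B. 0 < x" "size A = size B"
    and "\<And>\<rho>. 0 < \<rho> \<Longrightarrow> (\<Prod>x\<in>#A. max x \<rho>) = (\<Prod>x\<in>#B. max x \<rho>)"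
  shows "A = B"
  using assms
proof (induction "size A" arbitrary: A B)
  case (Suc n)
  have pow: "(\<Prod>x\<in>#C. max x \<rho>) = \<rho> ^ size C" if "\<forall>x\<in>#C. x \<le> \<rho>" for C and \<rho> :: real
    using that by (induction C) auto
  have ge: "\<rho> ^ size C \<le> (\<Prod>x\<in>#C. max x \<rho>)" if "0 < \<rho>" for C and \<rho> :: real
  proof (induction C)
    case (add x C)
    then show ?case using that by (auto intro!: mult_mono)
  qed simp
  have not_less: "\<not> Max (set_mset C) < Max (set_mset D)"
    if C: "C \<noteq> {#}" "\<forall>x\<in>#C. 0 < x" and D: "D \<noteq> {#}" and "size C = size D"
      and eq: "\<And>\<rho>. 0 < \<rho> \<Longrightarrow> (\<Prod>x\<in>#C. max x \<rho>) = (\<Prod>x\<in>#D. max x \<rho>)" for C D :: "real multiset"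
  proof
    define c where "c = Max (set_mset C)"
    define e where "e = Max (set_mset D)"
    assume "Max (set_mset C) < Max (set_mset D)"
    then have ce: "c < e" by (simp add: c_def e_def)
    have "c \<in># C" using C(1) by (simp add: c_def)
    then have c: "0 < c" using C(2) by blast
    have "e \<in># D" using D by (simp add: e_def)
    then obtain D' where D': "D = add_mset e D'" by (rule mset_add)
    have "c ^ size D = (\<Prod>x\<in>#C. max x c)" using pow[of C c] \<open>size C = size D\<close> by (simp add: c_def)
    also have "\<dots> = max e c * (\<Prod>x\<in>#D'. max x c)" using eq[OF c] by (simp add: D')
    also have "\<dots> \<ge> e * c ^ size D'"
      using ge[OF c, of D'] ce c by (intro mult_mono) auto
    finally have "e * c ^ size D' \<le> c * c ^ size D'" by (simp add: D')
    then show False using ce c by simp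
  qed
  have ne: "A \<noteq> {#}" "B \<noteq> {#}" using Suc by auto
  have "Max (set_mset A) = Max (set_mset B)"
    using not_less[OF ne(1) Suc.prems(1) ne(2) Suc.prems(3,4)]
      not_less[OF ne(2) Suc.prems(2) ne(1) Suc.prems(3)[symmetric] Suc.prems(4)[symmetric]] by simp
  moreover define a where "a = Max (set_mset A)"
  ultimately have "a \<in># A" "a \<in># B" using ne by (simp_all add: a_def) (metis Max_in finite_set_mset set_mset_eq_empty_iff)
  then obtain A' B' where AB: "A = add_mset a A'" "B = add_mset a B'" by (meson mset_add)
  have "A' = B'"
  proof (rule Suc.hyps)
    show "n = size A'" "\<forall>x\<in>#A'. 0 < x" "\<forall>x\<in>#B'. 0 < x" "size A' = size B'" using Suc AB by auto
    fix \<rho> :: real assume \<rho>: "0 < \<rho>"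
    have "max a \<rho> * (\<Prod>x\<in>#A'. max x \<rho>) = max a \<rho> * (\<Prod>x\<in>#B'. max x \<rho>)"
      using Suc.prems(4)[OF \<rho>] by (simp add: AB)
    then show "(\<Prod>x\<in>#A'. max x \<rho>) = (\<Prod>x\<in>#B'. max x \<rho>)" using \<rho> by auto
  qed
  then show ?case using AB by simp
qed simp

section \<open>The \<open>p\<close>-adic numbers\<close>

definition padic_abs :: "nat \<Rightarrow> rat \<Rightarrow> real" where
  "padic_abs p q = (if q = 0 then 0 else
     real p powr (real (multiplicity (int p) (snd (quotient_of q))) - real (multiplicity (int p) (fst (quotient_of q)))))"

lemma padic_abs_of_int_div:
  assumes p: "prime p" and a: "a \<noteq> 0" and b: "b \<noteq> 0"
  shows "padic_abs p (of_int a / of_int b) = real p powr (real (multiplicity (int p) b) - real (multiplicity (int p) a))"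
proof -
  obtain c d where cd: "quotient_of (of_int a / of_int b) = (c, d)" by (cases "quotient_of (of_int a / of_int b)")
  have d: "d \<noteq> 0" using quotient_of_denom_pos[OF cd] by simp
  have eq: "(of_int a / of_int b :: rat) = of_int c / of_int d" using quotient_of_div[OF cd] .
  then have "(of_int (a * d) :: rat) = of_int (c * b)" using b d by (simp add: field_simps)
  then have ad: "a * d = c * b" by (simp only: of_int_eq_iff)
  have c: "c \<noteq> 0" using ad a d b by auto
  have pe: "prime_elem (int p)" using p by simp
  have "multiplicity (int p) a + multiplicity (int p) d = multiplicity (int p) c + multiplicity (int p) b"
    using prime_elem_multiplicity_mult_distrib[OF pe a d] prime_elem_multiplicity_mult_distrib[OF pe c b] ad by simp
  then have "real (multiplicity (int p) d) - real (multiplicity (int p) c)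
      = real (multiplicity (int p) b) - real (multiplicity (int p) a)" by linarith
  then show ?thesis using a b by (simp add: padic_abs_def cd)
qed

lemma rat_as_quotient:
  fixes q :: rat assumes "q \<noteq> 0"
  obtains a b where "a \<noteq> 0" "b \<noteq> 0" "q = of_int a / of_int b"
proof -
  obtain a b where ab: "quotient_of q = (a, b)" by (cases "quotient_of q")
  have "q = of_int a / of_int b" by (rule quotient_of_div[OF ab])
  moreover have "b \<noteq> 0" using quotient_of_denom_pos[OF ab] by simp
  moreover have "a \<noteq> 0" using calculation assms by auto
  ultimately show ?thesis using that by blast
qed

text \<open>For the ultrametric inequality bring both fractions to a common denominator: a power of \<open>p\<close>
  dividing both numerators divides their sum.\<close>

lemma nonarch_field_padic_abs:
  assumes p: "prime p" shows "nonarch_field (padic_abs p)"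
proof
  have p0: "0 < real p" and p1: "1 < real p" using prime_gt_1_nat[OF p] by simp_all
  fix x y :: rat
  show "padic_abs p x = 0 \<longleftrightarrow> x = 0" using p0 by (simp add: padic_abs_def)
  show "0 \<le> padic_abs p x" by (simp add: padic_abs_def)
  show "padic_abs p (x * y) = padic_abs p x * padic_abs p y"
  proof (cases "x = 0 \<or> y = 0")
    case False
    then have "x \<noteq> 0" "y \<noteq> 0" by auto
    then obtain a b c d where ab: "a \<noteq> 0" "b \<noteq> 0" "x = of_int a / of_int b"
      and cd: "c \<noteq> 0" "d \<noteq> 0" "y = of_int c / of_int d" by (meson rat_as_quotient)
    have eq: "x * y = of_int (a * c) / of_int (b * d)" using ab cd by simp
    have pe: "prime_elem (int p)" using p by simp
    have ne: "a * c \<noteq> 0" "b * d \<noteq> 0" using ab cd by auto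
    show ?thesis
      unfolding eq padic_abs_of_int_div[OF p ne] unfolding ab(3) cd(3) padic_abs_of_int_div[OF p ab(1,2)]
        padic_abs_of_int_div[OF p cd(1,2)] powr_add[symmetric]
        prime_elem_multiplicity_mult_distrib[OF pe ab(1) cd(1)] prime_elem_multiplicity_mult_distrib[OF pe ab(2) cd(2)]
      by (simp add: algebra_simps)
  qed (auto simp: padic_abs_def)
  show "padic_abs p (x + y) \<le> max (padic_abs p x) (padic_abs p y)"
  proof (cases "x = 0 \<or> y = 0 \<or> x + y = 0")
    case True
    moreover have "padic_abs p 0 = 0" "0 \<le> padic_abs p x" by (simp_all add: padic_abs_def)
    ultimately show ?thesis by auto
  next
    case False
    then have "x \<noteq> 0" "y \<noteq> 0" by auto
    then obtain a b c d where ab: "a \<noteq> 0" "b \<noteq> 0" "x = of_int a / of_int b"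
      and cd: "c \<noteq> 0" "d \<noteq> 0" "y = of_int c / of_int d" by (meson rat_as_quotient)
    define s where "s = a * d + c * b"
    define l where "l = b * d"
    have l: "l \<noteq> 0" using ab cd by (simp add: l_def)
    have x: "x = of_int (a * d) / of_int l" and y: "y = of_int (c * b) / of_int l"
      using ab cd by (simp_all add: l_def)
    have xy: "x + y = of_int s / of_int l" unfolding x y s_def by (simp add: add_divide_distrib)
    have s: "s \<noteq> 0" using False xy by auto
    have adcb: "a * d \<noteq> 0" "c * b \<noteq> 0" using ab cd by auto
    have nu: "\<not> is_unit (int p)" using p by (metis not_prime_unit prime_nat_int_transfer)
    define k where "k = min (multiplicity (int p) (a * d)) (multiplicity (int p) (c * b))"
    have "int p ^ k dvd a * d" "int p ^ k dvd c * b"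
      using power_dvd_iff_le_multiplicity[OF adcb(1) nu, of k] power_dvd_iff_le_multiplicity[OF adcb(2) nu, of k]
      by (simp_all add: k_def)
    then have "int p ^ k dvd s" unfolding s_def by (rule dvd_add)
    then have "k \<le> multiplicity (int p) s" using power_dvd_iff_le_multiplicity[OF s nu] by simp
    then have "multiplicity (int p) (a * d) \<le> multiplicity (int p) s \<or> multiplicity (int p) (c * b) \<le> multiplicity (int p) s"
      by (auto simp: k_def)
    then have "padic_abs p (x + y) \<le> padic_abs p x \<or> padic_abs p (x + y) \<le> padic_abs p y"
      using p1 padic_abs_of_int_div[OF p s l, folded xy] padic_abs_of_int_div[OF p adcb(1) l, folded x]
        padic_abs_of_int_div[OF p adcb(2) l, folded y] by auto
    then show ?thesis by auto
  qed
qed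

lemma rat_val_eq_padic_abs:
  assumes p: "prime p" and "q \<noteq> 0" shows "rat_val p q = ereal (- log p (padic_abs p q))"
proof -
  have "0 < real p" "real p \<noteq> 1" using prime_gt_1_nat[OF p] by auto
  then show ?thesis using assms(2) by (simp add: rat_val_def padic_abs_def)
qed

lemma le_rat_val_iff:
  assumes p: "prime p" shows "ereal (real k) \<le> rat_val p q \<longleftrightarrow> padic_abs p q \<le> real p powr - real k"
proof (cases "q = 0")
  case False
  have p1: "1 < real p" using prime_gt_1_nat[OF p] by simp
  show ?thesis using False p1 by (simp add: rat_val_def padic_abs_def) linarith
qed (simp add: rat_val_def padic_abs_def)

lemma exists_powr_less:
  assumes p: "prime p" and "0 < e" shows "\<exists>k::nat. real p powr - real k < e"
proof -
  have p1: "1 < real p" using prime_gt_1_nat[OF p] by simp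
  obtain k where "(1 / real p) ^ k < e" using real_arch_pow_inv[OF assms(2), of "1 / real p"] p1 by auto
  then have "real p powr - real k < e" using p1 by (simp add: powr_minus powr_realpow power_divide inverse_eq_divide)
  then show ?thesis by blast
qed

context
  fixes p :: nat assumes p: "prime p"
begin

interpretation nonarch_field "padic_abs p" by (rule nonarch_field_padic_abs[OF p])

lemma padic_Cauchy_iff: "padic_Cauchy p u \<longleftrightarrow> cauchy u"
proof
  assume L: "padic_Cauchy p u"
  show "cauchy u"
    unfolding cauchy_def
  proof (intro allI impI)
    fix e :: real assume "0 < e"
    then obtain k :: nat where k: "real p powr - real k < e" using exists_powr_less[OF p] by blast
    obtain N where "\<forall>i\<ge>N. \<forall>j\<ge>N. padic_abs p (u i - u j) \<le> real p powr - real k"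
      using L unfolding padic_Cauchy_def le_rat_val_iff[OF p] by blast
    then have "\<forall>i\<ge>N. \<forall>j\<ge>N. padic_abs p (u i - u j) < e" using k by fastforce
    then show "\<exists>N. \<forall>i\<ge>N. \<forall>j\<ge>N. padic_abs p (u i - u j) < e" by blast
  qed
next
  assume R: "cauchy u"
  show "padic_Cauchy p u"
    unfolding padic_Cauchy_def le_rat_val_iff[OF p]
  proof
    fix k :: nat
    have "0 < real p powr - real k" using prime_gt_0_nat[OF p] by simp
    then obtain N where N: "\<And>i j. i \<ge> N \<Longrightarrow> j \<ge> N \<Longrightarrow> padic_abs p (u i - u j) < real p powr - real k"
      using cauchyD[OF R] by blast
    have "\<forall>i\<ge>N. \<forall>j\<ge>N. padic_abs p (u i - u j) \<le> real p powr - real k"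
      using N by (simp add: less_imp_le)
    then show "\<exists>N. \<forall>i\<ge>N. \<forall>j\<ge>N. padic_abs p (u i - u j) \<le> real p powr - real k" by blast
  qed
qed

lemma padic_null_iff: "padic_null p u \<longleftrightarrow> null u"
proof
  assume L: "padic_null p u"
  show "null u"
  proof (rule nullI)
    fix e :: real assume "0 < e"
    then obtain k :: nat where k: "real p powr - real k < e" using exists_powr_less[OF p] by blast
    obtain N where "\<forall>i\<ge>N. padic_abs p (u i) \<le> real p powr - real k"
      using L unfolding padic_null_def le_rat_val_iff[OF p] by blast
    then have "\<forall>i\<ge>N. padic_abs p (u i) < e" using k by fastforce
    then show "\<exists>N. \<forall>i\<ge>N. padic_abs p (u i) < e" by blast
  qed
next
  assume R: "null u"
  show "padic_null p u"
    unfolding padic_null_def le_rat_val_iff[OF p]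
  proof
    fix k :: nat
    have "0 < real p powr - real k" using prime_gt_0_nat[OF p] by simp
    then obtain N where "\<forall>i\<ge>N. padic_abs p (u i) < real p powr - real k" using nullD[OF R] by blast
    then have "\<forall>i\<ge>N. padic_abs p (u i) \<le> real p powr - real k" by (simp add: less_imp_le)
    then show "\<exists>N. \<forall>i\<ge>N. padic_abs p (u i) \<le> real p powr - real k" by blast
  qed
qed

definition "nulls = {u. padic_null p u}"

lemma carrier_Cauchy_ring: "carrier (padic_Cauchy_ring p) = {u. cauchy u}"
  by (simp add: padic_Cauchy_ring_def padic_Cauchy_iff)

lemma Cauchy_ring_ops:
  "\<one>\<^bsub>padic_Cauchy_ring p\<^esub> = (\<lambda>_. 1)" "\<zero>\<^bsub>padic_Cauchy_ring p\<^esub> = (\<lambda>_. 0)"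
  "u \<otimes>\<^bsub>padic_Cauchy_ring p\<^esub> w = (\<lambda>i. u i * w i)" "u \<oplus>\<^bsub>padic_Cauchy_ring p\<^esub> w = (\<lambda>i. u i + w i)"
  by (simp_all add: padic_Cauchy_ring_def)

lemma cring_Cauchy: "cring (padic_Cauchy_ring p)"
proof (rule cringI)
  show "abelian_group (padic_Cauchy_ring p)"
  proof (rule abelian_groupI; unfold carrier_Cauchy_ring Cauchy_ring_ops)
    fix x :: "nat \<Rightarrow> rat" assume "x \<in> {u. cauchy u}"
    then show "\<exists>y\<in>{u. cauchy u}. (\<lambda>i. y i + x i) = (\<lambda>_. 0)"
      using cauchy_uminus by (intro bexI[of _ "\<lambda>i. - x i"]) auto
  qed (auto intro: cauchy_add simp: algebra_simps)
  show "comm_monoid (padic_Cauchy_ring p)"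
    by (rule comm_monoidI; unfold carrier_Cauchy_ring Cauchy_ring_ops)
      (auto intro: cauchy_mult simp: algebra_simps)
qed (auto simp: carrier_Cauchy_ring Cauchy_ring_ops algebra_simps)

lemma Cauchy_ring_a_inv:
  assumes "cauchy u" shows "\<ominus>\<^bsub>padic_Cauchy_ring p\<^esub> u = (\<lambda>i. - u i)"
proof -
  interpret R: cring "padic_Cauchy_ring p" by (rule cring_Cauchy)
  show ?thesis
    by (rule R.minus_equality) (use assms cauchy_uminus in \<open>auto simp: carrier_Cauchy_ring Cauchy_ring_ops\<close>)
qed

lemma ideal_nulls: "ideal nulls (padic_Cauchy_ring p)"
proof (rule idealI)
  interpret R: cring "padic_Cauchy_ring p" by (rule cring_Cauchy)
  show "ring (padic_Cauchy_ring p)" by (rule R.ring_axioms)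
  show "subgroup nulls (add_monoid (padic_Cauchy_ring p))"
  proof (rule R.add.subgroupI)
    show "nulls \<subseteq> carrier (padic_Cauchy_ring p)"
      by (auto simp: nulls_def padic_null_iff carrier_Cauchy_ring null_imp_cauchy)
    have "(\<lambda>_. 0) \<in> nulls" by (simp add: nulls_def padic_null_iff)
    then show "nulls \<noteq> {}" by blast
    fix a b assume a: "a \<in> nulls"
    then show "\<ominus>\<^bsub>padic_Cauchy_ring p\<^esub> a \<in> nulls"
      using null_uminus null_imp_cauchy by (simp add: nulls_def padic_null_iff Cauchy_ring_a_inv)
    assume "b \<in> nulls"
    then show "a \<oplus>\<^bsub>padic_Cauchy_ring p\<^esub> b \<in> nulls"
      using a null_add by (simp add: nulls_def padic_null_iff Cauchy_ring_ops)
  qed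
  fix a x assume ax: "a \<in> nulls" "x \<in> carrier (padic_Cauchy_ring p)"
  then have n: "null (\<lambda>i. x i * a i)"
    by (intro null_mult) (auto simp: nulls_def padic_null_iff carrier_Cauchy_ring)
  then show "x \<otimes>\<^bsub>padic_Cauchy_ring p\<^esub> a \<in> nulls" by (simp add: nulls_def padic_null_iff Cauchy_ring_ops)
  show "a \<otimes>\<^bsub>padic_Cauchy_ring p\<^esub> x \<in> nulls"
    using n by (simp add: nulls_def padic_null_iff Cauchy_ring_ops mult.commute)
qed

definition padic_of :: "(nat \<Rightarrow> rat) \<Rightarrow> padic" where
  "padic_of u = nulls +>\<^bsub>padic_Cauchy_ring p\<^esub> u"

lemma padic_field_eq: "padic_field p = padic_Cauchy_ring p Quot nulls"
  by (simp add: padic_field_def nulls_def)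

lemma padic_of_hom: "padic_of \<in> Ring.ring_hom (padic_Cauchy_ring p) (padic_field p)"
  unfolding padic_field_eq padic_of_def[abs_def] by (rule ideal.rcos_ring_hom[OF ideal_nulls])

lemma padic_of_eq_iff:
  assumes "cauchy u" "cauchy w" shows "padic_of u = padic_of w \<longleftrightarrow> null (\<lambda>i. u i - w i)"
proof -
  interpret R: cring "padic_Cauchy_ring p" by (rule cring_Cauchy)
  have "u \<ominus>\<^bsub>padic_Cauchy_ring p\<^esub> w = (\<lambda>i. u i - w i)"
    unfolding a_minus_def Cauchy_ring_a_inv[OF assms(2)] Cauchy_ring_ops by simp
  moreover have "u \<ominus>\<^bsub>padic_Cauchy_ring p\<^esub> w \<in> nulls \<longleftrightarrow> padic_of u = padic_of w"
    unfolding padic_of_def using assms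
    by (intro R.quotient_eq_iff_same_a_r_cos[OF ideal_nulls]) (simp_all add: carrier_Cauchy_ring)
  ultimately show ?thesis by (simp add: nulls_def padic_null_iff)
qed

lemma carrier_padic_field: "carrier (padic_field p) = padic_of ` {u. cauchy u}"
  unfolding padic_field_eq FactRing_def A_RCOSETS_def' padic_of_def by (auto simp: carrier_Cauchy_ring)

lemma mem_padic_of_iff:
  assumes "cauchy u" shows "w \<in> padic_of u \<longleftrightarrow> cauchy w \<and> null (\<lambda>i. w i - u i)"
proof
  assume "w \<in> padic_of u"
  then obtain h where "null h" "w = (\<lambda>i. h i + u i)"
    unfolding padic_of_def a_r_coset_def' by (auto simp: nulls_def padic_null_iff Cauchy_ring_ops)
  then show "cauchy w \<and> null (\<lambda>i. w i - u i)"
    using assms by (auto intro: cauchy_add null_imp_cauchy)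
next
  assume "cauchy w \<and> null (\<lambda>i. w i - u i)"
  then show "w \<in> padic_of u"
    unfolding padic_of_def a_r_coset_def'
    by (auto simp: nulls_def padic_null_iff Cauchy_ring_ops intro!: exI[of _ "\<lambda>i. w i - u i"] bexI[of _ "\<lambda>i. w i - u i"])
qed

lemma cring_padic_field: "cring (padic_field p)"
  unfolding padic_field_eq by (rule ideal.quotient_is_cring[OF ideal_nulls cring_Cauchy])

lemma padic_field_ops:
  "\<one>\<^bsub>padic_field p\<^esub> = padic_of (\<lambda>_. 1)" "\<zero>\<^bsub>padic_field p\<^esub> = padic_of (\<lambda>_. 0)"
  "cauchy u \<Longrightarrow> cauchy w \<Longrightarrow> padic_of u \<otimes>\<^bsub>padic_field p\<^esub> padic_of w = padic_of (\<lambda>i. u i * w i)"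
  "cauchy u \<Longrightarrow> cauchy w \<Longrightarrow> padic_of u \<oplus>\<^bsub>padic_field p\<^esub> padic_of w = padic_of (\<lambda>i. u i + w i)"
proof -
  interpret h: ring_hom_ring "padic_Cauchy_ring p" "padic_field p" padic_of
    by (intro ring_hom_ringI2 padic_of_hom cring.axioms(1) cring_Cauchy cring_padic_field)
  show "\<one>\<^bsub>padic_field p\<^esub> = padic_of (\<lambda>_. 1)" using h.hom_one by (simp add: Cauchy_ring_ops)
  show "\<zero>\<^bsub>padic_field p\<^esub> = padic_of (\<lambda>_. 0)" using h.hom_zero by (simp add: Cauchy_ring_ops)
  show "padic_of u \<otimes>\<^bsub>padic_field p\<^esub> padic_of w = padic_of (\<lambda>i. u i * w i)" if "cauchy u" "cauchy w"
    using h.hom_mult[of u w] that by (simp add: Cauchy_ring_ops carrier_Cauchy_ring)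
  show "padic_of u \<oplus>\<^bsub>padic_field p\<^esub> padic_of w = padic_of (\<lambda>i. u i + w i)" if "cauchy u" "cauchy w"
    using h.hom_add[of u w] that by (simp add: Cauchy_ring_ops carrier_Cauchy_ring)
qed

lemma field_padic_field: "field (padic_field p)"
proof (rule cring.cring_fieldI2[OF cring_padic_field])
  show "\<zero>\<^bsub>padic_field p\<^esub> \<noteq> \<one>\<^bsub>padic_field p\<^esub>"
    by (simp add: padic_field_ops(1,2) padic_of_eq_iff)
  fix a assume a: "a \<in> carrier (padic_field p)" "a \<noteq> \<zero>\<^bsub>padic_field p\<^esub>"
  then obtain u where u: "cauchy u" "a = padic_of u" by (auto simp: carrier_padic_field)
  have "\<not> null u" using a(2) u by (simp add: padic_field_ops(2) padic_of_eq_iff)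
  obtain w where w: "cauchy w" "null (\<lambda>i. u i * w i - 1)" by (rule cauchy_inverse[OF u(1) \<open>\<not> null u\<close>])
  have "a \<otimes>\<^bsub>padic_field p\<^esub> padic_of w = \<one>\<^bsub>padic_field p\<^esub>"
    using u w by (simp add: padic_field_ops padic_of_eq_iff cauchy_mult)
  moreover have "padic_of w \<in> carrier (padic_field p)" using w by (simp add: carrier_padic_field)
  ultimately show "\<exists>b\<in>carrier (padic_field p). a \<otimes>\<^bsub>padic_field p\<^esub> b = \<one>\<^bsub>padic_field p\<^esub>" by blast
qed

text \<open>A ring homomorphism from the field of \<open>p\<close>-adic numbers to another field is injective, so
  precisely the null sequences are sent to zero.\<close>

lemma completion_embedding_padic:
  assumes K: "field K" and \<phi>: "\<phi> \<in> Ring.ring_hom (padic_field p) K"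
  shows "completion_embedding (padic_abs p) K (\<lambda>u. \<phi> (padic_of u))"
proof -
  interpret K: field K by (rule K)
  interpret Q: field "padic_field p" by (rule field_padic_field)
  interpret \<phi>: ring_hom_ring "padic_field p" K \<phi>
    by (rule ring_hom_ringI2) (auto intro: \<phi> Q.ring_axioms K.ring_axioms)
  have car: "padic_of u \<in> carrier (padic_field p)" if "cauchy u" for u using that by (simp add: carrier_padic_field)
  have inj: "inj_on \<phi> (carrier (padic_field p))" by (rule non_trivial_field_hom_is_inj[OF \<phi> field_padic_field K])
  show ?thesis
  proof (unfold_locales)
    fix u w :: "nat \<Rightarrow> rat" assume u: "cauchy u"
    show "\<phi> (padic_of u) \<in> carrier K" using car[OF u] by simp
    have "\<phi> (padic_of u) = \<zero>\<^bsub>K\<^esub> \<longleftrightarrow> padic_of u = \<zero>\<^bsub>padic_field p\<^esub>"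
      using inj_onD[OF inj _ car[OF u], of "\<zero>\<^bsub>padic_field p\<^esub>"] \<phi>.hom_zero by auto
    also have "\<dots> \<longleftrightarrow> null u" using u by (simp add: padic_field_ops(2) padic_of_eq_iff)
    finally show "\<phi> (padic_of u) = \<zero>\<^bsub>K\<^esub> \<longleftrightarrow> null u" .
    assume w: "cauchy w"
    show "\<phi> (padic_of (\<lambda>i. u i + w i)) = \<phi> (padic_of u) \<oplus>\<^bsub>K\<^esub> \<phi> (padic_of w)"
      using \<phi>.hom_add[OF car[OF u] car[OF w]] padic_field_ops(4)[OF u w] by simp
    show "\<phi> (padic_of (\<lambda>i. u i * w i)) = \<phi> (padic_of u) \<otimes>\<^bsub>K\<^esub> \<phi> (padic_of w)"
      using \<phi>.hom_mult[OF car[OF u] car[OF w]] padic_field_ops(3)[OF u w] by simp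
  next
    show "\<phi> (padic_of (\<lambda>_. 1)) = \<one>\<^bsub>K\<^esub>" using \<phi>.hom_one padic_field_ops(1) by simp
  qed
qed

text \<open>Two representatives differ by a null sequence, so their absolute values have the same limit. Since
  the limit is positive, the logarithms converge as well.\<close>

lemma padic_val_padic_of:
  assumes u: "cauchy u" and lim: "(\<lambda>i. padic_abs p (u i)) \<longlonglongrightarrow> c" and c: "0 < c"
  shows "padic_val p (padic_of u) = ereal (- log p c)"
proof -
  have "(\<lambda>i. rat_val p (w i)) \<longlonglongrightarrow> ereal (- log p c)" if w: "w \<in> padic_of u" for w
  proof -
    have "cauchy w" and nul: "(\<lambda>i. padic_abs p (w i - u i)) \<longlonglongrightarrow> 0"
      using w mem_padic_of_iff[OF u] unfolding null_def by auto
    have "(\<lambda>i. padic_abs p (w i) - padic_abs p (u i)) \<longlonglongrightarrow> 0"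
      by (rule tendsto_0_le[OF nul, of _ 1]) (simp add: nrm_reverse_triangle)
    from tendsto_add[OF this lim] have wl: "(\<lambda>i. padic_abs p (w i)) \<longlonglongrightarrow> c" by simp
    have "(\<lambda>i. - log p (padic_abs p (w i))) \<longlonglongrightarrow> - log p c"
      using c prime_gt_1_nat[OF p] by (intro tendsto_intros wl) auto
    then have "(\<lambda>i. ereal (- log p (padic_abs p (w i)))) \<longlonglongrightarrow> ereal (- log p c)" by simp
    moreover have "\<forall>\<^sub>F i in sequentially. ereal (- log p (padic_abs p (w i))) = rat_val p (w i)"
      using order_tendstoD(1)[OF wl c]
    proof (rule eventually_mono)
      fix i assume "0 < padic_abs p (w i)"
      then have "w i \<noteq> 0" by auto
      then show "ereal (- log p (padic_abs p (w i))) = rat_val p (w i)" by (simp add: rat_val_eq_padic_abs[OF p])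
    qed
    ultimately show ?thesis by (rule Lim_transform_eventually)
  qed
  moreover have "u \<in> padic_of u" using u mem_padic_of_iff[OF u] by simp
  ultimately show ?thesis
    unfolding padic_val_def by (intro the_equality) (auto dest: LIMSEQ_unique)
qed

end

section \<open>Divisibility of minors\<close>

text \<open>Rows and columns are selected by arbitrary functions instead of sets: expanding a minor of a
  product leads to selections with repetitions and in any order.\<close>

definition minor :: "'a::comm_ring_1 mat \<Rightarrow> nat \<Rightarrow> (nat \<Rightarrow> nat) \<Rightarrow> (nat \<Rightarrow> nat) \<Rightarrow> 'a" where
  "minor A k r c = det (mat k k (\<lambda>(a, b). A $$ (r a, c b)))"

definition dvd_minors :: "int \<Rightarrow> int mat \<Rightarrow> nat \<Rightarrow> bool" where
  "dvd_minors d A k \<longleftrightarrow>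
     (\<forall>r c. (\<forall>a<k. r a < dim_row A) \<and> (\<forall>b<k. c b < dim_col A) \<longrightarrow> d dvd minor A k r c)"

lemma dvd_minorsD:
  "dvd_minors d A k \<Longrightarrow> (\<And>a. a < k \<Longrightarrow> r a < dim_row A) \<Longrightarrow> (\<And>b. b < k \<Longrightarrow> c b < dim_col A)
    \<Longrightarrow> d dvd minor A k r c"
  unfolding dvd_minors_def by blast

lemma minor_transpose:
  assumes "\<And>a. a < k \<Longrightarrow> r a < dim_row A" "\<And>b. b < k \<Longrightarrow> c b < dim_col A"
  shows "minor (transpose_mat A) k c r = minor A k r c"
proof -
  have "mat k k (\<lambda>(a, b). transpose_mat A $$ (c a, r b))
      = transpose_mat (mat k k (\<lambda>(a, b). A $$ (r a, c b)))"
    using assms by (intro eq_matI) auto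
  then show ?thesis unfolding minor_def by (simp add: det_transpose[of _ k])
qed

lemma dvd_minors_transpose [simp]: "dvd_minors d (transpose_mat A) k \<longleftrightarrow> dvd_minors d A k"
proof -
  have "dvd_minors d (transpose_mat B) k" if "dvd_minors d B k" for B :: "int mat"
    unfolding dvd_minors_def
  proof (intro allI impI, elim conjE)
    fix r c assume rc: "\<forall>a<k. r a < dim_row (transpose_mat B)" "\<forall>b<k. c b < dim_col (transpose_mat B)"
    then have "minor (transpose_mat B) k r c = minor B k c r"
      by (intro minor_transpose) auto
    then show "d dvd minor (transpose_mat B) k r c" using that rc unfolding dvd_minors_def by simp
  qed
  from this[of A] this[of "transpose_mat A"] show ?thesis by auto
qed

text \<open>Each row of \<open>P * A\<close> is a combination of rows of \<open>A\<close>, so by multilinearity every minor of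
  \<open>P * A\<close> is a combination of minors of \<open>A\<close>, possibly with repeated rows.\<close>

lemma dvd_minors_mult_left:
  assumes P: "P \<in> carrier_mat l n" and A: "A \<in> carrier_mat n m" and d: "dvd_minors d A k"
  shows "dvd_minors d (P * A) k"
  unfolding dvd_minors_def
proof (intro allI impI, elim conjE)
  fix r c assume "\<forall>a<k. r a < dim_row (P * A)" "\<forall>b<k. c b < dim_col (P * A)"
  then have r: "\<And>a. a < k \<Longrightarrow> r a < l" and c: "\<And>b. b < k \<Longrightarrow> c b < m" using P A by auto
  define v where "v j = vec k (\<lambda>b. A $$ (j, c b))" for j
  define w where "w a j = P $$ (r a, j) \<cdot>\<^sub>v v j" for a j
  have v: "v j \<in> carrier_vec k" for j by (simp add: v_def)
  have w: "w a j \<in> carrier_vec k" for a j by (simp add: w_def v)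
  define I where "I = {f. (\<forall>i\<in>{0..<k}. f i \<in> {0..<n}) \<and> (\<forall>i. i \<notin> {0..<k} \<longrightarrow> f i = i)}"
  have "mat k k (\<lambda>(a, b). (P * A) $$ (r a, c b))
      = mat\<^sub>r k k (\<lambda>a. finsum_vec TYPE(int) k (w a) {0..<n})"
  proof (rule eq_matI)
    fix a b assume "a < dim_row (mat\<^sub>r k k (\<lambda>a. finsum_vec TYPE(int) k (w a) {0..<n}))"
      "b < dim_col (mat\<^sub>r k k (\<lambda>a. finsum_vec TYPE(int) k (w a) {0..<n}))"
    then have ab: "a < k" "b < k" by simp_all
    have "finsum_vec TYPE(int) k (w a) {0..<n} $ b = (\<Sum>j\<in>{0..<n}. w a j $ b)"
      using w ab by (intro index_finsum_vec) auto
    also have "\<dots> = (\<Sum>j\<in>{0..<n}. P $$ (r a, j) * A $$ (j, c b))"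
      using ab by (intro sum.cong) (auto simp: w_def v_def)
    also have "\<dots> = (P * A) $$ (r a, c b)"
      using P A r[OF ab(1)] c[OF ab(2)] by (simp add: scalar_prod_def)
    finally show "mat k k (\<lambda>(a, b). (P * A) $$ (r a, c b)) $$ (a, b)
        = mat\<^sub>r k k (\<lambda>a. finsum_vec TYPE(int) k (w a) {0..<n}) $$ (a, b)"
      using ab by simp
  qed simp_all
  then have "minor (P * A) k r c = (\<Sum>f\<in>I. det (mat\<^sub>r k k (\<lambda>a. w a (f a))))"
    unfolding minor_def I_def using w by (simp add: det_linear_rows_sum)
  also have "d dvd \<dots>"
  proof (rule dvd_sum)
    fix f assume f: "f \<in> I"
    have "det (mat\<^sub>r k k (\<lambda>a. w a (f a))) = (\<Prod>a\<in>{0..<k}. P $$ (r a, f a)) * det (mat\<^sub>r k k (\<lambda>a. v (f a)))"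
      unfolding w_def by (rule det_rows_mul) (use v in auto)
    also have "mat\<^sub>r k k (\<lambda>a. v (f a)) = mat k k (\<lambda>(a, b). A $$ (f a, c b))"
      by (rule eq_matI) (auto simp: v_def)
    finally show "d dvd det (mat\<^sub>r k k (\<lambda>a. w a (f a)))"
      using dvd_minorsD[OF d, of f c] f c A unfolding minor_def I_def by (auto intro: dvd_mult)
  qed
  finally show "d dvd minor (P * A) k r c" .
qed

lemma dvd_minors_smult:
  assumes "coprime d x" "dvd_minors d (x \<cdot>\<^sub>m A) k" shows "dvd_minors d A k"
  unfolding dvd_minors_def
proof (intro allI impI, elim conjE)
  fix r c assume rc: "\<forall>a<k. r a < dim_row A" "\<forall>b<k. c b < dim_col A"
  have "mat k k (\<lambda>(a, b). (x \<cdot>\<^sub>m A) $$ (r a, c b)) = x \<cdot>\<^sub>m mat k k (\<lambda>(a, b). A $$ (r a, c b))"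
    using rc by (intro eq_matI) auto
  then have "minor (x \<cdot>\<^sub>m A) k r c = x ^ k * minor A k r c"
    unfolding minor_def by simp
  moreover have "d dvd minor (x \<cdot>\<^sub>m A) k r c" using rc by (intro dvd_minorsD[OF assms(2)]) auto
  ultimately show "d dvd minor A k r c"
    using assms(1) by (metis coprime_dvd_mult_right_iff coprime_power_right_iff)
qed

text \<open>Multiplying by the adjugate inverts a multiplication up to the determinant.\<close>

lemma dvd_minors_mult_left_iff:
  assumes P: "P \<in> carrier_mat n n" and A: "A \<in> carrier_mat n m" and "coprime d (det P)"
  shows "dvd_minors d (P * A) k \<longleftrightarrow> dvd_minors d A k"
proof
  assume "dvd_minors d (P * A) k"
  then have "dvd_minors d (adj_mat P * (P * A)) k"
    using P A adj_mat(1)[OF P] by (auto intro: dvd_minors_mult_left[of "adj_mat P" n n "P * A" m])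
  also have "adj_mat P * (P * A) = (adj_mat P * P) * A"
    using assoc_mult_mat[OF adj_mat(1)[OF P] P A] by simp
  also have "\<dots> = det P \<cdot>\<^sub>m A"
    unfolding adj_mat(3)[OF P] using A by (simp add: mult_smult_assoc_mat[of _ n n])
  finally have "dvd_minors d (det P \<cdot>\<^sub>m A) k" .
  then show "dvd_minors d A k" using assms(3) by (rule dvd_minors_smult[rotated])
qed (rule dvd_minors_mult_left[OF P A])

lemma dvd_minors_mult_right_iff:
  assumes A: "A \<in> carrier_mat m n" and Q: "Q \<in> carrier_mat n n" and "coprime d (det Q)"
  shows "dvd_minors d (A * Q) k \<longleftrightarrow> dvd_minors d A k"
proof -
  have "dvd_minors d (transpose_mat Q * transpose_mat A) k \<longleftrightarrow> dvd_minors d (transpose_mat A) k"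
    using assms by (intro dvd_minors_mult_left_iff[of _ n _ m]) (auto simp: det_transpose[OF Q])
  then show ?thesis using transpose_mult[OF A Q] by (metis dvd_minors_transpose)
qed

lemma det_cong:
  fixes A B :: "int mat"
  assumes A: "A \<in> carrier_mat n n" and B: "B \<in> carrier_mat n n"
    and "\<And>i j. i < n \<Longrightarrow> j < n \<Longrightarrow> [A $$ (i, j) = B $$ (i, j)] (mod q)"
  shows "[det A = det B] (mod q)"
  unfolding det_def'[OF A] det_def'[OF B]
  using assms(3) by (intro cong_sum cong_mult cong_prod cong_refl) (auto simp: permutes_in_image)

lemma dvd_minors_cong:
  assumes A: "A \<in> carrier_mat n m" and B: "B \<in> carrier_mat n m"
    and cong: "\<And>i j. i < n \<Longrightarrow> j < m \<Longrightarrow> [A $$ (i, j) = B $$ (i, j)] (mod q)" and "d dvd q"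
  shows "dvd_minors d A k \<longleftrightarrow> dvd_minors d B k"
proof -
  have "d dvd minor A k r c \<longleftrightarrow> d dvd minor B k r c"
    if "\<forall>a<k. r a < n" "\<forall>b<k. c b < m" for r c
  proof -
    have "[minor A k r c = minor B k r c] (mod q)"
      unfolding minor_def by (rule det_cong) (use that cong in auto)
    then have "[minor A k r c = minor B k r c] (mod d)" using \<open>d dvd q\<close> by (rule cong_dvd_modulus)
    then show ?thesis by (rule cong_dvd_iff)
  qed
  then show ?thesis using A B unfolding dvd_minors_def by auto
qed

lemma minor_eq_0_of_equal_rows:
  assumes "\<not> inj_on r {..<k}" shows "minor A k r c = 0"
proof -
  obtain a b where "a < k" "b < k" "a \<noteq> b" "r a = r b" using assms by (auto simp: inj_on_def)
  then show ?thesis unfolding minor_def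
    by (intro det_identical_rows[of _ k a b]) (auto intro!: eq_vecI)
qed

text \<open>Sorting the selected rows permutes the rows of the minor, which changes it by a sign. Together with
  the vanishing of minors with a repeated row, this reduces selections to submatrices.\<close>

lemma minor_eq_signed_sorted_rows:
  assumes "inj_on r {..<k}"
  shows "\<exists>\<sigma>. minor A k r c = signof \<sigma> * minor A k (pick (r ` {..<k})) c"
proof -
  define I where "I = r ` {..<k}"
  have cardI: "card I = k" unfolding I_def using assms by (simp add: card_image)
  have finI: "finite I" by (simp add: I_def)
  define s where "s a = card {x \<in> I. x < r a}" for a
  have pick_s: "pick I (s a) = r a" if "a < k" for a
    unfolding s_def using that by (intro pick_card_in_set) (auto simp: I_def)
  have s_less: "s a < k" if "a < k" for a
  proof -
    have "{x \<in> I. x < r a} \<subset> I" using that by (auto simp: I_def)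
    then show ?thesis using psubset_card_mono[OF finI] cardI unfolding s_def by metis
  qed
  have inj: "inj_on s {0..<k}"
    using pick_s assms by (intro inj_onI) (metis atLeastLessThan_iff inj_onD lessThan_iff)
  define \<sigma> where "\<sigma> a = (if a < k then s a else a)" for a
  have "bij_betw \<sigma> {0..<k} {0..<k}"
  proof -
    have "inj_on \<sigma> {0..<k}" using inj by (auto simp: inj_on_def \<sigma>_def)
    moreover have "\<sigma> ` {0..<k} \<subseteq> {0..<k}" using s_less by (auto simp: \<sigma>_def)
    ultimately show ?thesis by (simp add: bij_betw_def endo_inj_surj)
  qed
  then have \<sigma>: "\<sigma> permutes {0..<k}" by (intro bij_imp_permutes) (auto simp: \<sigma>_def)
  define M where "M = mat k k (\<lambda>(a, b). A $$ (pick I a, c b))"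
  have "mat k k (\<lambda>(a, b). A $$ (r a, c b)) = mat k k (\<lambda>(a, b). M $$ (\<sigma> a, b))"
    by (rule eq_matI) (auto simp: M_def \<sigma>_def s_less pick_s)
  then have "minor A k r c = signof \<sigma> * det M"
    unfolding minor_def using det_permute_rows[OF _ \<sigma>, of M] by (simp add: M_def)
  then show ?thesis unfolding minor_def M_def I_def by blast
qed

lemma submatrix_eq_minor:
  assumes "I \<subseteq> {..<dim_row A}" "J \<subseteq> {..<dim_col A}" "card I = k" "card J = k"
  shows "det (submatrix A I J) = minor A k (pick I) (pick J)"
proof -
  have "{i. i < dim_row A \<and> i \<in> I} = I" "{j. j < dim_col A \<and> j \<in> J} = J" using assms by auto
  then show ?thesis unfolding submatrix_def minor_def using assms by simp
qed

lemma dvd_minors_iff_submatrix: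
  "dvd_minors d A k \<longleftrightarrow> (\<forall>I J. I \<subseteq> {..<dim_row A} \<and> J \<subseteq> {..<dim_col A} \<and> card I = k \<and> card J = k
      \<longrightarrow> d dvd det (submatrix A I J))" (is "_ \<longleftrightarrow> ?sub")
proof
  assume d: "dvd_minors d A k"
  show ?sub
  proof (intro allI impI, elim conjE)
    fix I J assume IJ: "I \<subseteq> {..<dim_row A}" "J \<subseteq> {..<dim_col A}" "card I = k" "card J = k"
    have "pick I a < dim_row A" if "a < k" for a
      using pick_in_set_le[of a I] IJ that by auto
    moreover have "pick J a < dim_col A" if "a < k" for a
      using pick_in_set_le[of a J] IJ that by auto
    ultimately show "d dvd det (submatrix A I J)"
      using dvd_minorsD[OF d] submatrix_eq_minor[OF IJ] by simp
  qed
next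
  assume sub: ?sub
  show "dvd_minors d A k"
    unfolding dvd_minors_def
  proof (intro allI impI, elim conjE)
    fix r c assume rc: "\<forall>a<k. r a < dim_row A" "\<forall>b<k. c b < dim_col A"
    show "d dvd minor A k r c"
    proof (cases "inj_on r {..<k} \<and> inj_on c {..<k}")
      case True
      define I where "I = r ` {..<k}"
      define J where "J = c ` {..<k}"
      have IJ: "I \<subseteq> {..<dim_row A}" "J \<subseteq> {..<dim_col A}" "card I = k" "card J = k"
        using True rc by (auto simp: I_def J_def card_image)
      have pI: "pick I a < dim_row A" if "a < k" for a
        using pick_in_set_le[of a I] IJ that by auto
      have pJ: "pick J a < dim_col A" if "a < k" for a
        using pick_in_set_le[of a J] IJ that by auto
      obtain \<sigma> where "minor A k r c = signof \<sigma> * minor A k (pick I) c"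
        using minor_eq_signed_sorted_rows True unfolding I_def by blast
      also have "minor A k (pick I) c = minor (transpose_mat A) k c (pick I)"
        using rc pI by (simp add: minor_transpose)
      also obtain \<tau> where "minor (transpose_mat A) k c (pick I)
          = signof \<tau> * minor (transpose_mat A) k (pick J) (pick I)"
        using minor_eq_signed_sorted_rows True unfolding J_def by blast
      also have "minor (transpose_mat A) k (pick J) (pick I) = det (submatrix A I J)"
        using pI pJ submatrix_eq_minor[OF IJ] by (simp add: minor_transpose)
      finally show ?thesis using sub IJ by simp
    next
      case False
      then consider "\<not> inj_on r {..<k}" | "\<not> inj_on c {..<k}" by blast
      then have "minor A k r c = 0"
      proof cases
        case 2
        then have "minor (transpose_mat A) k c r = 0" by (rule minor_eq_0_of_equal_rows)
        then show ?thesis using rc by (simp add: minor_transpose)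
      qed (rule minor_eq_0_of_equal_rows)
      then show ?thesis by simp
    qed
  qed
qed

lemma dvd_determinantal_divisor_iff:
  "d dvd determinantal_divisor A k \<longleftrightarrow> dvd_minors d A k"
  unfolding determinantal_divisor_def dvd_Gcd_iff dvd_minors_iff_submatrix by blast

section \<open>Smith normal form of integer matrices\<close>

text \<open>The determinant condition is easier to verify for elementary matrices than invertibility, to which
  it is equivalent.\<close>

definition unimod_equiv :: "nat \<Rightarrow> int mat \<Rightarrow> int mat \<Rightarrow> bool" where
  "unimod_equiv n A B \<longleftrightarrow> (\<exists>P Q. P \<in> carrier_mat n n \<and> Q \<in> carrier_mat n n \<and>
     det P dvd 1 \<and> det Q dvd 1 \<and> B = P * A * Q)"

lemma unimod_equiv_left:
  assumes "A \<in> carrier_mat n n" "P \<in> carrier_mat n n" "det P dvd 1"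
  shows "unimod_equiv n A (P * A)"
  unfolding unimod_equiv_def using assms
  by (intro exI[of _ P] exI[of _ "1\<^sub>m n"]) (auto simp: right_mult_one_mat[of _ n n])

lemma unimod_equiv_refl: "A \<in> carrier_mat n n \<Longrightarrow> unimod_equiv n A A"
  using unimod_equiv_left[of A n "1\<^sub>m n"] by simp

lemma unimod_equiv_carrier: "A \<in> carrier_mat n n \<Longrightarrow> unimod_equiv n A B \<Longrightarrow> B \<in> carrier_mat n n"
  unfolding unimod_equiv_def by auto

lemma unimod_equiv_trans [trans]:
  assumes A: "A \<in> carrier_mat n n" and "unimod_equiv n A B" "unimod_equiv n B C"
  shows "unimod_equiv n A C"
proof -
  obtain P Q where PQ: "P \<in> carrier_mat n n" "Q \<in> carrier_mat n n" "det P dvd 1" "det Q dvd 1"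
    "B = P * A * Q" using assms unfolding unimod_equiv_def by blast
  obtain R S where RS: "R \<in> carrier_mat n n" "S \<in> carrier_mat n n" "det R dvd 1" "det S dvd 1"
    "C = R * B * S" using assms unfolding unimod_equiv_def by blast
  have "C = (R * P) * A * (Q * S)"
    using A PQ RS by (simp add: assoc_mult_mat[of _ n n _ n _ n])
  moreover have "det (R * P) dvd 1" "det (Q * S) dvd 1"
    using PQ RS by (simp_all add: det_mult abs_mult)
  ultimately show ?thesis unfolding unimod_equiv_def using PQ RS
    by (intro exI[of _ "R * P"] exI[of _ "Q * S"]) auto
qed

lemma unimod_equiv_transpose:
  assumes A: "A \<in> carrier_mat n n" and "unimod_equiv n A B"
  shows "unimod_equiv n (transpose_mat A) (transpose_mat B)"
proof -
  obtain P Q where PQ: "P \<in> carrier_mat n n" "Q \<in> carrier_mat n n" "det P dvd 1" "det Q dvd 1"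
    "B = P * A * Q" using assms unfolding unimod_equiv_def by blast
  have "transpose_mat B = transpose_mat Q * transpose_mat A * transpose_mat P"
    using PQ A by (simp add: transpose_mult[of _ n n _ n] assoc_mult_mat[of _ n n _ n _ n])
  then show ?thesis unfolding unimod_equiv_def using PQ
    by (intro exI[of _ "transpose_mat Q"] exI[of _ "transpose_mat P"])
      (auto simp: det_transpose)
qed

lemma unimod_equiv_subtract_first_row:
  fixes q :: "nat \<Rightarrow> int"
  assumes A: "A \<in> carrier_mat n n" and n: "0 < n" and q: "q 0 = 0"
  shows "unimod_equiv n A (mat n n (\<lambda>(i, j). A $$ (i, j) - q i * A $$ (0, j)))"
proof -
  define P :: "int mat" where "P = mat n n (\<lambda>(i, k). (if i = k then 1 else 0) - (if k = 0 then q i else 0))"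
  have P: "P \<in> carrier_mat n n" by (simp add: P_def)
  have "det P = prod_list (diag_mat P)"
    by (rule det_lower_triangular[OF _ P]) (auto simp: P_def)
  also have "\<dots> = (\<Prod>i = 0..<n. P $$ (i, i))" using P by (simp add: prod_list_diag_prod)
  also have "\<dots> = 1" by (rule prod.neutral) (auto simp: P_def q)
  finally have "det P = 1" .
  moreover have "P * A = mat n n (\<lambda>(i, j). A $$ (i, j) - q i * A $$ (0, j))"
  proof (rule eq_matI)
    fix i j assume "i < dim_row (mat n n (\<lambda>(i, j). A $$ (i, j) - q i * A $$ (0, j)))"
      "j < dim_col (mat n n (\<lambda>(i, j). A $$ (i, j) - q i * A $$ (0, j)))"
    then have ij: "i < n" "j < n" by simp_all
    have "(P * A) $$ (i, j) = (\<Sum>k\<in>{0..<n}. P $$ (i, k) * A $$ (k, j))"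
      using ij A P by (simp add: scalar_prod_def)
    also have "\<dots> = (\<Sum>k\<in>{0..<n}. (if k = i then A $$ (k, j) else 0) - (if k = 0 then q i * A $$ (k, j) else 0))"
      using ij by (intro sum.cong) (auto simp: P_def algebra_simps)
    also have "\<dots> = A $$ (i, j) - q i * A $$ (0, j)"
      using ij n by (simp add: sum_subtractf)
    finally show "(P * A) $$ (i, j) = mat n n (\<lambda>(i, j). A $$ (i, j) - q i * A $$ (0, j)) $$ (i, j)"
      using ij by simp
  qed (use A P in auto)
  ultimately show ?thesis using unimod_equiv_left[OF A P] by simp
qed

lemma unimod_equiv_swaprows:
  assumes A: "A \<in> carrier_mat n n" and "l < n"
  shows "unimod_equiv n A (swaprows 0 l A)"
proof (cases "l = 0")
  case True
  have "swaprows 0 0 A = A" by (rule eq_matI) auto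
  then show ?thesis using True unimod_equiv_refl[OF A] by simp
next
  case False
  then have "det (swaprows_mat n 0 l :: int mat) = - 1" using assms by (intro det_swaprows_mat) auto
  then show ?thesis
    using unimod_equiv_left[OF A, of "swaprows_mat n 0 l"] swaprows_mat[OF A, of 0 l] assms
    by (simp add: swaprows_mat_carrier)
qed

lemma unimod_equiv_add_to_first_row:
  assumes A: "A \<in> carrier_mat n n" and "l < n" "l \<noteq> 0"
  shows "unimod_equiv n A (addrow 1 0 l A)"
  using unimod_equiv_left[OF A, of "addrow_mat n 1 0 l"] addrow_mat[OF A \<open>l < n\<close>, of 1 0]
    det_addrow_mat[of 0 l n "1::int"] assms by simp

text \<open>Otherwise a remainder modulo the corner entry could be moved into the corner.\<close>

lemma minimal_corner_dvd_column:
  assumes A: "A \<in> carrier_mat n n" and AC: "unimod_equiv n A C" and ne: "C $$ (0, 0) \<noteq> 0"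
    and min: "\<And>D. unimod_equiv n A D \<Longrightarrow> D $$ (0, 0) \<noteq> 0 \<Longrightarrow> \<bar>C $$ (0, 0)\<bar> \<le> \<bar>D $$ (0, 0)\<bar>"
    and i: "i < n"
  shows "C $$ (0, 0) dvd C $$ (i, 0)"
proof (rule ccontr)
  assume ndvd: "\<not> C $$ (0, 0) dvd C $$ (i, 0)"
  have C: "C \<in> carrier_mat n n" using unimod_equiv_carrier[OF A AC] .
  define q where "q k = (if k = 0 then 0 else C $$ (k, 0) div C $$ (0, 0))" for k
  define E where "E = mat n n (\<lambda>(i, j). C $$ (i, j) - q i * C $$ (0, j))"
  have i0: "i \<noteq> 0" using ndvd by (cases "i = 0") auto
  have n: "0 < n" using i by simp
  have AE: "unimod_equiv n A E"
    using unimod_equiv_trans[OF A AC unimod_equiv_subtract_first_row[OF C n, of q]]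
    by (simp add: q_def E_def)
  have E: "E \<in> carrier_mat n n" by (simp add: E_def)
  have "E $$ (i, 0) = C $$ (i, 0) mod C $$ (0, 0)"
    using i n i0 by (simp add: E_def q_def minus_div_mult_eq_mod)
  moreover have "C $$ (i, 0) mod C $$ (0, 0) \<noteq> 0" using ndvd by (simp add: dvd_eq_mod_eq_0)
  moreover have "\<bar>C $$ (i, 0) mod C $$ (0, 0)\<bar> < \<bar>C $$ (0, 0)\<bar>" using ne by (rule abs_mod_less)
  moreover have "swaprows 0 i E $$ (0, 0) = E $$ (i, 0)" using E n i by simp
  ultimately show False
    using min[OF unimod_equiv_trans[OF A AE unimod_equiv_swaprows[OF E i]]] by simp
qed

text \<open>Among the unimodularly equivalent matrices with nonzero corner take one whose corner has minimal
  absolute value. The corner divides its column and its row, which can therefore be cleared. Adding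
  any row to the first then shows that the corner divides every entry.\<close>

lemma exists_pivot:
  assumes A: "A \<in> carrier_mat n n" and ne: "A \<noteq> 0\<^sub>m n n"
  obtains E where "unimod_equiv n A E" "E $$ (0, 0) \<noteq> 0"
    "\<And>i j. i < n \<Longrightarrow> j < n \<Longrightarrow> E $$ (0, 0) dvd E $$ (i, j)"
    "\<And>i. 0 < i \<Longrightarrow> i < n \<Longrightarrow> E $$ (i, 0) = 0" "\<And>j. 0 < j \<Longrightarrow> j < n \<Longrightarrow> E $$ (0, j) = 0"
proof -
  obtain i j where ij: "i < n" "j < n" "A $$ (i, j) \<noteq> 0"
  proof -
    have "\<not> (\<forall>i<n. \<forall>j<n. A $$ (i, j) = 0)"
    proof
      assume "\<forall>i<n. \<forall>j<n. A $$ (i, j) = 0"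
      then have "A = 0\<^sub>m n n" using A by (intro eq_matI) auto
      then show False using ne by simp
    qed
    then show ?thesis using that by blast
  qed
  have n: "0 < n" using ij by simp
  define S where "S = {C. unimod_equiv n A C \<and> C $$ (0, 0) \<noteq> 0}"
  have "S \<noteq> {}"
  proof -
    define B where "B = swaprows 0 i A"
    have B: "unimod_equiv n A B" "B \<in> carrier_mat n n" "B $$ (0, j) \<noteq> 0"
      using unimod_equiv_swaprows[OF A ij(1)] A ij n by (auto simp: B_def)
    define C where "C = transpose_mat (swaprows 0 j (transpose_mat B))"
    have "unimod_equiv n (transpose_mat (transpose_mat B)) C"
      unfolding C_def using B ij by (intro unimod_equiv_transpose unimod_equiv_swaprows) auto
    then have "unimod_equiv n A C" using unimod_equiv_trans[OF A B(1)] by simp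
    moreover have "C $$ (0, 0) = B $$ (0, j)" using B(2) ij n by (simp add: C_def)
    ultimately show ?thesis using B(3) unfolding S_def by force
  qed
  then obtain B where B: "B \<in> S" "\<And>C. C \<in> S \<Longrightarrow> nat \<bar>B $$ (0, 0)\<bar> \<le> nat \<bar>C $$ (0, 0)\<bar>"
    using ex_has_least_nat[of "\<lambda>C. C \<in> S" _ "\<lambda>C. nat \<bar>C $$ (0, 0)\<bar>"] by blast
  define b where "b = B $$ (0, 0)"
  have b: "b \<noteq> 0" "unimod_equiv n A B" using B(1) by (auto simp: S_def b_def)
  have min: "\<bar>b\<bar> \<le> \<bar>D $$ (0, 0)\<bar>" if "unimod_equiv n A D" "D $$ (0, 0) \<noteq> 0" for D
    using B(2)[of D] that unfolding S_def b_def by simp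
  have col: "b dvd C $$ (i, 0)" if "unimod_equiv n A C" "C $$ (0, 0) = b" "i < n" for C i
    using minimal_corner_dvd_column[OF A that(1) _ _ that(3)] min b that(2) by simp
  have row: "b dvd C $$ (0, j)" if C: "unimod_equiv n A C" "C $$ (0, 0) = b" and j: "j < n" for C j
  proof -
    have Cc: "C \<in> carrier_mat n n" using unimod_equiv_carrier[OF A C(1)] .
    have "transpose_mat C $$ (0, 0) dvd transpose_mat C $$ (j, 0)"
    proof (rule minimal_corner_dvd_column[of "transpose_mat A" n])
      show "transpose_mat A \<in> carrier_mat n n" using A by simp
      show "unimod_equiv n (transpose_mat A) (transpose_mat C)" by (rule unimod_equiv_transpose[OF A C(1)])
      show "transpose_mat C $$ (0, 0) \<noteq> 0" using Cc C(2) b n by simp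
      show "j < n" by (rule j)
      fix D assume D: "unimod_equiv n (transpose_mat A) D" "D $$ (0, 0) \<noteq> 0"
      have "D \<in> carrier_mat n n" using unimod_equiv_carrier[OF _ D(1)] A by simp
      moreover have "unimod_equiv n A (transpose_mat D)"
        using unimod_equiv_transpose[OF _ D(1)] A by simp
      ultimately show "\<bar>transpose_mat C $$ (0, 0)\<bar> \<le> \<bar>D $$ (0, 0)\<bar>"
        using min[of "transpose_mat D"] D(2) Cc C(2) n by simp
    qed
    then show ?thesis using Cc C(2) j n by simp
  qed
  have Bc: "B \<in> carrier_mat n n" using unimod_equiv_carrier[OF A b(2)] .
  define q where "q k = (if k = 0 then 0 else B $$ (k, 0) div b)" for k
  define C where "C = mat n n (\<lambda>(i, j). B $$ (i, j) - q i * B $$ (0, j))"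
  have AC: "unimod_equiv n A C"
    using unimod_equiv_trans[OF A b(2) unimod_equiv_subtract_first_row[OF Bc n, of q]]
    by (simp add: q_def C_def)
  have Cc: "C \<in> carrier_mat n n" by (simp add: C_def)
  have C00: "C $$ (0, 0) = b" using n by (simp add: C_def q_def b_def)
  have Ci0: "C $$ (k, 0) = 0" if "0 < k" "k < n" for k
    using col[OF b(2) b_def[symmetric] that(2)] that n by (simp add: C_def q_def b_def[symmetric])
  define r where "r k = (if k = 0 then 0 else C $$ (0, k) div b)" for k
  define E where "E = transpose_mat (mat n n (\<lambda>(i, j). transpose_mat C $$ (i, j) - r i * transpose_mat C $$ (0, j)))"
  have "unimod_equiv n (transpose_mat (transpose_mat C)) E"
    unfolding E_def using Cc n
    by (intro unimod_equiv_transpose unimod_equiv_subtract_first_row) (auto simp: r_def)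
  then have AE: "unimod_equiv n A E" using unimod_equiv_trans[OF A AC] by simp
  have Ec: "E \<in> carrier_mat n n" by (simp add: E_def)
  have E_eq: "E $$ (i, j) = C $$ (i, j) - r j * C $$ (i, 0)" if "i < n" "j < n" for i j
    using that Cc n by (simp add: E_def)
  have E00: "E $$ (0, 0) = b" using n by (simp add: E_eq C00 r_def)
  have Ei0: "E $$ (k, 0) = 0" if "0 < k" "k < n" for k
    using that n Ci0[OF that] by (simp add: E_eq)
  have E0j: "E $$ (0, k) = 0" if "0 < k" "k < n" for k
    using that n row[OF AC C00 that(2)] by (simp add: E_eq C00 r_def)
  have "b dvd E $$ (i, j)" if ij: "i < n" "j < n" for i j
  proof (cases "i = 0")
    case True
    then show ?thesis using row[OF AE E00 ij(2)] by simp
  next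
    case False
    have "unimod_equiv n A (addrow 1 0 i E)"
      using unimod_equiv_trans[OF A AE unimod_equiv_add_to_first_row[OF Ec ij(1) False]] .
    moreover have "addrow 1 0 i E $$ (0, 0) = b" using Ec n False ij by (simp add: Ei0 E00)
    ultimately have "b dvd addrow 1 0 i E $$ (0, j)" using ij(2) by (rule row)
    then have "b dvd E $$ (i, j) + E $$ (0, j)" using Ec n ij by simp
    then show ?thesis using row[OF AE E00 ij(2)] by (simp add: dvd_add_left_iff)
  qed
  then show ?thesis using that[OF AE] E00 b Ei0 E0j by simp
qed

text \<open>The pivot divides every entry of the remaining block, hence also every entry of the diagonal form
  which the induction hypothesis provides for that block.\<close>

lemma unimod_equiv_smith:
  assumes "A \<in> carrier_mat n n"
  shows "\<exists>D. unimod_equiv n A D \<and> diagonal_mat D \<and> (\<forall>i<n. 0 \<le> D $$ (i, i)) \<and>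
    (\<forall>i. Suc i < n \<longrightarrow> D $$ (i, i) dvd D $$ (Suc i, Suc i))"
  using assms
proof (induction n arbitrary: A)
  case 0
  then show ?case using unimod_equiv_refl[OF 0] by (auto simp: diagonal_mat_def)
next
  case (Suc n)
  show ?case
  proof (cases "A = 0\<^sub>m (Suc n) (Suc n)")
    case True
    then show ?thesis using unimod_equiv_refl[OF Suc.prems] by (auto simp: diagonal_mat_def)
  next
    case False
    obtain E where E: "unimod_equiv (Suc n) A E" "E $$ (0, 0) \<noteq> 0"
      "\<And>i j. i < Suc n \<Longrightarrow> j < Suc n \<Longrightarrow> E $$ (0, 0) dvd E $$ (i, j)"
      "\<And>i. 0 < i \<Longrightarrow> i < Suc n \<Longrightarrow> E $$ (i, 0) = 0" "\<And>j. 0 < j \<Longrightarrow> j < Suc n \<Longrightarrow> E $$ (0, j) = 0"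
      using exists_pivot[OF Suc.prems False] by metis
    have Ec: "E \<in> carrier_mat (Suc n) (Suc n)" using unimod_equiv_carrier[OF Suc.prems E(1)] .
    define b where "b = E $$ (0, 0)"
    define E' where "E' = mat n n (\<lambda>(i, j). E $$ (Suc i, Suc j))"
    define one :: "int \<Rightarrow> int mat" where "one x = mat 1 1 (\<lambda>_. x)" for x
    have one: "one x \<in> carrier_mat 1 1" "det (one x) = x" "one x * one y = one (x * y)" for x y
      by (auto simp: one_def det_single intro!: eq_matI simp: scalar_prod_def)
    have one_zero: "one x * 0\<^sub>m (Suc 0) n = 0\<^sub>m (Suc 0) n" "0\<^sub>m n (Suc 0) * one x = 0\<^sub>m n (Suc 0)" for x
      by (auto simp: one_def scalar_prod_def intro!: eq_matI)
    define block where "block x M = four_block_mat (one x) (0\<^sub>m 1 n) (0\<^sub>m n 1) M" for x M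
    have block: "block x M \<in> carrier_mat (Suc n) (Suc n)" "det (block x M) = x * det M"
      if "M \<in> carrier_mat n n" for x M
      unfolding block_def
      using four_block_carrier_mat[OF one(1) that] det_four_block_mat_lower_left_zero[OF one(1) _ refl that, of "0\<^sub>m 1 n"] one
      by auto
    have block_mult: "block x M * block y N = block (x * y) (M * N)"
      if "M \<in> carrier_mat n n" "N \<in> carrier_mat n n" for x y M N
      unfolding block_def
      by (subst mult_four_block_mat[OF one(1) _ _ that(1) one(1) _ _ that(2)]) (use that one one_zero in auto)
    have E_block: "E = block b E'"
      by (rule eq_matI) (use Ec E(4,5) in \<open>auto simp: block_def one_def E'_def b_def\<close>)
    obtain D' where D': "unimod_equiv n E' D'" "diagonal_mat D'" "\<forall>i<n. 0 \<le> D' $$ (i, i)"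
      "\<forall>i. Suc i < n \<longrightarrow> D' $$ (i, i) dvd D' $$ (Suc i, Suc i)"
      using Suc.IH[of E'] by (auto simp: E'_def)
    obtain P Q where PQ: "P \<in> carrier_mat n n" "Q \<in> carrier_mat n n" "det P dvd 1" "det Q dvd 1"
      "D' = P * E' * Q" using D'(1) unfolding unimod_equiv_def by blast
    have E'c: "E' \<in> carrier_mat n n" by (simp add: E'_def)
    have D'c: "D' \<in> carrier_mat n n" using PQ E'c by simp
    have sgn: "sgn b dvd 1" "sgn b * b = \<bar>b\<bar>" using E(2) by (auto simp: b_def sgn_if)
    define D where "D = block \<bar>b\<bar> D'"
    have "D = block (sgn b) P * E * block 1 Q"
      unfolding E_block D_def using PQ E'c sgn(2) by (simp add: block_mult)
    moreover have "det (block (sgn b) P) dvd 1" "det (block 1 Q) dvd 1"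
      using PQ sgn by (simp_all add: block abs_mult)
    ultimately have "unimod_equiv (Suc n) E D"
      unfolding unimod_equiv_def using block(1)[OF PQ(1)] block(1)[OF PQ(2)]
      by (intro exI[of _ "block (sgn b) P"] exI[of _ "block 1 Q"]) simp
    then have AD: "unimod_equiv (Suc n) A D" by (rule unimod_equiv_trans[OF Suc.prems E(1)])
    have D_Suc: "D $$ (Suc i, Suc j) = D' $$ (i, j)" if "i < n" "j < n" for i j
      using D'c that by (auto simp: D_def block_def one_def)
    have D_00: "D $$ (0, 0) = \<bar>b\<bar>" using D'c by (simp add: D_def block_def one_def)
    have D_diag: "diagonal_mat D"
      unfolding diagonal_mat_def D_def block_def using D'(2) D'c
      by (auto simp: one_def diagonal_mat_def)
    have D_nonneg: "\<forall>i<Suc n. 0 \<le> D $$ (i, i)"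
    proof (intro allI impI)
      fix i assume "i < Suc n" then show "0 \<le> D $$ (i, i)"
        using D'(3) D_00 D_Suc by (cases i) auto
    qed
    have D_chain: "D $$ (i, i) dvd D $$ (Suc i, Suc i)" if i: "Suc i < Suc n" for i
    proof (cases i)
      case 0
      have "b dvd E' $$ (j, k)" if "j < n" "k < n" for j k
        using E(3)[of "Suc j" "Suc k"] that by (simp add: E'_def b_def)
      then have PE: "b dvd (P * E') $$ (j, k)" if "j < n" "k < n" for j k
        using that PQ E'c by (auto simp: scalar_prod_def intro!: dvd_sum dvd_mult)
      have "b dvd (P * E' * Q) $$ (0, 0)"
      proof -
        have n: "0 < n" using i 0 by simp
        have "(Y * Q) $$ (0, 0) = (\<Sum>k\<in>{0..<n}. Y $$ (0, k) * Q $$ (k, 0))" if "Y \<in> carrier_mat n n" for Y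
          using PQ that n by (simp add: scalar_prod_def)
        then have "(P * E' * Q) $$ (0, 0) = (\<Sum>k\<in>{0..<n}. (P * E') $$ (0, k) * Q $$ (k, 0))"
          using PQ E'c by (simp del: assoc_mult_mat)
        also have "b dvd \<dots>" using PE n by (intro dvd_sum dvd_mult2) auto
        finally show ?thesis .
      qed
      then show ?thesis using 0 i D_00 D_Suc PQ(5) by simp
    next
      case (Suc k)
      then show ?thesis using D'(4) D_Suc i by simp
    qed
    show ?thesis using AD D_diag D_nonneg D_chain by (intro exI[of _ D]) simp
  qed
qed

lemma invertible_int_mat_iff_det:
  fixes P :: "int mat"
  assumes P: "P \<in> carrier_mat n n"
  shows "invertible_mat P \<longleftrightarrow> det P dvd 1"
proof
  assume "invertible_mat P"
  then obtain B where B: "P * B = 1\<^sub>m n" "B * P = 1\<^sub>m (dim_row B)"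
    using P unfolding invertible_mat_def inverts_mat_def by auto
  have "B \<in> carrier_mat n n"
    using arg_cong[OF B(1), of dim_col] arg_cong[OF B(2), of dim_col] P by auto
  then have "det P * det B = 1" using det_mult[OF P, of B] B by simp
  then show "det P dvd 1" by (metis dvd_triv_left)
next
  assume d: "det P dvd 1"
  define B where "B = det P \<cdot>\<^sub>m adj_mat P"
  have B: "B \<in> carrier_mat n n" using adj_mat(1)[OF P] by (simp add: B_def)
  have d2: "det P * det P = 1" using d by (metis abs_mult_self_eq zdvd1_eq mult_1 abs_zmult_eq_1)
  have "P * B = det P \<cdot>\<^sub>m (det P \<cdot>\<^sub>m 1\<^sub>m n)"
    unfolding B_def mult_smult_distrib[OF P adj_mat(1)[OF P]] adj_mat(2)[OF P] ..
  moreover have "B * P = det P \<cdot>\<^sub>m (det P \<cdot>\<^sub>m 1\<^sub>m n)"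
    unfolding B_def mult_smult_assoc_mat[OF adj_mat(1)[OF P] P] adj_mat(3)[OF P] ..
  moreover have "det P \<cdot>\<^sub>m (det P \<cdot>\<^sub>m 1\<^sub>m n) = 1\<^sub>m n"
    using d2 by (intro eq_matI) auto
  ultimately have "P * B = 1\<^sub>m n" "B * P = 1\<^sub>m n" by simp_all
  then show "invertible_mat P"
    using P B unfolding invertible_mat_def inverts_mat_def by auto
qed

lemma unimodular_inverse:
  fixes P :: "int mat"
  assumes P: "P \<in> carrier_mat n n" "det P dvd 1"
  obtains B where "B \<in> carrier_mat n n" "P * B = 1\<^sub>m n" "B * P = 1\<^sub>m n" "det B dvd 1"
proof -
  obtain B where B: "P * B = 1\<^sub>m n" "B * P = 1\<^sub>m (dim_row B)"
    using invertible_int_mat_iff_det[OF P(1)] P unfolding invertible_mat_def inverts_mat_def by auto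
  have Bc: "B \<in> carrier_mat n n"
    using arg_cong[OF B(1), of dim_col] arg_cong[OF B(2), of dim_col] P by auto
  have "det P * det B = 1" using det_mult[OF P(1) Bc] B(1) by simp
  then have "det B dvd 1" by (metis dvd_triv_right)
  then show ?thesis using that[OF Bc] B Bc by simp
qed

lemma smith_normal_form_exists:
  assumes A: "A \<in> carrier_mat n n" obtains D where "smith_normal_form A D"
proof -
  obtain D where D: "unimod_equiv n A D" "diagonal_mat D" "\<forall>i<n. 0 \<le> D $$ (i, i)"
    "\<forall>i. Suc i < n \<longrightarrow> D $$ (i, i) dvd D $$ (Suc i, Suc i)"
    using unimod_equiv_smith[OF A] by blast
  have "D \<in> carrier_mat n n" by (rule unimod_equiv_carrier[OF A D(1)])
  moreover have "\<exists>P Q. P \<in> carrier_mat n n \<and> invertible_mat P \<and> Q \<in> carrier_mat n n \<and> invertible_mat Q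
      \<and> D = P * A * Q"
    using D(1) invertible_int_mat_iff_det unfolding unimod_equiv_def by blast
  ultimately show ?thesis
    using that[of D] A D unfolding smith_normal_form_def by auto
qed

section \<open>Valuations of determinantal divisors\<close>

lemma rat_val_of_int_eq_iff:
  assumes "prime p"
  shows "rat_val p (rat_of_int z) = ereal (real e) \<longleftrightarrow> int p ^ e dvd z \<and> \<not> int p ^ Suc e dvd z"
proof (cases "z = 0")
  case False
  have p: "\<not> is_unit (int p)" using assms by (metis prime_int_nat_transfer prime_elem_not_unit prime_elem_iff_prime_abs prime_def prime_nat_int_transfer not_prime_unit)
  have "quotient_of (rat_of_int z) = (z, 1)" by (metis Rat.of_int_def quotient_of_int)
  then have rv: "rat_val p (rat_of_int z) = ereal (real (multiplicity (int p) z))"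
    using False by (simp add: rat_val_def)
  have "int p ^ k dvd z \<longleftrightarrow> k \<le> multiplicity (int p) z" for k
    using False p by (intro power_dvd_iff_le_multiplicity) auto
  then have "int p ^ e dvd z \<longleftrightarrow> e \<le> multiplicity (int p) z"
    "int p ^ Suc e dvd z \<longleftrightarrow> Suc e \<le> multiplicity (int p) z" by blast+
  with rv show ?thesis by (auto simp del: power_Suc)
qed (simp add: rat_val_def)

text \<open>The determinantal divisor has valuation \<open>e\<close>, expressed by divisibility: this form is invariant
  under congruence modulo high powers of \<open>p\<close>.\<close>

definition minors_val :: "nat \<Rightarrow> int mat \<Rightarrow> nat \<Rightarrow> nat \<Rightarrow> bool" where
  "minors_val p A k e \<longleftrightarrow> dvd_minors (int p ^ e) A k \<and> \<not> dvd_minors (int p ^ Suc e) A k"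

lemma rat_val_determinantal_divisor_iff:
  "prime p \<Longrightarrow> rat_val p (rat_of_int (determinantal_divisor A k)) = ereal (real e) \<longleftrightarrow> minors_val p A k e"
  by (simp only: rat_val_of_int_eq_iff dvd_determinantal_divisor_iff minors_val_def)

lemma minors_val_unique:
  assumes "minors_val p A k e" "minors_val p A k f" shows "e = f"
proof (rule ccontr)
  have le: "\<not> f < e" if "minors_val p A k e" "minors_val p A k f" for e f
  proof
    assume "f < e"
    then have "int p ^ Suc f dvd int p ^ e" by (intro le_imp_power_dvd) simp
    then show False using that unfolding minors_val_def dvd_minors_def by (meson dvd_trans)
  qed
  assume "e \<noteq> f"
  then show False using le assms by (meson linorder_neqE_nat)
qed

lemma minors_val_mult_iff:
  assumes "prime p" and P: "P \<in> carrier_mat n n" and A: "A \<in> carrier_mat n n" and Q: "Q \<in> carrier_mat n n"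
    and "\<not> int p dvd det P" "\<not> int p dvd det Q"
  shows "minors_val p (P * A * Q) k e \<longleftrightarrow> minors_val p A k e"
proof -
  have "coprime (int p ^ l) x" if "\<not> int p dvd x" for l x
    using that assms(1) by (simp add: prime_imp_coprime)
  then have "dvd_minors (int p ^ l) (P * A * Q) k \<longleftrightarrow> dvd_minors (int p ^ l) A k" for l
    using assms dvd_minors_mult_right_iff[of "P * A" n n Q] dvd_minors_mult_left_iff[OF P A]
    by simp
  then show ?thesis unfolding minors_val_def by (simp only:)
qed

lemma sum_initial_le_sum_of_card:
  fixes e :: "nat \<Rightarrow> nat"
  assumes "\<And>i j. i \<le> j \<Longrightarrow> j < n \<Longrightarrow> e i \<le> e j" and "K \<subseteq> {..<n}" "card K = k"
  shows "sum e {..<k} \<le> sum e K"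
  using assms(2,3)
proof (induction k arbitrary: K)
  case (Suc k)
  have fin: "finite K" using Suc.prems(1) finite_subset by blast
  have ne: "K \<noteq> {}" using Suc.prems(2) by auto
  define x where "x = Max K"
  have x: "x \<in> K" using fin ne by (simp add: x_def)
  have "K \<subseteq> {..x}" using fin by (auto simp: x_def)
  then have "Suc k \<le> Suc x" using card_mono[of "{..x}" K] Suc.prems(2) by simp
  then have "e k \<le> e x" using assms(1)[of k x] x Suc.prems(1) by auto
  moreover have "sum e {..<k} \<le> sum e (K - {x})"
    using Suc.prems x fin by (intro Suc.IH) auto
  ultimately show ?case using sum.remove[OF fin x, of e] by simp
qed simp

lemma exact_power_cofactor:
  fixes q x :: int
  assumes "q ^ e dvd x" "\<not> q ^ Suc e dvd x"
  obtains t where "x = q ^ e * t" "\<not> q dvd t"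
proof -
  obtain t where t: "x = q ^ e * t" using assms(1) by (rule dvdE)
  have "\<not> q dvd t"
  proof
    assume "q dvd t"
    then have "q ^ e * q dvd q ^ e * t" by (rule mult_dvd_mono[OF dvd_refl])
    then show False using assms(2) t by (simp add: mult.commute)
  qed
  then show ?thesis using that[OF t] by simp
qed

lemma prime_power_prod_exact:
  fixes d :: "nat \<Rightarrow> int"
  assumes "prime p" "finite I"
    and "\<And>i. i \<in> I \<Longrightarrow> int p ^ e i dvd d i \<and> \<not> int p ^ Suc (e i) dvd d i"
  shows "\<not> int p ^ Suc (sum e I) dvd prod d I"
proof -
  have p: "prime (int p)" using assms(1) by simp
  have "\<exists>t. d i = int p ^ e i * t \<and> \<not> int p dvd t" if i: "i \<in> I" for i
    using exact_power_cofactor[of "int p" "e i" "d i"] assms(3)[OF i] by metis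
  then obtain t where t: "\<And>i. i \<in> I \<Longrightarrow> d i = int p ^ e i * t i \<and> \<not> int p dvd t i" by metis
  have "prod d I = int p ^ sum e I * prod t I"
    using t by (simp add: prod.distrib power_sum)
  moreover have "\<not> int p dvd prod t I"
    using t p assms(2) by (simp add: prime_dvd_prod_iff)
  moreover have "int p ^ sum e I \<noteq> 0" using assms(1) by auto
  ultimately show ?thesis by (simp add: mult.commute)
qed

text \<open>A minor of a diagonal matrix is the product of the selected diagonal entries times a minor
  of the identity; a selection without repetition has at least the valuation of the first
  \<open>k\<close> entries, and the leading principal minor attains it.\<close>

lemma minors_val_diagonal:
  assumes "prime p" and D: "D \<in> carrier_mat n n" "diagonal_mat D"
    and e: "\<And>i. i < n \<Longrightarrow> int p ^ e i dvd D $$ (i, i) \<and> \<not> int p ^ Suc (e i) dvd D $$ (i, i)"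
    and mono: "\<And>i j. i \<le> j \<Longrightarrow> j < n \<Longrightarrow> e i \<le> e j" and k: "k \<le> n"
  shows "minors_val p D k (sum e {..<k})"
proof -
  have "int p ^ sum e {..<k} dvd minor D k r c" if rc: "\<forall>a<k. r a < n" "\<forall>b<k. c b < n" for r c
  proof (cases "inj_on r {..<k}")
    case True
    have "mat k k (\<lambda>(a, b). D $$ (r a, c b))
        = mat\<^sub>r k k (\<lambda>a. D $$ (r a, r a) \<cdot>\<^sub>v vec k (\<lambda>b. if r a = c b then 1 else 0))"
      using rc D by (intro eq_matI) (auto simp: diagonal_mat_def)
    then have "minor D k r c = (\<Prod>a\<in>{0..<k}. D $$ (r a, r a))
        * det (mat\<^sub>r k k (\<lambda>a. vec k (\<lambda>b. if r a = c b then 1 else 0)))"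
      unfolding minor_def by (simp add: det_rows_mul)
    moreover have "int p ^ sum e {..<k} dvd (\<Prod>a\<in>{0..<k}. D $$ (r a, r a))"
    proof -
      have "sum e {..<k} \<le> sum e (r ` {..<k})"
        using True rc by (intro sum_initial_le_sum_of_card[of n] mono) (auto simp: card_image)
      also have "\<dots> = (\<Sum>a\<in>{0..<k}. e (r a))" using True by (simp add: sum.reindex atLeast0LessThan)
      finally have "int p ^ sum e {..<k} dvd int p ^ (\<Sum>a\<in>{0..<k}. e (r a))" by (rule le_imp_power_dvd)
      also have "\<dots> = (\<Prod>a\<in>{0..<k}. int p ^ e (r a))" by (simp add: power_sum)
      also have "\<dots> dvd (\<Prod>a\<in>{0..<k}. D $$ (r a, r a))"
        using e rc by (intro prod_dvd_prod) auto
      finally show ?thesis .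
    qed
    ultimately show ?thesis by simp
  qed (simp add: minor_eq_0_of_equal_rows)
  moreover have "\<not> int p ^ Suc (sum e {..<k}) dvd minor D k id id"
  proof -
    define M where "M = mat k k (\<lambda>(a, b). D $$ (id a, id b))"
    have "det M = prod_list (diag_mat M)"
      by (rule det_lower_triangular[of k]) (use D k in \<open>auto simp: M_def diagonal_mat_def\<close>)
    also have "\<dots> = (\<Prod>i\<in>{..<k}. D $$ (i, i))"
      by (simp add: prod_list_diag_prod M_def atLeast0LessThan)
    finally have "minor D k id id = (\<Prod>i\<in>{..<k}. D $$ (i, i))" by (simp add: minor_def M_def)
    then show ?thesis
      using prime_power_prod_exact[OF assms(1), of "{..<k}" e "\<lambda>i. D $$ (i, i)"] e k by simp
  qed
  ultimately show ?thesis
    using D k unfolding minors_val_def dvd_minors_def by (auto intro!: exI[of _ id])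
qed

text \<open>The determinantal divisors are invariant under multiplication by unimodular matrices and determine
  the valuations of the invariant factors as successive differences. So the condition on the Smith
  normal form becomes one on minors, in which no transformation matrices occur.\<close>

lemma smith_class_iff:
  assumes "prime p" "sorted es" "length es = n"
  shows "A \<in> smith_class p m es \<longleftrightarrow> A \<in> carrier_mat n n
    \<and> (\<forall>i<n. \<forall>j<n. A $$ (i, j) \<in> {0..int p ^ m - 1})
    \<and> (\<forall>k\<in>{1..n}. minors_val p A k (\<Sum>i<k. es ! i))"
proof -
  have mono: "es ! i \<le> es ! j" if "i \<le> j" "j < n" for i j
    using assms that by (simp add: sorted_nth_mono)
  have unit: "\<not> int p dvd det P" if "det P dvd 1" for P
    using that assms(1) by (metis dvd_trans not_prime_unit prime_nat_int_transfer)
  have "(\<exists>D. smith_normal_form A D \<and> (\<forall>i<n. rat_val p (rat_of_int (D $$ (i, i))) = ereal (real (es ! i))))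
      \<longleftrightarrow> (\<forall>k\<in>{1..n}. minors_val p A k (\<Sum>i<k. es ! i))" (is "?L \<longleftrightarrow> ?R") if A: "A \<in> carrier_mat n n"
  proof -
    have same: "minors_val p D k e \<longleftrightarrow> minors_val p A k e" if snf: "smith_normal_form A D" for D k e
    proof -
      obtain P Q where PQ: "P \<in> carrier_mat n n" "invertible_mat P" "Q \<in> carrier_mat n n"
        "invertible_mat Q" "D = P * A * Q"
        using snf A unfolding smith_normal_form_def by (auto simp del: assoc_mult_mat)
      have "\<not> int p dvd det P" "\<not> int p dvd det Q"
        using PQ invertible_int_mat_iff_det unit by auto
      then show ?thesis
        unfolding PQ(5) by (rule minors_val_mult_iff[OF assms(1) PQ(1) A PQ(3)])
    qed
    show ?thesis
    proof
      assume ?L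
      then obtain D where D: "smith_normal_form A D"
        "\<forall>i<n. rat_val p (rat_of_int (D $$ (i, i))) = ereal (real (es ! i))" by blast
      have Dc: "D \<in> carrier_mat n n" "diagonal_mat D" using D(1) A unfolding smith_normal_form_def by auto
      have "minors_val p D k (\<Sum>i<k. es ! i)" if "k \<le> n" for k
        using minors_val_diagonal[OF assms(1) Dc, of "\<lambda>i. es ! i"] D(2) that mono
        by (simp add: rat_val_of_int_eq_iff[OF assms(1)])
      then show ?R using same[OF D(1)] by simp
    next
      assume R: ?R
      obtain D where D: "smith_normal_form A D" using smith_normal_form_exists[OF A] .
      have Dc: "D \<in> carrier_mat n n" "diagonal_mat D" using D A unfolding smith_normal_form_def by auto
      have chain: "D $$ (i, i) dvd D $$ (Suc i, Suc i)" if "Suc i < n" for i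
        using D A that unfolding smith_normal_form_def by auto
      have RD: "minors_val p D k (\<Sum>i<k. es ! i)" if "k \<in> {1..n}" for k
        using R same[OF D] that by blast
      have nz: "D $$ (i, i) \<noteq> 0" if i: "i < n" for i
      proof
        assume Dii: "D $$ (i, i) = 0"
        have "dvd_minors d D n" for d
          unfolding dvd_minors_def
        proof (intro allI impI, elim conjE)
          fix r c assume rc: "\<forall>a<n. r a < dim_row D" "\<forall>b<n. c b < dim_col D"
          show "d dvd minor D n r c"
          proof (cases "inj_on r {..<n}")
            case True
            have "r ` {..<n} = {..<n}" using True rc Dc by (intro endo_inj_surj) auto
            then obtain a where a: "a < n" "r a = i" using i by (metis imageE lessThan_iff)
            have "D $$ (i, c b) = 0" if "b < n" for b
              using Dc Dii rc that i unfolding diagonal_mat_def by (cases "c b = i") auto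
            then have "row (mat n n (\<lambda>(a, b). D $$ (r a, c b))) a = 0\<^sub>v n"
              using a by (intro eq_vecI) auto
            then have "minor D n r c = 0"
              unfolding minor_def
              by (subst laplace_expansion_row[of _ n a]) (use a \<open>\<And>b. b < n \<Longrightarrow> D $$ (i, c b) = 0\<close> in auto)
            then show ?thesis by simp
          qed (simp add: minor_eq_0_of_equal_rows)
        qed
        then show False using RD[of n] i unfolding minors_val_def by auto
      qed
      define f where "f i = multiplicity (int p) (D $$ (i, i))" for i
      have p: "\<not> is_unit (int p)" using unit[of "mat 1 1 (\<lambda>_. int p)"] by (auto simp: det_single)
      have f: "int p ^ f i dvd D $$ (i, i) \<and> \<not> int p ^ Suc (f i) dvd D $$ (i, i)" if "i < n" for i
        using nz[OF that] p unfolding f_def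
        by (metis multiplicity_dvd power_dvd_iff_le_multiplicity Suc_n_not_le_n)
      have f_mono: "f i \<le> f j" if "i \<le> j" "j < n" for i j
        using that
      proof (induction j rule: dec_induct)
        case (step j)
        have "f j \<le> f (Suc j)"
          unfolding f_def using chain[OF step.prems] nz[OF step.prems]
          by (intro dvd_imp_multiplicity_le) auto
        then show ?case using step by simp
      qed simp
      have sums: "(\<Sum>i<k. f i) = (\<Sum>i<k. es ! i)" if "k \<le> n" for k
      proof (cases "k = 0")
        case False
        then show ?thesis
          using minors_val_unique[OF minors_val_diagonal[OF assms(1) Dc f f_mono that] RD[of k]] that by simp
      qed simp
      have "f i = es ! i" if "i < n" for i using sums[of i] sums[of "Suc i"] that by simp
      then show ?L using D f by (metis rat_val_of_int_eq_iff[OF assms(1)])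
    qed
  qed
  then show ?thesis unfolding smith_class_def assms(3) by blast
qed

section \<open>Principal minors and roots modulo a prime\<close>

text \<open>Summing over the permutations of \<open>K\<close> avoids renumbering the rows and columns of the submatrix.\<close>

definition principal_minor :: "'a::comm_ring_1 mat \<Rightarrow> nat set \<Rightarrow> 'a" where
  "principal_minor A K = (\<Sum>\<sigma> | \<sigma> permutes K. signof \<sigma> * (\<Prod>i\<in>K. A $$ (i, \<sigma> i)))"

text \<open>Expand \<open>det(x I - A)\<close> over the permutations \<open>\<pi>\<close> and over the sets \<open>K\<close> of rows in which the entry of
  \<open>- A\<close> is selected. The rows outside \<open>K\<close> contribute a power of \<open>x\<close> if \<open>\<pi>\<close> fixes them and \<open>0\<close>
  otherwise, so that only permutations of \<open>K\<close> remain.\<close>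

lemma coeff_char_poly_principal_minors:
  fixes A :: "int mat"
  assumes A: "A \<in> carrier_mat n n" and k: "k \<le> n"
  shows "coeff (char_poly A) (n - k) = (-1) ^ k * (\<Sum>K | K \<subseteq> {0..<n} \<and> card K = k. principal_minor A K)"
proof -
  define U where "U = {0..<n}"
  have U: "finite U" "card U = n" by (simp_all add: U_def)
  define a where "a \<pi> i = [:- A $$ (i, \<pi> i):]" for \<pi> :: "nat \<Rightarrow> nat" and i
  define x where "x \<pi> i = (if \<pi> i = i then [:0, 1:] else 0 :: int poly)" for \<pi> :: "nat \<Rightarrow> nat" and i
  have inner: "(\<Sum>\<pi> | \<pi> permutes U. signof \<pi> * ((\<Prod>i\<in>K. a \<pi> i) * (\<Prod>i\<in>U - K. x \<pi> i)))
      = monom ((-1) ^ card K * principal_minor A K) (n - card K)" if K: "K \<subseteq> U" for K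
  proof -
    define t where "t \<pi> = (signof \<pi> :: int poly) * ((\<Prod>i\<in>K. a \<pi> i) * (\<Prod>i\<in>U - K. x \<pi> i))"
      for \<pi> :: "nat \<Rightarrow> nat"
    have zero: "t \<pi> = 0" if \<pi>: "\<pi> permutes U" "\<not> \<pi> permutes K" for \<pi>
    proof -
      have "\<exists>i\<in>U - K. \<pi> i \<noteq> i"
      proof (rule ccontr)
        assume "\<not> ?thesis"
        then have "\<pi> i = i" if "i \<in> U - K" for i using that by blast
        then have "\<pi> permutes K" by (rule permutes_superset[OF \<pi>(1)])
        then show False using \<pi>(2) by simp
      qed
      then obtain i where "i \<in> U - K" "x \<pi> i = 0" unfolding x_def by auto
      then have "(\<Prod>i\<in>U - K. x \<pi> i) = 0" using U(1) by (intro prod_zero) auto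
      then show ?thesis by (simp add: t_def)
    qed
    have "(\<Sum>\<pi> | \<pi> permutes U. t \<pi>) = (\<Sum>\<pi> | \<pi> permutes K. t \<pi>)"
    proof (rule sum.mono_neutral_right)
      show "{\<pi>. \<pi> permutes K} \<subseteq> {\<pi>. \<pi> permutes U}"
        by (intro Collect_mono impI permutes_subset[OF _ K])
    qed (use zero in \<open>simp_all add: finite_permutations U\<close>)
    also have "\<dots> = (\<Sum>\<pi> | \<pi> permutes K. monom ((-1) ^ card K * (signof \<pi> * (\<Prod>i\<in>K. A $$ (i, \<pi> i)))) (n - card K))"
    proof (rule sum.cong)
      fix \<pi> assume "\<pi> \<in> {\<pi>. \<pi> permutes K}"
      then have "x \<pi> i = [:0, 1:]" if "i \<in> U - K" for i
        using that permutes_not_in[of \<pi> K i] by (simp add: x_def)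
      then have "(\<Prod>i\<in>U - K. x \<pi> i) = (\<Prod>i\<in>U - K. [:0, 1:])" by (intro prod.cong) auto
      also have "\<dots> = [:0, 1:] ^ (n - card K)"
        using K U finite_subset[OF K U(1)] by (simp add: card_Diff_subset)
      also have "\<dots> = monom 1 (n - card K)" by (simp add: x_as_monom monom_power)
      finally have x: "(\<Prod>i\<in>U - K. x \<pi> i) = monom 1 (n - card K)" .
      have "(\<Prod>i\<in>K. a \<pi> i) = [: \<Prod>i\<in>K. - A $$ (i, \<pi> i) :]"
        unfolding a_def by (induction K rule: infinite_finite_induct) (auto simp: one_pCons)
      also have "(\<Prod>i\<in>K. - A $$ (i, \<pi> i)) = (-1) ^ card K * (\<Prod>i\<in>K. A $$ (i, \<pi> i))"
        by (rule prod_uminus)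
      finally have a: "(\<Prod>i\<in>K. a \<pi> i) = [: (-1) ^ card K * (\<Prod>i\<in>K. A $$ (i, \<pi> i)) :]" .
      have "signof \<pi> = [: signof \<pi> :: int :]" by (simp add: sign_def one_pCons)
      then show "t \<pi> = monom ((-1) ^ card K * (signof \<pi> * (\<Prod>i\<in>K. A $$ (i, \<pi> i)))) (n - card K)"
        unfolding t_def x a by (simp add: smult_monom mult.left_commute)
    qed simp
    also have "\<dots> = monom ((-1) ^ card K * principal_minor A K) (n - card K)"
      unfolding principal_minor_def sum_distrib_left
      by (induction "{\<pi>. \<pi> permutes K}" rule: infinite_finite_induct) (simp_all add: add_monom monom_sum)
    finally show ?thesis unfolding t_def .
  qed
  have "char_poly A = (\<Sum>\<pi> | \<pi> permutes U. signof \<pi> * (\<Prod>i\<in>U. char_poly_matrix A $$ (i, \<pi> i)))"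
    unfolding char_poly_def U_def by (rule det_def') (use A in simp)
  also have "\<dots> = (\<Sum>\<pi> | \<pi> permutes U. \<Sum>K\<in>Pow U. signof \<pi> * ((\<Prod>i\<in>K. a \<pi> i) * (\<Prod>i\<in>U - K. x \<pi> i)))"
  proof (rule sum.cong)
    fix \<pi> assume "\<pi> \<in> {\<pi>. \<pi> permutes U}"
    then have "char_poly_matrix A $$ (i, \<pi> i) = a \<pi> i + x \<pi> i" if "i \<in> U" for i
      using that A permutes_in_image[of \<pi> U i] by (auto simp: U_def char_poly_matrix_def a_def x_def)
    then have "(\<Prod>i\<in>U. char_poly_matrix A $$ (i, \<pi> i)) = (\<Prod>i\<in>U. a \<pi> i + x \<pi> i)" by (rule prod.cong[OF refl])
    then show "signof \<pi> * (\<Prod>i\<in>U. char_poly_matrix A $$ (i, \<pi> i))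
        = (\<Sum>K\<in>Pow U. signof \<pi> * ((\<Prod>i\<in>K. a \<pi> i) * (\<Prod>i\<in>U - K. x \<pi> i)))"
      using prod_add[OF U(1), of "a \<pi>" "x \<pi>"] by (simp add: sum_distrib_left)
  qed simp
  also have "\<dots> = (\<Sum>K\<in>Pow U. \<Sum>\<pi> | \<pi> permutes U. signof \<pi> * ((\<Prod>i\<in>K. a \<pi> i) * (\<Prod>i\<in>U - K. x \<pi> i)))"
    by (rule sum.swap)
  also have "\<dots> = (\<Sum>K\<in>Pow U. monom ((-1) ^ card K * principal_minor A K) (n - card K))"
    by (rule sum.cong) (use inner in auto)
  finally have "coeff (char_poly A) (n - k)
      = (\<Sum>K\<in>Pow U. if n - card K = n - k then (-1) ^ card K * principal_minor A K else 0)"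
    by (simp add: coeff_sum coeff_monom)
  also have "\<dots> = (\<Sum>K | K \<subseteq> U \<and> card K = k. (-1) ^ k * principal_minor A K)"
  proof (rule sum.mono_neutral_cong_right)
    show "finite (Pow U)" using U by simp
    show "{K. K \<subseteq> U \<and> card K = k} \<subseteq> Pow U" by auto
    show "\<forall>K\<in>Pow U - {K. K \<subseteq> U \<and> card K = k}. (if n - card K = n - k then (-1) ^ card K * principal_minor A K else 0) = 0"
    proof
      fix K assume K: "K \<in> Pow U - {K. K \<subseteq> U \<and> card K = k}"
      then have "card K \<le> n" using card_mono[of U K] U by auto
      then show "(if n - card K = n - k then (-1) ^ card K * principal_minor A K else 0) = 0"
        using K k by auto
    qed
  qed auto
  finally show ?thesis unfolding U_def by (simp add: sum_distrib_left)
qed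

lemma principal_minor_cong:
  fixes A B :: "int mat"
  assumes "K \<subseteq> {0..<n}" and "\<And>i j. i < n \<Longrightarrow> j < n \<Longrightarrow> [A $$ (i, j) = B $$ (i, j)] (mod q)"
  shows "[principal_minor A K = principal_minor B K] (mod q)"
  unfolding principal_minor_def
proof (intro cong_sum cong_mult cong_prod cong_refl)
  fix \<sigma> i assume "\<sigma> \<in> {\<sigma>. \<sigma> permutes K}" "i \<in> K"
  then have "i < n" "\<sigma> i < n" using assms(1) permutes_in_image[of \<sigma> K i] by auto
  then show "[A $$ (i, \<sigma> i) = B $$ (i, \<sigma> i)] (mod q)" by (rule assms(2))
qed

text \<open>For a root \<open>a\<close> modulo \<open>p\<close> divide by \<open>x - a\<close>: since \<open>p\<close> is prime, every other root modulo \<open>p\<close> is a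
  root of the quotient.\<close>

lemma card_roots_mod_prime_le:
  fixes F :: "int poly"
  assumes "prime p" "degree F \<le> d" "\<not> int p dvd coeff F k"
  shows "card {t \<in> {0..<int p}. int p dvd poly F t} \<le> d"
  using assms(2,3)
proof (induction d arbitrary: F k)
  case 0
  then obtain c where c: "F = [:c:]" using degree_eq_zeroE by auto
  then have "\<not> int p dvd c" using 0(2) by (cases k) auto
  then show ?case using c by simp
next
  case (Suc d)
  show ?case
  proof (cases "\<exists>a\<in>{0..<int p}. int p dvd poly F a")
    case False
    then have "{t \<in> {0..<int p}. int p dvd poly F t} = {}" by blast
    then show ?thesis by (simp only: card.empty)
  next
    case True
    then obtain a where a: "a \<in> {0..<int p}" "int p dvd poly F a" by blast
    define q where "q = synthetic_div F a"
    have F: "F = [:- a, 1:] * q + [:poly F a:]"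
      unfolding q_def by (rule synthetic_div_correct'[symmetric])
    have "\<exists>l. \<not> int p dvd coeff q l"
    proof (rule ccontr)
      assume "\<not> ?thesis"
      then have "int p dvd coeff q l" for l by blast
      then have "int p dvd coeff ([:- a, 1:] * q + [:poly F a:]) l" for l
        using a(2) by (auto simp: coeff_pCons split: nat.splits intro!: dvd_add dvd_diff)
      then show False using Suc.prems(2) F by metis
    qed
    then obtain l where l: "\<not> int p dvd coeff q l" by blast
    have dq: "degree q \<le> d" using Suc.prems(1) by (simp add: q_def degree_synthetic_div)
    have "{t \<in> {0..<int p}. int p dvd poly F t} \<subseteq> insert a {t \<in> {0..<int p}. int p dvd poly q t}"
    proof
      fix t assume t: "t \<in> {t \<in> {0..<int p}. int p dvd poly F t}"
      have "poly F t = (t - a) * poly q t + poly F a" using arg_cong[OF F, of "\<lambda>f. poly f t"] by (simp add: algebra_simps)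
      then have "int p dvd (t - a) * poly q t" using t a(2) by (simp add: dvd_add_left_iff)
      then have "int p dvd t - a \<or> int p dvd poly q t"
        using assms(1) by (simp add: prime_dvd_mult_iff)
      moreover have "t = a" if "int p dvd t - a"
        using that t a(1) zdvd_imp_le[of "int p" "t - a"] zdvd_imp_le[of "int p" "a - t"] dvd_diff_commute[of "int p" t a]
        by (cases "t - a" "0 :: int" rule: linorder_cases) auto
      ultimately show "t \<in> insert a {t \<in> {0..<int p}. int p dvd poly q t}" using t by auto
    qed
    moreover have fin: "finite {t \<in> {0..<int p}. int p dvd poly q t}" by (rule finite_Collect_conjI) simp
    ultimately have "card {t \<in> {0..<int p}. int p dvd poly F t} \<le> card (insert a {t \<in> {0..<int p}. int p dvd poly q t})"
      by (intro card_mono finite.insertI)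
    also have "\<dots> \<le> Suc (card {t \<in> {0..<int p}. int p dvd poly q t})"
      unfolding card_insert_if[OF fin] by simp
    also have "\<dots> \<le> Suc d" using Suc.IH[OF dq l] by simp
    finally show ?thesis .
  qed
qed

lemma degree_prod_linear:
  fixes a b :: "nat \<Rightarrow> 'a::comm_ring_1"
  assumes "finite K"
  shows "degree (\<Prod>j\<in>K. [:a j, b j:]) \<le> card K \<and> coeff (\<Prod>j\<in>K. [:a j, b j:]) (card K) = prod b K"
  using assms
proof (induction K rule: finite_induct)
  case (insert x K)
  define f where "f = (\<Prod>j\<in>K. [:a j, b j:])"
  have f: "degree f \<le> card K" "coeff f (card K) = prod b K" using insert.IH by (simp_all add: f_def)
  have eq: "(\<Prod>j\<in>insert x K. [:a j, b j:]) = [:a x, b x:] * f" using insert by (simp add: f_def)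
  have "degree ([:a x, b x:] * f) \<le> degree [:a x, b x:] + degree f" by (rule degree_mult_le)
  also have "\<dots> \<le> Suc (card K)" using f(1) degree_pCons_le[of "a x" "[:b x:]"] by simp
  finally have "degree ([:a x, b x:] * f) \<le> Suc (card K)" .
  moreover have "coeff ([:a x, b x:] * f) (Suc (card K)) = b x * prod b K"
    using f by (simp add: coeff_eq_0)
  ultimately show ?case unfolding eq using insert by simp
qed simp

section \<open>Characteristic polynomials with prescribed Smith type\<close>

text \<open>The exponents \<open>e 0 \<le> \<dots> \<le> e (n - 1)\<close> describe \<open>S = diag(p\<^bsup>e 0\<^esup>, \<dots>, p\<^bsup>e (n - 1)\<^esup>)\<close>. All valuations
  that occur are at most \<open>sum e {..<n}\<close>, so they can be read off modulo \<open>p\<^sup>m\<close>.\<close>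

locale smith_type =
  fixes n p m :: nat and e :: "nat \<Rightarrow> nat"
  assumes prime: "prime p" and n: "0 < n"
    and mono: "\<And>i j. i \<le> j \<Longrightarrow> j < n \<Longrightarrow> e i \<le> e j"
    and m: "sum e {..<n} < m"
begin

abbreviation N :: int where "N \<equiv> int p ^ m"

lemma p_dvd_N: "int p dvd N"
  using m by simp

lemma p_pos: "0 < int p"
  using prime prime_gt_0_nat by auto

lemma N_pos: "0 < N"
  using p_pos by simp

definition box :: "int mat set" where
  "box = {A \<in> carrier_mat n n. \<forall>i<n. \<forall>j<n. A $$ (i, j) \<in> {0..<N}}"

definition reduce_mod :: "int mat \<Rightarrow> int mat" where
  "reduce_mod A = map_mat (\<lambda>x. x mod N) A"

lemma reduce_mod_in_box: "A \<in> carrier_mat n n \<Longrightarrow> reduce_mod A \<in> box"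
  using N_pos by (auto simp: box_def reduce_mod_def)

lemma reduce_mod_cong: "A \<in> carrier_mat n n \<Longrightarrow> i < n \<Longrightarrow> j < n \<Longrightarrow> [reduce_mod A $$ (i, j) = A $$ (i, j)] (mod N)"
  by (auto simp: reduce_mod_def cong_def)

lemma box_eqI:
  assumes "A \<in> box" "B \<in> box" "\<And>i j. i < n \<Longrightarrow> j < n \<Longrightarrow> [A $$ (i, j) = B $$ (i, j)] (mod N)"
  shows "A = B"
proof (rule eq_matI)
  fix i j assume "i < dim_row B" "j < dim_col B"
  then have ij: "i < n" "j < n" using assms by (auto simp: box_def)
  then have "A $$ (i, j) \<in> {0..<N}" "B $$ (i, j) \<in> {0..<N}" using assms(1,2) by (auto simp: box_def)
  then show "A $$ (i, j) = B $$ (i, j)" using assms(3)[OF ij] by (auto simp: cong_def)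
qed (use assms in \<open>auto simp: box_def\<close>)

lemma finite_box: "finite box"
proof -
  have "box \<subseteq> (\<lambda>f. mat n n f) ` (({0..<n} \<times> {0..<n}) \<rightarrow>\<^sub>E {0..<N})"
  proof
    fix A assume A: "A \<in> box"
    define f where "f = restrict (\<lambda>ij. A $$ ij) ({0..<n} \<times> {0..<n})"
    have "A = mat n n f" by (rule eq_matI) (use A in \<open>auto simp: box_def f_def\<close>)
    moreover have "f \<in> ({0..<n} \<times> {0..<n}) \<rightarrow>\<^sub>E {0..<N}"
      using A by (auto simp: box_def f_def)
    ultimately show "A \<in> (\<lambda>f. mat n n f) ` (({0..<n} \<times> {0..<n}) \<rightarrow>\<^sub>E {0..<N})" by blast
  qed
  moreover have "finite (({0..<n} \<times> {0..<n}) \<rightarrow>\<^sub>E {0..<N})" by (intro finite_PiE) auto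
  ultimately show ?thesis by (meson finite_imageI finite_subset)
qed

text \<open>For \<open>S = diag(p\<^bsup>e i\<^esup>)\<close> the \<open>k\<close>-th coefficient of the characteristic polynomial of \<open>S * W\<close> is
  \<open>\<plusminus> p\<^bsup>e 0 + \<dots> + e (k - 1)\<^esup>\<close> times the following integer, because a principal minor of
  \<open>S * W\<close> is the principal minor of \<open>W\<close> scaled by the selected entries of \<open>S\<close>.\<close>

definition reduced_coeff :: "nat \<Rightarrow> int mat \<Rightarrow> int" where
  "reduced_coeff k W = (\<Sum>K | K \<subseteq> {0..<n} \<and> card K = k. int p ^ (sum e K - sum e {..<k}) * principal_minor W K)"

lemma coeff_char_poly_scaled:
  assumes W: "W \<in> carrier_mat n n" and k: "k \<le> n"
  shows "coeff (char_poly (mat n n (\<lambda>(i, j). int p ^ e i * W $$ (i, j)))) (n - k)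
    = (-1) ^ k * (int p ^ sum e {..<k} * reduced_coeff k W)"
proof -
  define M where "M = mat n n (\<lambda>(i, j). int p ^ e i * W $$ (i, j))"
  have "principal_minor M K = int p ^ sum e {..<k} * (int p ^ (sum e K - sum e {..<k}) * principal_minor W K)"
    if K: "K \<subseteq> {0..<n}" "card K = k" for K
  proof -
    have "principal_minor M K = int p ^ sum e K * principal_minor W K"
      unfolding principal_minor_def sum_distrib_left
    proof (rule sum.cong)
      fix \<sigma> assume \<sigma>: "\<sigma> \<in> {\<sigma>. \<sigma> permutes K}"
      have "(\<Prod>i\<in>K. M $$ (i, \<sigma> i)) = (\<Prod>i\<in>K. int p ^ e i * W $$ (i, \<sigma> i))"
      proof (rule prod.cong)
        fix i assume "i \<in> K"
        then have "i < n" "\<sigma> i < n" using \<sigma> K(1) permutes_in_image[of \<sigma> K i] by auto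
        then show "M $$ (i, \<sigma> i) = int p ^ e i * W $$ (i, \<sigma> i)" by (simp add: M_def)
      qed simp
      also have "\<dots> = int p ^ sum e K * (\<Prod>i\<in>K. W $$ (i, \<sigma> i))"
        by (simp add: prod.distrib power_sum)
      finally show "signof \<sigma> * (\<Prod>i\<in>K. M $$ (i, \<sigma> i)) = int p ^ sum e K * (signof \<sigma> * (\<Prod>i\<in>K. W $$ (i, \<sigma> i)))"
        by simp
    qed simp
    moreover have "sum e {..<k} \<le> sum e K"
      using sum_initial_le_sum_of_card[of n e K k] mono K by (simp add: atLeast0LessThan)
    ultimately show ?thesis by (simp add: mult.assoc[symmetric] flip: power_add)
  qed
  then have "(\<Sum>K | K \<subseteq> {0..<n} \<and> card K = k. principal_minor M K)
      = int p ^ sum e {..<k} * reduced_coeff k W"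
    unfolding reduced_coeff_def sum_distrib_left by (intro sum.cong) auto
  moreover have "M \<in> carrier_mat n n" by (simp add: M_def)
  ultimately show ?thesis
    using coeff_char_poly_principal_minors[of M n k] k unfolding M_def by simp
qed

text \<open>For generic \<open>W\<close> all coefficients of the characteristic polynomial of \<open>S * W\<close> have the least possible
  valuation.\<close>

definition generic :: "int mat \<Rightarrow> bool" where
  "generic W \<longleftrightarrow> (\<forall>k\<in>{1..n}. \<not> int p dvd reduced_coeff k W)"

lemma reduced_coeff_cong:
  assumes "\<And>i j. i < n \<Longrightarrow> j < n \<Longrightarrow> [A $$ (i, j) = B $$ (i, j)] (mod N)"
  shows "int p dvd reduced_coeff k A \<longleftrightarrow> int p dvd reduced_coeff k B"
proof -
  have "[reduced_coeff k A = reduced_coeff k B] (mod N)"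
    unfolding reduced_coeff_def
    by (intro cong_sum cong_mult cong_refl principal_minor_cong[of _ n] assms) auto
  then show ?thesis using cong_dvd_modulus[OF _ p_dvd_N] cong_dvd_iff by blast
qed

lemma reduced_coeff_last:
  assumes W: "W \<in> carrier_mat n n" shows "reduced_coeff n W = det W"
proof -
  have "{K. K \<subseteq> {0..<n} \<and> card K = n} = {{0..<n}}"
    using card_subset_eq[of "{0..<n}"] by (auto 4 0)
  then show ?thesis
    unfolding reduced_coeff_def by (simp add: principal_minor_def det_def'[OF W] atLeast0LessThan)
qed

text \<open>Along the line \<open>W + t diag(1, \<dots>, 1, 0, \<dots>, 0)\<close> with \<open>k\<close> ones, only the leading principal
  minor of size \<open>k\<close> reaches degree \<open>k\<close> in \<open>t\<close>, and its coefficient there is \<open>1\<close>.\<close>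

lemma card_line_reduced_coeff_le:
  assumes k: "k \<le> n"
  shows "card {t \<in> {0..<int p}. int p dvd reduced_coeff k
      (mat n n (\<lambda>(i, j). W $$ (i, j) + (if i = j \<and> i < k then t else 0)))} \<le> k"
proof -
  define T where "T i j = (if i = j \<and> i < k then 1 else 0 :: int)" for i j :: nat
  define Wt where "Wt t = mat n n (\<lambda>(i, j). W $$ (i, j) + (if i = j \<and> i < k then t else 0))" for t
  define f where "f K \<sigma> = (\<Prod>i\<in>K. [: W $$ (i, \<sigma> i), T i (\<sigma> i) :])" for K \<sigma>
  define G where "G K = (\<Sum>\<sigma> | \<sigma> permutes K. smult (signof \<sigma>) (f K \<sigma>))" for K
  define I where "I = {K. K \<subseteq> {0..<n} \<and> card K = k}"
  define F where "F = (\<Sum>K\<in>I. smult (int p ^ (sum e K - sum e {..<k})) (G K))"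
  have finK: "finite K" if "K \<in> I" for K using that finite_subset unfolding I_def by blast
  have "poly (G K) t = principal_minor (Wt t) K" if K: "K \<in> I" for K t
    unfolding G_def principal_minor_def poly_sum poly_smult f_def poly_prod
  proof (intro sum.cong refl arg_cong2[where f = "(*)"] prod.cong)
    fix \<sigma> i assume "\<sigma> \<in> {\<sigma>. \<sigma> permutes K}" "i \<in> K"
    then have "i < n" "\<sigma> i < n" using K permutes_in_image[of \<sigma> K i] unfolding I_def by auto
    then show "poly [:W $$ (i, \<sigma> i), T i (\<sigma> i):] t = Wt t $$ (i, \<sigma> i)"
      by (simp add: Wt_def T_def)
  qed
  then have F: "poly F t = reduced_coeff k (Wt t)" for t
    unfolding F_def reduced_coeff_def I_def[symmetric] poly_sum poly_smult by (intro sum.cong) simp_all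
  have f: "degree (f K \<sigma>) \<le> k" "coeff (f K \<sigma>) k = (\<Prod>i\<in>K. T i (\<sigma> i))" if "K \<in> I" for K \<sigma>
    using degree_prod_linear[OF finK[OF that], of "\<lambda>i. W $$ (i, \<sigma> i)" "\<lambda>i. T i (\<sigma> i)"] that
    unfolding f_def I_def by auto
  have finI: "finite I" unfolding I_def by (rule finite_subset[of _ "Pow {0..<n}"]) auto
  have "degree (G K) \<le> k" if K: "K \<in> I" for K
    unfolding G_def
    by (rule degree_sum_le[OF finite_permutations[OF finK[OF K]]])
      (rule order_trans[OF degree_smult_le f(1)[OF K]])
  then have degF: "degree F \<le> k"
    unfolding F_def by (intro degree_sum_le[OF finI]) (rule order_trans[OF degree_smult_le])
  have G: "coeff (G K) k = (if K = {..<k} then 1 else 0)" if K: "K \<in> I" for K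
  proof -
    have "coeff (G K) k = (\<Sum>\<sigma> | \<sigma> permutes K. signof \<sigma> * (\<Prod>i\<in>K. T i (\<sigma> i)))"
      unfolding G_def by (simp add: coeff_sum f(2)[OF K])
    also have "\<dots> = (\<Sum>\<sigma>\<in>{id}. signof \<sigma> * (\<Prod>i\<in>K. T i (\<sigma> i)))"
    proof (rule sum.mono_neutral_right)
      show "\<forall>\<sigma>\<in>{\<sigma>. \<sigma> permutes K} - {id}. signof \<sigma> * (\<Prod>i\<in>K. T i (\<sigma> i)) = 0"
      proof
        fix \<sigma> assume \<sigma>: "\<sigma> \<in> {\<sigma>. \<sigma> permutes K} - {id}"
        then obtain i where i: "\<sigma> i \<noteq> i" by (auto simp: fun_eq_iff)
        then have "i \<in> K" using \<sigma> permutes_not_in[of \<sigma> K i] by blast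
        then have "(\<Prod>i\<in>K. T i (\<sigma> i)) = 0"
          using i finK[OF K] by (intro prod_zero) (auto simp: T_def intro!: bexI[of _ i])
        then show "signof \<sigma> * (\<Prod>i\<in>K. T i (\<sigma> i)) = 0" by simp
      qed
    qed (use finK[OF K] in \<open>auto simp: finite_permutations permutes_id\<close>)
    also have "\<dots> = (\<Prod>i\<in>K. if i < k then 1 else 0)" by (simp add: T_def)
    also have "\<dots> = (if K = {..<k} then 1 else 0)"
    proof (cases "K \<subseteq> {..<k}")
      case True
      then have "K = {..<k}" using K unfolding I_def by (intro card_subset_eq) auto
      then show ?thesis by simp
    next
      case False
      then obtain i where "i \<in> K" "\<not> i < k" by auto
      then have "(\<Prod>i\<in>K. if i < k then 1 else 0 :: int) = 0"
        using finK[OF K] by (intro prod_zero) auto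
      then show ?thesis using False by auto
    qed
    finally show ?thesis .
  qed
  have "coeff F k = (\<Sum>K\<in>I. int p ^ (sum e K - sum e {..<k}) * (if K = {..<k} then 1 else 0))"
    unfolding F_def by (simp add: coeff_sum G)
  also have "\<dots> = (\<Sum>K\<in>I. if K = {..<k} then 1 else 0)" by (intro sum.cong) auto
  also have "\<dots> = 1"
  proof -
    have "{..<k} \<in> I" using k by (auto simp: I_def)
    then show ?thesis using finI by simp
  qed
  finally have "\<not> int p dvd coeff F k" using prime_gt_1_nat[OF prime] by simp
  from card_roots_mod_prime_le[OF prime degF this] show ?thesis
    unfolding F Wt_def .
qed

text \<open>The translations by \<open>t diag(1, \<dots>, 1, 0, \<dots>, 0)\<close>, \<open>0 \<le> t < p\<close>, permute the box, so the
  previous bound on lines averages to a bound on the box.\<close>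

lemma card_reduced_coeff_zero_le:
  assumes k: "k \<le> n"
  shows "p * card {W \<in> box. int p dvd reduced_coeff k W} \<le> k * card box"
proof -
  define line where "line t W = mat n n (\<lambda>(i, j). W $$ (i, j) + (if i = j \<and> i < k then t else 0 :: int))" for t W
  define bad where "bad W \<longleftrightarrow> int p dvd reduced_coeff k W" for W
  have bad_reduce_mod: "bad (reduce_mod (line t W)) \<longleftrightarrow> bad (line t W)" for t W
    unfolding bad_def by (intro reduced_coeff_cong reduce_mod_cong) (simp_all add: line_def)
  have perm: "bij_betw (\<lambda>W. reduce_mod (line t W)) box box" for t
  proof -
    have "inj_on (\<lambda>W. reduce_mod (line t W)) box"
    proof (rule inj_onI)
      fix A B assume AB: "A \<in> box" "B \<in> box" "reduce_mod (line t A) = reduce_mod (line t B)"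
      show "A = B"
      proof (rule box_eqI[OF AB(1,2)])
        fix i j assume ij: "i < n" "j < n"
        have "[reduce_mod (line t A) $$ (i, j) = line t A $$ (i, j)] (mod N)"
          "[reduce_mod (line t A) $$ (i, j) = line t B $$ (i, j)] (mod N)"
          using reduce_mod_cong[of "line t A" i j] reduce_mod_cong[of "line t B" i j] ij unfolding AB(3)
          by (simp_all add: line_def)
        then have "[line t A $$ (i, j) = line t B $$ (i, j)] (mod N)"
          by (meson cong_sym cong_trans)
        then show "[A $$ (i, j) = B $$ (i, j)] (mod N)"
          using ij by (simp add: line_def cong_add_rcancel)
      qed
    qed
    moreover have "(\<lambda>W. reduce_mod (line t W)) ` box \<subseteq> box" by (auto intro: reduce_mod_in_box simp: line_def)
    ultimately show ?thesis by (simp add: bij_betw_def endo_inj_surj finite_box)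
  qed
  have "p * card {W \<in> box. bad W} = (\<Sum>t\<in>{0..<int p}. card {W \<in> box. bad W})" by simp
  also have "\<dots> = (\<Sum>t\<in>{0..<int p}. card {W \<in> box. bad (line t W)})"
  proof (rule sum.cong)
    fix t :: int
    have "bij_betw (\<lambda>W. reduce_mod (line t W)) {W \<in> box. bad (line t W)} {W \<in> box. bad W}"
    proof -
      have "(\<lambda>W. reduce_mod (line t W)) ` {W \<in> box. bad (line t W)} = {W \<in> box. bad W}"
      proof
        show "{W \<in> box. bad W} \<subseteq> (\<lambda>W. reduce_mod (line t W)) ` {W \<in> box. bad (line t W)}"
        proof
          fix W assume W: "W \<in> {W \<in> box. bad W}"
          then obtain Y where "Y \<in> box" "W = reduce_mod (line t Y)"
            using perm[of t] unfolding bij_betw_def by auto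
          then show "W \<in> (\<lambda>W. reduce_mod (line t W)) ` {W \<in> box. bad (line t W)}"
            using W bad_reduce_mod[of t Y] by simp
        qed
        show "(\<lambda>W. reduce_mod (line t W)) ` {W \<in> box. bad (line t W)} \<subseteq> {W \<in> box. bad W}"
          using bad_reduce_mod[of t] bij_betwE[OF perm[of t]] by auto
      qed
      moreover have "inj_on (\<lambda>W. reduce_mod (line t W)) {W \<in> box. bad (line t W)}"
        using bij_betw_imp_inj_on[OF perm[of t]] by (rule inj_on_subset) auto
      ultimately show ?thesis by (simp add: bij_betw_def)
    qed
    then show "card {W \<in> box. bad W} = card {W \<in> box. bad (line t W)}"
      by (simp add: bij_betw_same_card)
  qed simp
  also have "\<dots> = (\<Sum>t\<in>{0..<int p}. \<Sum>W\<in>box. if bad (line t W) then 1 else 0)"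
    using finite_box by (simp add: sum.If_cases Int_def)
  also have "\<dots> = (\<Sum>W\<in>box. \<Sum>t\<in>{0..<int p}. if bad (line t W) then 1 else 0)" by (rule sum.swap)
  also have "\<dots> = (\<Sum>W\<in>box. card {t \<in> {0..<int p}. bad (line t W)})"
    by (simp add: sum.If_cases Int_def)
  also have "\<dots> \<le> (\<Sum>W\<in>box. k)"
    by (rule sum_mono) (use card_line_reduced_coeff_le[OF k] in \<open>simp add: bad_def line_def\<close>)
  finally show ?thesis unfolding bad_def by (simp add: mult.commute)
qed

end

section \<open>Counting by unit multiplication\<close>

context smith_type begin

lemma card_not_generic_le: "p * card {W \<in> box. \<not> generic W} \<le> n ^ 2 * card box"
proof -
  have "{W \<in> box. \<not> generic W} = (\<Union>k\<in>{1..n}. {W \<in> box. int p dvd reduced_coeff k W})"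
    unfolding generic_def by auto
  then have "card {W \<in> box. \<not> generic W} \<le> (\<Sum>k\<in>{1..n}. card {W \<in> box. int p dvd reduced_coeff k W})"
    using card_UN_le[of "{1..n}" "\<lambda>k. {W \<in> box. int p dvd reduced_coeff k W}"] by simp
  then have "p * card {W \<in> box. \<not> generic W} \<le> (\<Sum>k\<in>{1..n}. p * card {W \<in> box. int p dvd reduced_coeff k W})"
    unfolding sum_distrib_left[symmetric] by simp
  also have "\<dots> \<le> (\<Sum>k\<in>{1..n}. n * card box)"
  proof (rule sum_mono)
    fix k assume "k \<in> {1..n}"
    then show "p * card {W \<in> box. int p dvd reduced_coeff k W} \<le> n * card box"
      using card_reduced_coeff_zero_le[of k] mult_right_mono[of k n "card box"] by (simp add: order_trans)
  qed
  also have "\<dots> = n ^ 2 * card box" by (simp add: power2_eq_square)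
  finally show ?thesis .
qed

definition units :: "int mat set" where
  "units = {W \<in> box. \<not> int p dvd det W}"

lemma prime_int: "prime (int p)"
  using prime by simp

lemma coprime_p: "\<not> int p dvd x \<Longrightarrow> coprime (int p ^ l) x"
  using prime_int by (simp add: prime_imp_coprime)

lemma generic_imp_unit: "W \<in> box \<Longrightarrow> generic W \<Longrightarrow> W \<in> units"
proof -
  assume W: "W \<in> box" "generic W"
  then have "reduced_coeff n W = det W" by (intro reduced_coeff_last) (simp add: box_def)
  moreover have "\<not> int p dvd reduced_coeff n W" using W(2) n unfolding generic_def by auto
  ultimately show "W \<in> units" using W(1) by (simp add: units_def)
qed

lemma generic_reduce_mod: "A \<in> carrier_mat n n \<Longrightarrow> generic (reduce_mod A) \<longleftrightarrow> generic A"
proof -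
  assume "A \<in> carrier_mat n n"
  then have "int p dvd reduced_coeff k (reduce_mod A) \<longleftrightarrow> int p dvd reduced_coeff k A" for k
    by (intro reduced_coeff_cong reduce_mod_cong)
  then show ?thesis by (simp add: generic_def)
qed

lemma p_dvd_det_red: "A \<in> carrier_mat n n \<Longrightarrow> int p dvd det (reduce_mod A) \<longleftrightarrow> int p dvd det A"
proof -
  assume A: "A \<in> carrier_mat n n"
  then have "int p dvd reduced_coeff n (reduce_mod A) \<longleftrightarrow> int p dvd reduced_coeff n A"
    by (intro reduced_coeff_cong reduce_mod_cong)
  then show ?thesis using A by (simp add: reduced_coeff_last reduce_mod_def)
qed

lemma mat_mult_cong:
  fixes A B C :: "int mat"
  assumes "A \<in> carrier_mat n n" "B \<in> carrier_mat n n" "C \<in> carrier_mat n n"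
    and "\<And>i j. i < n \<Longrightarrow> j < n \<Longrightarrow> [A $$ (i, j) = B $$ (i, j)] (mod q)" and ij: "i < n" "j < n"
  shows "[(A * C) $$ (i, j) = (B * C) $$ (i, j)] (mod q)" "[(C * A) $$ (i, j) = (C * B) $$ (i, j)] (mod q)"
proof -
  have "(Y * Z) $$ (i, j) = (\<Sum>k\<in>{0..<n}. Y $$ (i, k) * Z $$ (k, j))"
    if "Y \<in> carrier_mat n n" "Z \<in> carrier_mat n n" for Y Z :: "int mat"
    using that ij by (simp add: scalar_prod_def)
  note entry = this
  show "[(A * C) $$ (i, j) = (B * C) $$ (i, j)] (mod q)"
    unfolding entry[OF assms(1,3)] entry[OF assms(2,3)]
    by (intro cong_sum cong_mult cong_refl assms(4)) (use ij in auto)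
  show "[(C * A) $$ (i, j) = (C * B) $$ (i, j)] (mod q)"
    unfolding entry[OF assms(3,1)] entry[OF assms(3,2)]
    by (intro cong_sum cong_mult cong_refl assms(4)) (use ij in auto)
qed

text \<open>Multiplication by an integer matrix with determinant prime to \<open>p\<close> is injective modulo
  \<open>p\<^sup>m\<close>: multiply by the adjugate and cancel the determinant.\<close>

lemma mult_right_cancel_mod:
  assumes A: "A \<in> carrier_mat n n" and B: "B \<in> carrier_mat n n" and W: "W \<in> carrier_mat n n"
    and unit: "\<not> int p dvd det W"
    and cong: "\<And>i j. i < n \<Longrightarrow> j < n \<Longrightarrow> [(A * W) $$ (i, j) = (B * W) $$ (i, j)] (mod N)"
    and ij: "i < n" "j < n"
  shows "[A $$ (i, j) = B $$ (i, j)] (mod N)"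
proof -
  have adj: "(Y * W) * adj_mat W = det W \<cdot>\<^sub>m Y" if "Y \<in> carrier_mat n n" for Y
  proof -
    have "(Y * W) * adj_mat W = Y * (W * adj_mat W)" by (rule assoc_mult_mat[OF that W adj_mat(1)[OF W]])
    also have "\<dots> = det W \<cdot>\<^sub>m Y"
      unfolding adj_mat(2)[OF W] using that by (simp add: mult_smult_distrib[of _ n n _ n])
    finally show ?thesis .
  qed
  have "[((A * W) * adj_mat W) $$ (i, j) = ((B * W) * adj_mat W) $$ (i, j)] (mod N)"
    by (rule mat_mult_cong(1)) (use A B W adj_mat(1)[OF W] cong ij in auto)
  moreover have "(det W \<cdot>\<^sub>m A) $$ (i, j) = det W * A $$ (i, j)" "(det W \<cdot>\<^sub>m B) $$ (i, j) = det W * B $$ (i, j)"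
    using A B ij by auto
  ultimately have "[det W * A $$ (i, j) = det W * B $$ (i, j)] (mod N)"
    unfolding adj[OF A] adj[OF B] by (simp only:)
  moreover have "coprime (det W) N" using coprime_p[OF unit, of m] by (simp add: coprime_commute)
  ultimately show ?thesis by (simp add: cong_mult_lcancel)
qed

lemma mult_left_cancel_mod:
  assumes A: "A \<in> carrier_mat n n" and B: "B \<in> carrier_mat n n" and W: "W \<in> carrier_mat n n"
    and unit: "\<not> int p dvd det W"
    and cong: "\<And>i j. i < n \<Longrightarrow> j < n \<Longrightarrow> [(W * A) $$ (i, j) = (W * B) $$ (i, j)] (mod N)"
    and ij: "i < n" "j < n"
  shows "[A $$ (i, j) = B $$ (i, j)] (mod N)"
proof -
  have "[transpose_mat A $$ (j, i) = transpose_mat B $$ (j, i)] (mod N)"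
  proof (rule mult_right_cancel_mod)
    show "\<not> int p dvd det (transpose_mat W)" using unit det_transpose[OF W] by simp
    show "transpose_mat A \<in> carrier_mat n n" "transpose_mat B \<in> carrier_mat n n"
      "transpose_mat W \<in> carrier_mat n n" "j < n" "i < n" using A B W ij by auto
    fix a b assume ab: "a < n" "b < n"
    then show "[(transpose_mat A * transpose_mat W) $$ (a, b) = (transpose_mat B * transpose_mat W) $$ (a, b)] (mod N)"
      unfolding transpose_mult[OF W A, symmetric] transpose_mult[OF W B, symmetric]
      using cong[OF ab(2) ab(1)] A B W by simp
  qed
  then show ?thesis using A B ij by simp
qed

lemma units_translate:
  assumes U: "U \<in> carrier_mat n n" "\<not> int p dvd det U" and V: "V \<in> carrier_mat n n" "\<not> int p dvd det V"
  shows "bij_betw (\<lambda>W. reduce_mod (V * W * U)) units units"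
proof -
  have "inj_on (\<lambda>W. reduce_mod (V * W * U)) units"
  proof (rule inj_onI)
    fix W Z assume WZ: "W \<in> units" "Z \<in> units" "reduce_mod (V * W * U) = reduce_mod (V * Z * U)"
    have c: "W \<in> carrier_mat n n" "Z \<in> carrier_mat n n" using WZ by (auto simp: units_def box_def)
    have VW: "V * W \<in> carrier_mat n n" "V * Z \<in> carrier_mat n n" using c V by auto
    have VWU: "V * W * U \<in> carrier_mat n n" "V * Z * U \<in> carrier_mat n n" using VW U by auto
    have "[(V * W * U) $$ (i, j) = (V * Z * U) $$ (i, j)] (mod N)" if ij: "i < n" "j < n" for i j
      using reduce_mod_cong[OF VWU(1) ij] reduce_mod_cong[OF VWU(2) ij] unfolding WZ(3) cong_def by (simp only:)
    then have "[(V * W) $$ (i, j) = (V * Z) $$ (i, j)] (mod N)" if ij: "i < n" "j < n" for i j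
      using mult_right_cancel_mod[OF VW U _ ij] by blast
    then have "[W $$ (i, j) = Z $$ (i, j)] (mod N)" if ij: "i < n" "j < n" for i j
      using mult_left_cancel_mod[OF c V _ ij] by blast
    then show "W = Z" using WZ by (intro box_eqI) (auto simp: units_def)
  qed
  moreover have "(\<lambda>W. reduce_mod (V * W * U)) ` units \<subseteq> units"
  proof
    fix Z assume "Z \<in> (\<lambda>W. reduce_mod (V * W * U)) ` units"
    then obtain W where W: "W \<in> units" "Z = reduce_mod (V * W * U)" by blast
    have c: "W \<in> carrier_mat n n" using W by (auto simp: units_def box_def)
    have VWU: "V * W * U \<in> carrier_mat n n" using c U V by auto
    have "det (V * W * U) = det V * det W * det U"
      using det_mult[of "V * W" n U] det_mult[OF V(1) c] c U V by (simp del: assoc_mult_mat)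
    moreover have "\<not> int p dvd det W" using W by (simp add: units_def)
    ultimately have "\<not> int p dvd det (V * W * U)"
      using U V prime_int by (simp add: prime_dvd_mult_iff)
    then show "Z \<in> units" using W(2) reduce_mod_in_box[OF VWU] p_dvd_det_red[OF VWU] by (simp add: units_def)
  qed
  moreover have "finite units" using finite_box by (simp add: units_def)
  ultimately show ?thesis by (simp add: bij_betw_def endo_inj_surj)
qed

text \<open>For the matrices of this Smith type this means to be \<open>p\<close>-characterized.\<close>

definition exact_coeffs :: "int mat \<Rightarrow> bool" where
  "exact_coeffs A \<longleftrightarrow> (\<forall>k\<in>{1..n}. int p ^ sum e {..<k} dvd coeff (char_poly A) (n - k)
     \<and> \<not> int p ^ Suc (sum e {..<k}) dvd coeff (char_poly A) (n - k))"

lemma partial_sum_less: "k \<le> n \<Longrightarrow> sum e {..<k} < m"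
  using m sum_mono2[of "{..<n}" "{..<k}" e] by simp

lemma power_dvd_cong:
  assumes "k \<le> n" "l \<le> Suc (sum e {..<k})" "[x = y] (mod N)"
  shows "int p ^ l dvd x \<longleftrightarrow> int p ^ l dvd y"
proof -
  have "int p ^ l dvd N" using partial_sum_less[OF assms(1)] assms(2) by (intro le_imp_power_dvd) simp
  then have "[x = y] (mod int p ^ l)" by (rule cong_dvd_modulus[OF assms(3)])
  then show ?thesis by (rule cong_dvd_iff)
qed

lemma exact_coeffs_reduce_mod:
  assumes A: "A \<in> carrier_mat n n" shows "exact_coeffs (reduce_mod A) \<longleftrightarrow> exact_coeffs A"
proof -
  have rA: "reduce_mod A \<in> carrier_mat n n" using A by (simp add: reduce_mod_def)
  have cong: "[coeff (char_poly (reduce_mod A)) (n - k) = coeff (char_poly A) (n - k)] (mod N)" if "k \<le> n" for k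
    unfolding coeff_char_poly_principal_minors[OF A that] coeff_char_poly_principal_minors[OF rA that]
    by (intro cong_mult cong_sum cong_refl principal_minor_cong[of _ n] reduce_mod_cong[OF A]) auto
  have "int p ^ l dvd coeff (char_poly (reduce_mod A)) (n - k) \<longleftrightarrow> int p ^ l dvd coeff (char_poly A) (n - k)"
    if "k \<in> {1..n}" "l \<le> Suc (sum e {..<k})" for k l
    using that by (intro power_dvd_cong[of k] cong) auto
  then show ?thesis unfolding exact_coeffs_def by (meson le_Suc_eq order_refl)
qed

definition diag_p :: "int mat" where
  "diag_p = mat n n (\<lambda>(i, j). if i = j then int p ^ e i else 0)"

lemma diag_p_mult:
  assumes "Y \<in> carrier_mat n n"
  shows "diag_p * Y = mat n n (\<lambda>(i, j). int p ^ e i * Y $$ (i, j))"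
proof (rule eq_matI)
  fix i j assume "i < dim_row (mat n n (\<lambda>(i, j). int p ^ e i * Y $$ (i, j)))"
    "j < dim_col (mat n n (\<lambda>(i, j). int p ^ e i * Y $$ (i, j)))"
  then have ij: "i < n" "j < n" by simp_all
  have "(diag_p * Y) $$ (i, j) = (\<Sum>k\<in>{0..<n}. (if i = k then int p ^ e i else 0) * Y $$ (k, j))"
    using ij assms by (simp add: diag_p_def scalar_prod_def)
  also have "\<dots> = (\<Sum>k\<in>{0..<n}. if k = i then int p ^ e i * Y $$ (k, j) else 0)"
    by (intro sum.cong) auto
  also have "\<dots> = int p ^ e i * Y $$ (i, j)" using ij by simp
  finally show "(diag_p * Y) $$ (i, j) = mat n n (\<lambda>(i, j). int p ^ e i * Y $$ (i, j)) $$ (i, j)"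
    using ij by simp
qed (use assms in \<open>auto simp: diag_p_def\<close>)

lemma exact_coeffs_diag_p_mult:
  assumes Y: "Y \<in> carrier_mat n n" shows "exact_coeffs (diag_p * Y) \<longleftrightarrow> generic Y"
proof -
  have "int p ^ sum e {..<k} dvd coeff (char_poly (diag_p * Y)) (n - k)"
    "int p ^ Suc (sum e {..<k}) dvd coeff (char_poly (diag_p * Y)) (n - k) \<longleftrightarrow> int p dvd reduced_coeff k Y"
    if k: "k \<in> {1..n}" for k
  proof -
    have eq: "coeff (char_poly (diag_p * Y)) (n - k) = (-1) ^ k * (int p ^ sum e {..<k} * reduced_coeff k Y)"
      unfolding diag_p_mult[OF Y] using k by (intro coeff_char_poly_scaled[OF Y]) simp
    have sgn: "d dvd (-1) ^ k * x \<longleftrightarrow> d dvd x" for d x :: int by (cases "even k") auto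
    show "int p ^ sum e {..<k} dvd coeff (char_poly (diag_p * Y)) (n - k)" unfolding eq by simp
    show "int p ^ Suc (sum e {..<k}) dvd coeff (char_poly (diag_p * Y)) (n - k) \<longleftrightarrow> int p dvd reduced_coeff k Y"
      unfolding eq sgn power_Suc2 using p_pos by simp
  qed
  then show ?thesis unfolding exact_coeffs_def generic_def by blast
qed

text \<open>Conjugation by the unimodular \<open>U\<close> moves it to the other end of the product.\<close>

lemma exact_coeffs_mult_iff_generic:
  assumes U: "U \<in> carrier_mat n n" "det U dvd 1" and V: "V \<in> carrier_mat n n"
    and W: "W \<in> carrier_mat n n" and A: "A = U * diag_p * V"
  shows "exact_coeffs (A * W) \<longleftrightarrow> generic (V * W * U)"
proof -
  have S: "diag_p \<in> carrier_mat n n" by (simp add: diag_p_def)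
  obtain U' where U': "U' \<in> carrier_mat n n" "U * U' = 1\<^sub>m n" "U' * U = 1\<^sub>m n"
    by (rule unimodular_inverse[OF U]) (rule that)
  have "similar_mat (A * W) (diag_p * (V * W * U))"
  proof (rule similar_matI[of _ _ U U' n])
    have "U * (diag_p * (V * W * U)) * U' = U * diag_p * V * W * (U * U')"
      using U U' V W S by (simp add: assoc_mult_mat[of _ n n _ n _ n])
    then show "A * W = U * (diag_p * (V * W * U)) * U'"
      unfolding U'(2) A using U V W S by (simp add: assoc_mult_mat[of _ n n _ n _ n])
  qed (use U U' V W S A in auto)
  then have "char_poly (A * W) = char_poly (diag_p * (V * W * U))" by (rule char_poly_similar)
  then have "exact_coeffs (A * W) \<longleftrightarrow> exact_coeffs (diag_p * (V * W * U))" by (simp only: exact_coeffs_def)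
  then show ?thesis using exact_coeffs_diag_p_mult[of "V * W * U"] U V W by auto
qed

definition smith_matrices :: "int mat set" where
  "smith_matrices = {A \<in> box. \<forall>k\<in>{1..n}. minors_val p A k (sum e {..<k})}"

lemma smith_matrices_mult_unit:
  assumes A: "A \<in> smith_matrices" and W: "W \<in> units" shows "reduce_mod (A * W) \<in> smith_matrices"
proof -
  have c: "A \<in> carrier_mat n n" "W \<in> carrier_mat n n" "\<not> int p dvd det W"
    using A W by (auto simp: smith_matrices_def units_def box_def)
  have AW: "A * W \<in> carrier_mat n n" using c by simp
  have "minors_val p (reduce_mod (A * W)) k (sum e {..<k})" if k: "k \<in> {1..n}" for k
  proof -
    have "dvd_minors (int p ^ l) (reduce_mod (A * W)) k \<longleftrightarrow> dvd_minors (int p ^ l) A k"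
      if "l \<le> Suc (sum e {..<k})" for l
    proof -
      have "int p ^ l dvd N" using partial_sum_less[of k] k that by (intro le_imp_power_dvd) auto
      then have "dvd_minors (int p ^ l) (reduce_mod (A * W)) k \<longleftrightarrow> dvd_minors (int p ^ l) (A * W) k"
        using reduce_mod_in_box[OF AW] reduce_mod_cong[OF AW] AW unfolding box_def
        by (intro dvd_minors_cong[of _ n n _ N]) auto
      also have "\<dots> \<longleftrightarrow> dvd_minors (int p ^ l) A k"
        by (rule dvd_minors_mult_right_iff[OF c(1,2) coprime_p[OF c(3)]])
      finally show ?thesis .
    qed
    moreover have "minors_val p A k (sum e {..<k})" using A k by (simp add: smith_matrices_def)
    ultimately show ?thesis unfolding minors_val_def by (meson le_Suc_eq order_refl)
  qed
  then show ?thesis using reduce_mod_in_box[OF AW] by (simp add: smith_matrices_def)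
qed

lemma smith_matrices_mult_unit_bij:
  assumes W: "W \<in> units" shows "bij_betw (\<lambda>A. reduce_mod (A * W)) smith_matrices smith_matrices"
proof -
  have Wc: "W \<in> carrier_mat n n" "\<not> int p dvd det W" using W by (auto simp: units_def box_def)
  have "inj_on (\<lambda>A. reduce_mod (A * W)) smith_matrices"
  proof (rule inj_onI)
    fix A B assume AB: "A \<in> smith_matrices" "B \<in> smith_matrices" "reduce_mod (A * W) = reduce_mod (B * W)"
    have c: "A \<in> carrier_mat n n" "B \<in> carrier_mat n n" using AB by (auto simp: smith_matrices_def box_def)
    have "[(A * W) $$ (i, j) = (B * W) $$ (i, j)] (mod N)" if ij: "i < n" "j < n" for i j
      using reduce_mod_cong[OF mult_carrier_mat[OF c(1) Wc(1)] ij] reduce_mod_cong[OF mult_carrier_mat[OF c(2) Wc(1)] ij]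
      unfolding AB(3) cong_def by (simp only:)
    then have "[A $$ (i, j) = B $$ (i, j)] (mod N)" if ij: "i < n" "j < n" for i j
      using mult_right_cancel_mod[OF c Wc _ ij] by blast
    then show "A = B" using AB by (intro box_eqI) (auto simp: smith_matrices_def)
  qed
  moreover have "(\<lambda>A. reduce_mod (A * W)) ` smith_matrices \<subseteq> smith_matrices" using smith_matrices_mult_unit W by blast
  moreover have "finite smith_matrices" using finite_box by (simp add: smith_matrices_def)
  ultimately show ?thesis by (simp add: bij_betw_def endo_inj_surj)
qed

lemma card_Collect_bij:
  assumes "bij_betw f S S" shows "card {x \<in> S. P (f x)} = card {x \<in> S. P x}"
proof -
  have "f ` {x \<in> S. P (f x)} = {x \<in> S. P x}"
    using assms unfolding bij_betw_def by force
  moreover have "inj_on f {x \<in> S. P (f x)}"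
    using bij_betw_imp_inj_on[OF assms] by (rule inj_on_subset) auto
  ultimately show ?thesis by (metis card_image)
qed

text \<open>Count the pairs \<open>(A, W)\<close> for which \<open>A * W\<close> has the required coefficients. For fixed \<open>W\<close> the
  map \<open>A \<mapsto> A * W\<close> permutes the class; for fixed \<open>A = U * S * V\<close> the condition says that
  \<open>V * W * U\<close> is generic, and \<open>W \<mapsto> V * W * U\<close> permutes the units.\<close>

lemma card_exact_coeffs_mult_card_units:
  assumes factor: "\<And>A. A \<in> smith_matrices \<Longrightarrow> \<exists>U V. U \<in> carrier_mat n n \<and> det U dvd 1 \<and> V \<in> carrier_mat n n
      \<and> \<not> int p dvd det V \<and> A = U * diag_p * V"
  shows "card {A \<in> smith_matrices. exact_coeffs A} * card units = card smith_matrices * card {W \<in> box. generic W}"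
proof -
  have fin: "finite smith_matrices" "finite units" using finite_box by (simp_all add: smith_matrices_def units_def)
  have "card {A \<in> smith_matrices. exact_coeffs A} * card units = (\<Sum>W\<in>units. card {A \<in> smith_matrices. exact_coeffs A})" by simp
  also have "\<dots> = (\<Sum>W\<in>units. card {A \<in> smith_matrices. exact_coeffs (reduce_mod (A * W))})"
    by (intro sum.cong refl card_Collect_bij[symmetric] smith_matrices_mult_unit_bij)
  also have "\<dots> = (\<Sum>W\<in>units. \<Sum>A\<in>smith_matrices. if exact_coeffs (reduce_mod (A * W)) then 1 else 0)"
    using fin by (simp add: sum.If_cases Int_def)
  also have "\<dots> = (\<Sum>A\<in>smith_matrices. \<Sum>W\<in>units. if exact_coeffs (reduce_mod (A * W)) then 1 else 0)" by (rule sum.swap)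
  also have "\<dots> = (\<Sum>A\<in>smith_matrices. card {W \<in> units. exact_coeffs (reduce_mod (A * W))})"
    using fin by (simp add: sum.If_cases Int_def)
  also have "\<dots> = (\<Sum>A\<in>smith_matrices. card {W \<in> box. generic W})"
  proof (rule sum.cong)
    fix A assume A: "A \<in> smith_matrices"
    obtain U V where UV: "U \<in> carrier_mat n n" "det U dvd 1" "V \<in> carrier_mat n n"
      "\<not> int p dvd det V" "A = U * diag_p * V" using factor[OF A] by blast
    have U: "\<not> int p dvd det U" using UV(2) prime_int by (meson dvd_trans not_prime_unit)
    have "exact_coeffs (reduce_mod (A * W)) \<longleftrightarrow> generic (reduce_mod (V * W * U))" if W: "W \<in> units" for W
    proof -
      have c: "A \<in> carrier_mat n n" "W \<in> carrier_mat n n" using A W by (auto simp: smith_matrices_def units_def box_def)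
      have "exact_coeffs (reduce_mod (A * W)) \<longleftrightarrow> exact_coeffs (A * W)" using c by (intro exact_coeffs_reduce_mod) simp
      also have "\<dots> \<longleftrightarrow> generic (V * W * U)" by (rule exact_coeffs_mult_iff_generic[OF UV(1-3) c(2) UV(5)])
      also have "\<dots> \<longleftrightarrow> generic (reduce_mod (V * W * U))" using c UV by (intro generic_reduce_mod[symmetric]) auto
      finally show ?thesis .
    qed
    then have "card {W \<in> units. exact_coeffs (reduce_mod (A * W))} = card {W \<in> units. generic (reduce_mod (V * W * U))}"
      by (metis (mono_tags, lifting))
    also have "\<dots> = card {W \<in> units. generic W}"
      by (rule card_Collect_bij[OF units_translate[OF UV(1) U UV(3,4)]])
    also have "{W \<in> units. generic W} = {W \<in> box. generic W}"
      using generic_imp_unit by (auto simp: units_def)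
    finally show "card {W \<in> units. exact_coeffs (reduce_mod (A * W))} = card {W \<in> box. generic W}" .
  qed simp
  finally show ?thesis by simp
qed

end

section \<open>The proportion of \<open>p\<close>-characterized matrices\<close>

text \<open>The diagonal entries of the Smith normal form are powers of \<open>p\<close> up to factors prime to \<open>p\<close>. These
  factors need not be units of the integers, which is why only \<open>det V\<close> prime to \<open>p\<close> can be achieved
  in a factorization \<open>A = U * S * V\<close>.\<close>

lemma smith_class_smith_form:
  assumes "prime p" "length es = n" "A \<in> smith_class p m es"
  obtains D P Q t where "smith_normal_form A D" "P \<in> carrier_mat n n" "Q \<in> carrier_mat n n"
    "det P dvd 1" "det Q dvd 1" "D = P * A * Q" "D \<in> carrier_mat n n" "diagonal_mat D"
    "\<And>i. i < n \<Longrightarrow> rat_val p (rat_of_int (D $$ (i, i))) = ereal (real (es ! i))"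
    "\<And>i. i < n \<Longrightarrow> D $$ (i, i) = int p ^ (es ! i) * t i \<and> \<not> int p dvd t i"
proof -
  have A: "A \<in> carrier_mat n n" using assms unfolding smith_class_def by simp
  obtain D where D: "smith_normal_form A D"
    "\<forall>i<n. rat_val p (rat_of_int (D $$ (i, i))) = ereal (real (es ! i))"
    using assms unfolding smith_class_def by auto
  obtain P Q where PQ: "P \<in> carrier_mat n n" "invertible_mat P" "Q \<in> carrier_mat n n"
    "invertible_mat Q" "D = P * A * Q"
    using D(1) A unfolding smith_normal_form_def by (auto simp del: assoc_mult_mat)
  have Dc: "D \<in> carrier_mat n n" "diagonal_mat D" using D(1) A unfolding smith_normal_form_def by auto
  have "\<exists>x. D $$ (i, i) = int p ^ (es ! i) * x \<and> \<not> int p dvd x" if i: "i < n" for i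
  proof -
    have *: "int p ^ (es ! i) dvd D $$ (i, i)" "\<not> int p ^ Suc (es ! i) dvd D $$ (i, i)"
      using D(2) i rat_val_of_int_eq_iff[OF assms(1)] by blast+
    show ?thesis using exact_power_cofactor[OF *] by metis
  qed
  then obtain t where "\<And>i. i < n \<Longrightarrow> D $$ (i, i) = int p ^ (es ! i) * t i \<and> \<not> int p dvd t i" by metis
  then show ?thesis
    using that[OF D(1) PQ(1,3) _ _ PQ(5) Dc] PQ D(2) invertible_int_mat_iff_det by blast
qed

lemma int_mat_rank_smith_class:
  assumes "prime p" "length es = n" "A \<in> smith_class p m es"
  shows "int_mat_rank A = n"
proof -
  obtain D P Q t where D: "P \<in> carrier_mat n n" "Q \<in> carrier_mat n n" "D = P * A * Q"
    "D \<in> carrier_mat n n" "diagonal_mat D"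
    and t: "\<And>i. i < n \<Longrightarrow> D $$ (i, i) = int p ^ (es ! i) * t i \<and> \<not> int p dvd t i"
    using smith_class_smith_form[OF assms] by metis
  have A: "A \<in> carrier_mat n n" using assms unfolding smith_class_def by simp
  have "det D = prod_list (diag_mat D)"
    by (rule det_lower_triangular[OF _ D(4)]) (use D in \<open>auto simp: diagonal_mat_def\<close>)
  also have "\<dots> = (\<Prod>i = 0..<n. D $$ (i, i))" using D(4) by (simp add: prod_list_diag_prod)
  also have "\<dots> \<noteq> 0"
  proof -
    have "D $$ (i, i) \<noteq> 0" if "i < n" for i
      using t[OF that] prime_gt_0_nat[OF assms(1)] by (metis dvd_0_right mult_eq_0_iff of_nat_0_less_iff power_not_zero less_irrefl)
    then show ?thesis by simp
  qed
  finally have "det D \<noteq> 0" .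
  moreover have "det D = det P * det A * det Q"
    unfolding D(3) using det_mult[OF mult_carrier_mat[OF D(1) A] D(2)] det_mult[OF D(1) A] by simp
  ultimately have "det A \<noteq> 0" by auto
  then have "det (map_mat rat_of_int A) \<noteq> 0" by simp
  moreover have "map_mat rat_of_int A \<in> carrier_mat n n" using A by simp
  ultimately show ?thesis
    using vec_space.det_rank_iff[of "map_mat rat_of_int A" n] A unfolding int_mat_rank_def by auto
qed

lemma smith_type_of_list:
  assumes "prime p" "n > 0" "length es = n" "sorted es" "m \<ge> sum_list es + 1"
  shows "smith_type n p m (\<lambda>i. es ! i)"
proof
  show "es ! i \<le> es ! j" if "i \<le> j" "j < n" for i j using assms that by (simp add: sorted_nth_mono)
  show "sum ((!) es) {..<n} < m" using assms by (simp add: sum_list_sum_nth atLeast0LessThan)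
qed (use assms in auto)

lemma p_characterized_iff_coeff_val:
  assumes "prime p" "n > 0" "length es = n" "sorted es" "m \<ge> sum_list es + 1" "A \<in> smith_class p m es"
  shows "p_characterized p A \<longleftrightarrow> (\<forall>k\<in>{1..n}.
    rat_val p (rat_of_int (coeff (char_poly A) (n - k))) = ereal (real (\<Sum>i<k. es ! i)))"
proof -
  have A: "A \<in> carrier_mat n n" using assms unfolding smith_class_def by simp
  have rank: "int_mat_rank A = n" by (rule int_mat_rank_smith_class[OF assms(1,3,6)])
  have "rat_val p (rat_of_int (determinantal_divisor A k)) = ereal (real (\<Sum>i<k. es ! i))" if "k \<in> {1..n}" for k
    using assms(6) that unfolding smith_class_iff[OF assms(1,4,3)] rat_val_determinantal_divisor_iff[OF assms(1)] by blast
  then show ?thesis unfolding p_characterized_def rank using A by simp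
qed

text \<open>At most \<open>\<epsilon> * card box\<close> matrices of the box are not generic, and there are at most as many
  units as matrices in the box, so the generic ones are at least the proportion \<open>1 - \<epsilon>\<close> of the
  units. This is the proportion of \<open>p\<close>-characterized matrices in the class.\<close>

lemma card_p_characterized_ge:
  assumes "n > 0" "\<epsilon> > 0" "prime p" "real n ^ 2 \<le> \<epsilon> * real p" "length es = n" "sorted es" "m \<ge> sum_list es + 1"
  shows "real (card {A \<in> smith_class p m es. p_characterized p A}) \<ge> (1 - \<epsilon>) * real (card (smith_class p m es))"
proof (cases "\<epsilon> \<le> 1")
  case False
  then have "(1 - \<epsilon>) * real (card (smith_class p m es)) \<le> 0" by (simp add: mult_le_0_iff)
  then show ?thesis by simp
next
  case True
  interpret smith_type n p m "\<lambda>i. es ! i" by (rule smith_type_of_list[OF assms(3,1,5-7)])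
  have smith_matrices: "smith_matrices = smith_class p m es"
  proof (rule Set.set_eqI)
    fix A :: "int mat"
    have "{0..<int p ^ m} = {0..int p ^ m - 1}" by auto
    then show "A \<in> smith_matrices \<longleftrightarrow> A \<in> smith_class p m es"
      unfolding smith_class_iff[OF assms(3,6,5)] smith_matrices_def box_def by auto
  qed
  have char: "{A \<in> smith_class p m es. p_characterized p A} = {A \<in> smith_matrices. exact_coeffs A}"
    unfolding smith_matrices
  proof (rule Collect_cong, rule conj_cong[OF refl])
    fix A assume "A \<in> smith_class p m es"
    then show "p_characterized p A \<longleftrightarrow> exact_coeffs A"
      unfolding exact_coeffs_def
      by (simp only: p_characterized_iff_coeff_val[OF assms(3,1,5-7)] rat_val_of_int_eq_iff[OF assms(3)])
  qed
  have eq: "card {A \<in> smith_matrices. exact_coeffs A} * card units = card smith_matrices * card {W \<in> box. generic W}"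
  proof (rule card_exact_coeffs_mult_card_units)
    fix A assume A: "A \<in> smith_matrices"
    obtain D P Q t where "smith_normal_form A D"
      and D: "P \<in> carrier_mat n n" "Q \<in> carrier_mat n n" "det P dvd 1" "det Q dvd 1"
      "D = P * A * Q" "D \<in> carrier_mat n n" "diagonal_mat D"
      and "\<And>i. i < n \<Longrightarrow> rat_val p (rat_of_int (D $$ (i, i))) = ereal (real (es ! i))"
      and t: "\<And>i. i < n \<Longrightarrow> D $$ (i, i) = int p ^ (es ! i) * t i \<and> \<not> int p dvd t i"
      by (rule smith_class_smith_form[OF assms(3,5) A[unfolded smith_matrices]]) (rule that)
    have Ac: "A \<in> carrier_mat n n" using A by (simp add: smith_matrices_def box_def)
    obtain U where U: "U \<in> carrier_mat n n" "P * U = 1\<^sub>m n" "U * P = 1\<^sub>m n" "det U dvd 1"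
      by (rule unimodular_inverse[OF D(1,3)]) (rule that)
    obtain R where R: "R \<in> carrier_mat n n" "Q * R = 1\<^sub>m n" "R * Q = 1\<^sub>m n" "det R dvd 1"
      by (rule unimodular_inverse[OF D(2,4)]) (rule that)
    define T where "T = mat n n (\<lambda>(i, j). if i = j then t i else 0)"
    have T: "T \<in> carrier_mat n n" by (simp add: T_def)
    have S: "diag_p \<in> carrier_mat n n" by (simp add: diag_p_def)
    have "D = diag_p * T"
      unfolding diag_p_mult[OF T]
      by (rule eq_matI) (use D(6,7) t in \<open>auto simp: T_def diagonal_mat_def\<close>)
    moreover have "A = U * D * R"
    proof -
      have "U * D * R = (U * P) * A * (Q * R)"
        unfolding D(5) using U(1) R(1) D(1,2) Ac by (simp add: assoc_mult_mat[of _ n n _ n _ n])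
      then show ?thesis unfolding U(3) R(2) using Ac by simp
    qed
    ultimately have "A = U * diag_p * (T * R)" using U(1) S T R(1) by (simp add: assoc_mult_mat[of _ n n _ n _ n])
    moreover have "\<not> int p dvd det (T * R)"
    proof -
      have "det T = prod_list (diag_mat T)"
        by (rule det_lower_triangular[OF _ T]) (auto simp: T_def)
      also have "\<dots> = (\<Prod>i = 0..<n. t i)" by (simp add: prod_list_diag_prod T_def)
      finally have "\<not> int p dvd det T" using t prime_int by (simp add: prime_dvd_prod_iff)
      moreover have "\<not> int p dvd det R" using R(4) prime_int by (meson dvd_trans not_prime_unit)
      ultimately show ?thesis using det_mult[OF T R(1)] prime_int by (simp add: prime_dvd_mult_iff)
    qed
    ultimately show "\<exists>U V. U \<in> carrier_mat n n \<and> det U dvd 1 \<and> V \<in> carrier_mat n n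
        \<and> \<not> int p dvd det V \<and> A = U * diag_p * V"
      using U T R by (intro exI[of _ U] exI[of _ "T * R"]) auto
  qed
  have fin: "finite box" by (rule finite_box)
  have "0 < real p" using prime_gt_0_nat[OF assms(3)] by simp
  have "real (p * card {W \<in> box. \<not> generic W}) \<le> real (n ^ 2 * card box)"
    using card_not_generic_le by (simp only: of_nat_le_iff)
  then have "real p * real (card {W \<in> box. \<not> generic W}) \<le> real n ^ 2 * real (card box)" by simp
  also have "\<dots> \<le> \<epsilon> * real p * real (card box)" using assms(4) by (intro mult_right_mono) auto
  finally have "real p * real (card {W \<in> box. \<not> generic W}) \<le> real p * (\<epsilon> * real (card box))"
    by (simp add: algebra_simps)
  then have bad: "real (card {W \<in> box. \<not> generic W}) \<le> \<epsilon> * real (card box)" using \<open>0 < real p\<close> by simp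
  have "card box = card {W \<in> box. generic W} + card {W \<in> box. \<not> generic W}"
    using fin by (subst card_Un_disjoint[symmetric]) (auto intro: arg_cong[of _ _ card])
  then have "real (card {W \<in> box. generic W}) \<ge> (1 - \<epsilon>) * real (card box)"
    using bad by (simp add: algebra_simps)
  moreover have "card units \<le> card box" using fin by (intro card_mono) (auto simp: units_def)
  ultimately have gen: "(1 - \<epsilon>) * real (card units) \<le> real (card {W \<in> box. generic W})"
    using mult_left_mono[of "real (card units)" "real (card box)" "1 - \<epsilon>"] True by simp
  have "1\<^sub>m n \<in> units"
  proof -
    have "1 < int p ^ m" using prime_gt_1_nat[OF assms(3)] assms(7) by (intro one_less_power) auto
    then have "1\<^sub>m n \<in> box" using p_pos by (auto simp: box_def one_mat_def)
    moreover have "\<not> int p dvd 1" using prime_int by (simp add: prime_int_iff)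
    ultimately show ?thesis by (simp add: units_def)
  qed
  then have "0 < card units" using fin by (auto simp: card_gt_0_iff units_def)
  have "(1 - \<epsilon>) * real (card smith_matrices) * real (card units) = real (card smith_matrices) * ((1 - \<epsilon>) * real (card units))"
    by simp
  also have "\<dots> \<le> real (card smith_matrices) * real (card {W \<in> box. generic W})" using gen by (rule mult_left_mono) simp
  also have "\<dots> = real (card {A \<in> smith_matrices. exact_coeffs A}) * real (card units)"
    using arg_cong[OF eq, of real] by simp
  finally have "(1 - \<epsilon>) * real (card smith_matrices) \<le> real (card {A \<in> smith_matrices. exact_coeffs A})"
    using \<open>0 < card units\<close> by simp
  then show ?thesis unfolding char unfolding smith_matrices .
qed

section \<open>Eigenvalues in \<open>p\<close>-adic extensions\<close>

context completion_embedding begin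

lemma add_pow_one_int:
  fixes c :: int
  shows "[c] \<cdot> \<one> = \<psi> (\<lambda>_. of_int c)"
proof -
  have nat: "[k] \<cdot> \<one> = \<psi> (\<lambda>_. of_nat k)" for k :: nat
  proof (induction k)
    case (Suc k)
    have "[Suc k] \<cdot> \<one> = [k] \<cdot> \<one> \<oplus> \<one>" by (rule add.nat_pow_Suc)
    also have "\<dots> = \<psi> (\<lambda>_. of_nat k + 1)" using Suc \<psi>_add[of "\<lambda>_. of_nat k" "\<lambda>_. 1"] by (simp add: \<psi>_one)
    finally show ?case by (simp add: add.commute)
  qed (simp add: \<psi>_zero)
  show ?thesis
  proof (cases "0 \<le> c")
    case True
    then show ?thesis using nat[of "nat c"] by (simp add: add_pow_int_ge)
  next
    case False
    then have "[c] \<cdot> \<one> = \<ominus> \<psi> (\<lambda>_. of_nat (nat (- c)))" by (simp only: add_pow_int_lt not_le nat)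
    also have "\<dots> = \<psi> (\<lambda>_. - of_nat (nat (- c)))" by (rule \<psi>_uminus[symmetric]) simp
    finally show ?thesis using False by simp
  qed
qed

lemma char_poly_over_eq: "char_poly_over L A = map (\<lambda>c. \<psi> (\<lambda>_. of_int c)) (rev (coeffs (char_poly A)))"
  unfolding char_poly_over_def add_pow_one_int ..

lemma char_poly_over_props:
  assumes A: "A \<in> carrier_mat n n"
  shows "char_poly_over L A \<in> carrier (F[X])" "length (char_poly_over L A) = Suc n"
    "hd (char_poly_over L A) = \<one>"
    "coeff (char_poly_over L A) j = \<psi> (\<lambda>_. of_int (poly.coeff (char_poly A) j))"
proof -
  have monic: "Polynomial.degree (char_poly A) = n" "poly.coeff (char_poly A) n = 1"
    using degree_monic_char_poly[OF A] by auto
  then have "char_poly A \<noteq> 0" by auto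
  then have eq: "char_poly_over L A = map (\<lambda>j. \<psi> (\<lambda>_. of_int (poly.coeff (char_poly A) j))) (rev [0..<Suc n])"
    unfolding char_poly_over_eq by (simp add: coeffs_def monic(1) rev_map comp_def del: upt_Suc)
  show len: "length (char_poly_over L A) = Suc n" by (simp add: eq)
  show hd: "hd (char_poly_over L A) = \<one>" by (simp add: eq monic(2) \<psi>_one)
  have "set (char_poly_over L A) \<subseteq> F" by (auto simp: eq simp del: upt_Suc)
  then show "char_poly_over L A \<in> carrier (F[X])"
    using hd len by (auto simp: univ_poly_carrier[symmetric] polynomial_def)
  show "coeff (char_poly_over L A) j = \<psi> (\<lambda>_. of_int (poly.coeff (char_poly A) j))"
  proof (cases "j < Suc n")
    case False
    then have "poly.coeff (char_poly A) j = 0" using monic(1) by (intro coeff_eq_0) simp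
    then show ?thesis using False unfolding eq coeff_map_rev_upt by (simp add: \<psi>_zero)
  qed (simp add: eq coeff_map_rev_upt del: upt_Suc)
qed

lemma root_properties:
  assumes P: "P \<in> carrier (F[X])" "P \<noteq> []" "coeff P 0 \<noteq> \<zero>" and x: "x \<in># roots P"
  shows "x \<in> carrier L" "(algebraic over F) x" "coeff (Irr F x) 0 \<noteq> \<zero>" "x \<noteq> \<zero>"
proof -
  interpret UP: domain "F[X]" by (rule univ_poly_is_domain[OF subring_F])
  have root: "is_root P x" using x roots_mem_iff_is_root[OF carrier_polynomial_shell[OF subring_F P(1)]] by simp
  show xc: "x \<in> carrier L" using root by (simp add: is_root_def)
  have ev: "eval P x = \<zero>" using root by (simp add: is_root_def)
  show alg: "(algebraic over F) x" by (rule algebraicI[OF P(1,2) ev])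
  define I where "I = Irr F x"
  have I: "I \<in> carrier (F[X])" using IrrE[OF subfield_F xc alg] by (simp add: I_def)
  have "I pdivides P" unfolding I_def by (rule Irr_minimal[OF subfield_F xc alg P(1) ev])
  then have "I divides\<^bsub>F[X]\<^esub> P" using pdivides_iff_shell[OF subfield_F I P(1)] by simp
  then obtain R where R: "R \<in> carrier (F[X])" "P = I \<otimes>\<^bsub>F[X]\<^esub> R" unfolding factor_def by auto
  have "coeff I 0 \<otimes> coeff R 0 \<noteq> \<zero>" using P(3) coeff_mult_zero[OF I R(1)] R(2) by simp
  then show "coeff (Irr F x) 0 \<noteq> \<zero>"
    using F_poly_in_carrier[OF R(1)] by (auto simp: I_def)
  show "x \<noteq> \<zero>"
  proof
    assume "x = \<zero>"
    moreover obtain Q a where Q: "P = Q @ [a]" using P(2) by (cases P rule: rev_cases) auto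
    moreover have "set Q \<subseteq> carrier L" "a \<in> carrier L" using F_poly_in_carrier[OF P(1)] Q by auto
    ultimately have "a = \<zero>" using ev const_term_eq_last[of Q a] by (simp add: const_term_def)
    then show False using P(3) Q by (simp add: append_coeff)
  qed
qed

end

text \<open>Every irreducible factor over \<open>E\<close> has a root in the large field. That root lies in \<open>E\<close>, so the factor
  is linear.\<close>

lemma (in field) splitted_in_subfield:
  assumes E: "subfield E R" and P: "P \<in> carrier (E[X])" "P \<noteq> []" "splitted P" and roots: "set_mset (roots P) \<subseteq> E"
  shows "ring.splitted (R \<lparr> carrier := E \<rparr>) P"
proof -
  interpret S: field "R \<lparr> carrier := E \<rparr>" by (rule subfield_iff(2)[OF E])
  have sub: "subring E R" by (rule subfieldE(1)[OF E])
  have poly: "univ_poly (R \<lparr> carrier := E \<rparr>) E = E[X]" by (simp add: univ_poly_consistent[OF sub])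
  have PR: "P \<in> carrier (poly_ring R)" by (rule carrier_polynomial_shell[OF sub P(1)])
  show ?thesis
  proof (rule S.trivial_factors_imp_splitted)
    show "P \<in> carrier (poly_ring (R \<lparr> carrier := E \<rparr>))" using P(1) poly by simp
    fix q assume q: "q \<in> carrier (poly_ring (R \<lparr> carrier := E \<rparr>))"
      "pirreducible\<^bsub>R \<lparr> carrier := E \<rparr>\<^esub> (carrier (R \<lparr> carrier := E \<rparr>)) q"
      "q pdivides\<^bsub>R \<lparr> carrier := E \<rparr>\<^esub> P"
    have qE: "q \<in> carrier (E[X])" using q(1) poly by simp
    have qR: "q \<in> carrier (poly_ring R)" by (rule carrier_polynomial_shell[OF sub qE])
    have "q divides\<^bsub>E[X]\<^esub> P" using q(3) poly by (simp add: pdivides_def)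
    then have dvd: "q pdivides P" using pdivides_iff_shell[OF E qE P(1)] by simp
    have split: "splitted q" by (rule pdivides_imp_splitted[OF qR PR P(2,3) dvd])
    have deg: "1 \<le> length q - 1" by (rule S.pirreducible_degree[OF S.carrier_is_subfield q(1,2)])
    then have "roots q \<noteq> {#}" using split by (auto simp: splitted_def)
    then obtain x where x: "x \<in># roots q" by blast
    have "x \<in># roots P" using pdivides_imp_roots_incl[OF qR PR P(2) dvd] x by (rule mset_subset_eqD)
    then have "x \<in> E" using roots by auto
    moreover have "eval q x = \<zero>" "q \<noteq> []"
      using x roots_mem_iff_is_root[OF qR] by (simp_all add: is_root_def)
    ultimately have "S.is_root q x" by (simp add: S.is_root_def eval_consistent[OF sub])
    then have "S.roots q \<noteq> {#}" using S.roots_mem_iff_is_root[OF q(1), of x] by auto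
    then have "length q - 1 = 1" using S.pirreducible_roots[OF q(1,2)] by blast
    then show "length q - 1 \<le> 1" by simp
  qed
qed

text \<open>Adjoin the eigenvalues inside an algebraic closure.\<close>

lemma padic_splitting_extension:
  assumes p: "prime p" and A: "A \<in> carrier_mat n n"
  obtains K \<phi> where "finite_padic_extension p K \<phi>" "ring.splitted K (char_poly_over K A)"
proof -
  interpret Q: field "padic_field p" by (rule field_padic_field[OF p])
  define \<iota> :: "padic \<Rightarrow> padic_ext" where "\<iota> = Q.indexed_const"
  define L :: "padic_ext ring" where "L = Q.alg_closure"
  have L: "algebraic_closure L (\<iota> ` carrier (padic_field p))" and hom: "\<iota> \<in> Ring.ring_hom (padic_field p) L"
    unfolding \<iota>_def L_def by (rule Q.alg_closureE)+
  interpret L: algebraic_closure L "\<iota> ` carrier (padic_field p)" by (rule L)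
  interpret C: completion_embedding "padic_abs p" L "\<lambda>u. \<iota> (padic_of p u)"
    by (rule completion_embedding_padic[OF p L.field_axioms hom])
  have F: "C.F = \<iota> ` carrier (padic_field p)"
    unfolding C.F_def carrier_padic_field[OF p] by auto
  define P where "P = char_poly_over L A"
  have P: "P \<in> carrier (C.F[X]\<^bsub>L\<^esub>)" "P \<noteq> []"
    using C.char_poly_over_props(1,2)[OF A] by (auto simp: P_def)
  have PL: "P \<in> carrier (poly_ring L)" by (rule L.carrier_polynomial_shell[OF C.subring_F P(1)])
  have split: "L.splitted P" by (rule L.roots_over_carrier[OF PL])
  obtain rs where rs: "mset rs = L.roots P" using ex_mset by blast
  have rs_L: "set rs \<subseteq> carrier L"
  proof
    fix x assume "x \<in> set rs"
    then have "x \<in># L.roots P" by (simp flip: rs)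
    then show "x \<in> carrier L" using L.roots_mem_iff_is_root[OF PL] by (simp add: L.is_root_def)
  qed
  have alg: "(L.algebraic over C.F) x" if "x \<in> set rs" for x
    using L.algebraic_extension[of x] rs_L that F by auto
  define E where "E = L.finite_extension C.F rs"
  define K where "K = L \<lparr> carrier := E \<rparr>"
  have E: "subfield E L"
    unfolding E_def by (rule L.finite_extension_is_subfield[OF C.subfield_F rs_L alg])
  have FE: "C.F \<subseteq> E"
    unfolding E_def using subfieldE(3)[OF C.subfield_F] rs_L by (rule L.finite_extension_incl)
  have rsE: "set rs \<subseteq> E" unfolding E_def by (rule L.finite_extension_mem[OF C.subring_F rs_L])
  have K: "field K" unfolding K_def by (rule L.subfield_iff(2)[OF E])
  interpret K: field K by (rule K)
  have homK: "\<iota> \<in> Ring.ring_hom (padic_field p) K"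
    using hom FE F unfolding Ring.ring_hom_def K_def by auto
  interpret CK: completion_embedding "padic_abs p" K "\<lambda>u. \<iota> (padic_of p u)"
    by (rule completion_embedding_padic[OF p K homK])
  have PK: "char_poly_over K A = P" unfolding P_def CK.char_poly_over_eq C.char_poly_over_eq ..
  have sub: "subring E L" by (rule subfieldE(1)[OF E])
  have "K.finite_dimension C.F (carrier K)"
  proof -
    have ext: "K.finite_extension = L.finite_extension"
      unfolding K_def by (rule L.finite_extension_consistent[OF sub])
    have alg_eq: "K.algebraic = L.algebraic"
      unfolding K_def by (rule L.algebraic_consistent[OF sub, symmetric])
    have carr: "carrier K = E" by (simp add: K_def)
    have subF: "subfield C.F K" by (rule CK.subfield_F)
    have rsK: "set rs \<subseteq> carrier K" unfolding carr by (rule rsE)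
    have algK: "(K.algebraic over C.F) x" if "x \<in> set rs" for x
      unfolding alg_eq by (rule alg[OF that])
    have "K.finite_dimension C.F (K.finite_extension C.F rs)"
      by (rule K.finite_extension_finite_dimension(1)[OF subF rsK algK])
    then show ?thesis unfolding ext carr E_def[symmetric] .
  qed
  then have "finite_padic_extension p K \<iota>"
    unfolding finite_padic_extension_def using K homK F by simp
  moreover have "K.splitted P"
    unfolding K_def
  proof (rule L.splitted_in_subfield[OF E _ P(2) split])
    show "P \<in> carrier (E[X]\<^bsub>L\<^esub>)"
      using P FE unfolding univ_poly_carrier[symmetric] polynomial_def by auto
    show "set_mset (L.roots P) \<subseteq> E" using rsE unfolding rs[symmetric] by simp
  qed
  ultimately show ?thesis using that[of K \<iota>] unfolding PK by blast
qed

text \<open>For non-increasing \<open>b\<close> the maximum is attained where \<open>b\<close> passes \<open>\<sigma>\<close>.\<close>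

lemma Max_partial_prods:
  fixes b :: "nat \<Rightarrow> real"
  assumes pos: "\<And>i. 0 < b i" and mono: "\<And>i j. i \<le> j \<Longrightarrow> j < n \<Longrightarrow> b j \<le> b i" and \<sigma>: "0 < \<sigma>"
  shows "Max ((\<lambda>k. (\<Prod>i<k. b i) * \<sigma> ^ (n - k)) ` {..n}) = (\<Prod>i<n. max (b i) \<sigma>)"
proof (rule antisym)
  have split: "(\<Prod>i<n. f i) = (\<Prod>i<k. f i) * (\<Prod>i\<in>{k..<n}. f i)" if "k \<le> n" for f :: "nat \<Rightarrow> real" and k
  proof -
    have "{..<n} = {..<k} \<union> {k..<n}" using that by auto
    then show ?thesis by (simp add: prod.union_disjoint[symmetric] ivl_disj_int)
  qed
  show "Max ((\<lambda>k. (\<Prod>i<k. b i) * \<sigma> ^ (n - k)) ` {..n}) \<le> (\<Prod>i<n. max (b i) \<sigma>)"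
  proof (rule Max.boundedI)
    fix x assume "x \<in> (\<lambda>k. (\<Prod>i<k. b i) * \<sigma> ^ (n - k)) ` {..n}"
    then obtain k where k: "k \<le> n" "x = (\<Prod>i<k. b i) * \<sigma> ^ (n - k)" by auto
    have "\<sigma> ^ (n - k) = (\<Prod>i\<in>{k..<n}. \<sigma>)" by simp
    then have "x = (\<Prod>i<k. b i) * (\<Prod>i\<in>{k..<n}. \<sigma>)" using k by simp
    also have "\<dots> \<le> (\<Prod>i<k. max (b i) \<sigma>) * (\<Prod>i\<in>{k..<n}. max (b i) \<sigma>)"
      using pos \<sigma> by (intro mult_mono prod_mono prod_nonneg) (auto simp: less_imp_le le_max_iff_disj)
    finally show "x \<le> (\<Prod>i<n. max (b i) \<sigma>)" using split[OF k(1)] by simp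
  qed auto
  define k where "k = card {i. i < n \<and> \<sigma> \<le> b i}"
  have set_eq: "{i. i < n \<and> \<sigma> \<le> b i} = {..<k}"
  proof -
    define S where "S = {i. i < n \<and> \<sigma> \<le> b i}"
    have fin: "finite S" by (simp add: S_def)
    have down: "j \<in> S" if "i \<in> S" "j \<le> i" for i j
      using that mono[of j i] unfolding S_def by auto
    have "S = {..<card S}"
    proof (cases "S = {}")
      case False
      have "S = {..Max S}"
      proof
        show "S \<subseteq> {..Max S}" using fin by auto
        show "{..Max S} \<subseteq> S" using down[OF Max_in[OF fin False]] by auto
      qed
      then have "S = {..<Suc (Max S)}" by (simp add: lessThan_Suc_atMost)
      then show ?thesis by (metis card_lessThan)
    qed simp
    then show ?thesis by (simp add: S_def k_def)
  qed
  have kn: "k \<le> n" unfolding k_def using card_mono[of "{..<n}" "{i. i < n \<and> \<sigma> \<le> b i}"] by auto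
  have "(\<Prod>i<n. max (b i) \<sigma>) = (\<Prod>i<k. max (b i) \<sigma>) * (\<Prod>i\<in>{k..<n}. max (b i) \<sigma>)" by (rule split[OF kn])
  also have "(\<Prod>i<k. max (b i) \<sigma>) = (\<Prod>i<k. b i)"
  proof (rule prod.cong)
    fix i assume "i \<in> {..<k}"
    then have "i \<in> {i. i < n \<and> \<sigma> \<le> b i}" unfolding set_eq .
    then show "max (b i) \<sigma> = b i" by simp
  qed simp
  also have "(\<Prod>i\<in>{k..<n}. max (b i) \<sigma>) = (\<Prod>i\<in>{k..<n}. \<sigma>)"
  proof (rule prod.cong)
    fix i assume "i \<in> {k..<n}"
    then have "i \<notin> {i. i < n \<and> \<sigma> \<le> b i}" "i < n" unfolding set_eq by auto
    then show "max (b i) \<sigma> = \<sigma>" by auto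
  qed simp
  also have "(\<Prod>i\<in>{k..<n}. \<sigma>) = \<sigma> ^ (n - k)" by simp
  finally have "(\<Prod>i<n. max (b i) \<sigma>) = (\<Prod>i<k. b i) * \<sigma> ^ (n - k)" .
  then show "(\<Prod>i<n. max (b i) \<sigma>) \<le> Max ((\<lambda>k. (\<Prod>i<k. b i) * \<sigma> ^ (n - k)) ` {..n})"
    using kn by (auto intro!: Max_ge)
qed

text \<open>Both sides come from the constant coefficient of the minimal polynomial. It is represented by a
  Cauchy sequence of rational numbers, along which the valuation is minus the logarithm of the
  absolute value.\<close>

lemma ext_val_eq_anrm:
  assumes p: "prime p" and ext: "finite_padic_extension p K \<phi>"
    and C: "completion_embedding (padic_abs p) K \<psi>" "\<psi> = (\<lambda>u. \<phi> (padic_of p u))"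
    and x: "x \<in> carrier K" "(ring.algebraic K over completion_embedding.F (padic_abs p) \<psi>) x"
    and c0: "ring.coeff K (ring.Irr K (completion_embedding.F (padic_abs p) \<psi>) x) 0 \<noteq> \<zero>\<^bsub>K\<^esub>"
  shows "ext_val p K \<phi> x = ereal (- log p (completion_embedding.anrm (padic_abs p) K \<psi> x))"
proof -
  interpret C: completion_embedding "padic_abs p" K \<psi> by (rule C(1))
  interpret Q: field "padic_field p" by (rule field_padic_field[OF p])
  have K: "field K" "\<phi> \<in> Ring.ring_hom (padic_field p) K"
    using ext by (auto simp: finite_padic_extension_def)
  have inj: "inj_on \<phi> (carrier (padic_field p))"
    by (rule non_trivial_field_hom_is_inj[OF K(2) Q.field_axioms K(1)])
  have F: "C.F = \<phi> ` carrier (padic_field p)"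
    unfolding C.F_def carrier_padic_field[OF p] by (auto simp: C(2))
  define I where "I = C.Irr C.F x"
  have I: "I \<in> carrier (C.F[X]\<^bsub>K\<^esub>)" "pirreducible\<^bsub>K\<^esub> C.F I"
    using C.IrrE[OF C.subfield_F x] by (simp_all add: I_def)
  have In: "I \<noteq> []" using C.pirreducibleE(1)[OF C.subring_F I] .
  have dI: "1 \<le> length I - 1" by (rule C.pirreducible_degree[OF C.subfield_F I])
  have last: "last I = C.coeff I 0"
  proof -
    obtain Q a where "I = Q @ [a]" using In by (cases I rule: rev_cases) auto
    then show ?thesis by (simp add: C.append_coeff)
  qed
  have "C.coeff I 0 \<in> C.F" by (rule C.F_poly_coeff[OF I(1)])
  then obtain u where u: "C.cauchy u" "\<psi> u = C.coeff I 0" by (rule C.F_E)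
  have pos: "0 < C.cnrm (C.coeff I 0)" using C.cnrm_pos[OF \<open>C.coeff I 0 \<in> C.F\<close>] c0 by (simp add: I_def)
  have "inv_into (carrier (padic_field p)) \<phi> (last I) = padic_of p u"
    unfolding last u(2)[symmetric] C(2)
    by (rule inv_into_f_f[OF inj]) (use u(1) in \<open>simp add: carrier_padic_field[OF p]\<close>)
  moreover have "padic_val p (padic_of p u) = ereal (- log p (C.cnrm (C.coeff I 0)))"
    using C.nrm_tendsto_cnrm[OF u(1)] pos unfolding u(2) by (intro padic_val_padic_of[OF p u(1)])
  ultimately have "ext_val p K \<phi> x = ereal (- log p (C.cnrm (C.coeff I 0))) / ereal (real (length I - 1))"
    unfolding ext_val_def Let_def F[symmetric] I_def[symmetric] by simp
  also have "\<dots> = ereal (- log p (C.cnrm (C.coeff I 0)) / real (length I - 1))" using dI by simp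
  also have "- log p (C.cnrm (C.coeff I 0)) / real (length I - 1) = - log p (C.anrm x)"
    unfolding C.anrm_def I_def[symmetric] using pos by (simp add: log_powr)
  finally show ?thesis .
qed

text \<open>The valuations of the coefficients give the Gauss norms of the characteristic polynomial, and these
  determine the absolute values of the roots. Sorting the roots by valuation then reproduces
  the sorted list of exponents.\<close>

lemma p_characterized_imp_p_correspondent:
  assumes p: "prime p" and n: "n > 0" and es: "length es = n" "sorted es" and m: "m \<ge> sum_list es + 1"
    and A: "A \<in> smith_class p m es" and char: "p_characterized p A"
  shows "p_correspondent p A"
proof -
  have Ac: "A \<in> carrier_mat n n" using A es unfolding smith_class_def by simp
  obtain K \<phi> where ext: "finite_padic_extension p K \<phi>" and split: "ring.splitted K (char_poly_over K A)"
    by (rule padic_splitting_extension[OF p Ac]) (rule that)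
  define \<psi> where "\<psi> = (\<lambda>u. \<phi> (padic_of p u))"
  have K: "field K" "\<phi> \<in> Ring.ring_hom (padic_field p) K"
    using ext by (auto simp: finite_padic_extension_def)
  have emb: "completion_embedding (padic_abs p) K \<psi>"
    unfolding \<psi>_def by (rule completion_embedding_padic[OF p K])
  interpret C: completion_embedding "padic_abs p" K \<psi> by (rule emb)
  define P where "P = char_poly_over K A"
  have P: "P \<in> carrier (C.F[X]\<^bsub>K\<^esub>)" "length P = Suc n" "hd P = \<one>\<^bsub>K\<^esub>"
    "\<And>j. C.coeff P j = \<psi> (\<lambda>_. of_int (poly.coeff (char_poly A) j))"
    unfolding P_def using C.char_poly_over_props[OF Ac] by simp_all
  have Pn: "P \<noteq> []" using P(2) by auto
  have p1: "1 < real p" using prime_gt_1_nat[OF p] by simp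
  define b where "b i = real p powr - real (es ! i)" for i
  have coeff_norm: "C.cnrm (C.coeff P (n - k)) = (\<Prod>i<k. b i)" if k: "k \<le> n" for k
  proof (cases "k = 0")
    case True
    then show ?thesis using C.lead_coeff_simp[OF Pn] P(2,3) by simp
  next
    case False
    define c where "c = poly.coeff (char_poly A) (n - k)"
    have val: "rat_val p (rat_of_int c) = ereal (real (\<Sum>i<k. es ! i))"
      using char False k unfolding p_characterized_iff_coeff_val[OF p n es m A] c_def by auto
    then have c: "rat_of_int c \<noteq> 0" by (auto simp: rat_val_def)
    have "- log p (padic_abs p (rat_of_int c)) = real (\<Sum>i<k. es ! i)"
      using val rat_val_eq_padic_abs[OF p c] by simp
    then have "log p (padic_abs p (rat_of_int c)) = - real (\<Sum>i<k. es ! i)" by linarith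
    moreover have "0 < padic_abs p (rat_of_int c)"
      using C.nrm_nonneg[of "rat_of_int c"] C.nrm_zero_iff[of "rat_of_int c"] c by linarith
    ultimately have "padic_abs p (rat_of_int c) = real p powr (- real (\<Sum>i<k. es ! i))"
      using p1 powr_log_cancel[of "real p" "padic_abs p (rat_of_int c)"] by simp
    also have "- real (\<Sum>i<k. es ! i) = (\<Sum>i<k. - real (es ! i))" by (simp add: sum_negf)
    also have "real p powr \<dots> = (\<Prod>i<k. b i)" unfolding b_def using p1 by (simp add: powr_sum)
    finally show ?thesis unfolding P(4) by (simp add: c_def)
  qed
  have b: "0 < b i" for i using p1 by (simp add: b_def)
  have b_mono: "b j \<le> b i" if "i \<le> j" "j < n" for i j
    using p1 that es by (simp add: b_def sorted_nth_mono)
  have P0: "C.coeff P 0 \<noteq> \<zero>\<^bsub>K\<^esub>"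
  proof
    assume "C.coeff P 0 = \<zero>\<^bsub>K\<^esub>"
    then have "(\<Prod>i<n. b i) = 0" using coeff_norm[of n] by simp
    moreover have "0 < (\<Prod>i<n. b i)" using b by (intro prod_pos) auto
    ultimately show False by (simp only: less_irrefl)
  qed
  have roots: "x \<in> carrier K" "(C.algebraic over C.F) x" "C.coeff (C.Irr C.F x) 0 \<noteq> \<zero>\<^bsub>K\<^esub>" "x \<noteq> \<zero>\<^bsub>K\<^esub>"
    if "x \<in># C.roots P" for x
    using C.root_properties[OF P(1) Pn P0 that] by simp_all
  have ext_val: "ext_val p K \<phi> x = ereal (- log p (C.anrm x))" if "x \<in># C.roots P" for x
    by (rule ext_val_eq_anrm[OF p ext emb \<psi>_def roots(1-3)[OF that]])
  have eq: "image_mset C.anrm (C.roots P) = mset (map b [0..<n])"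
  proof (rule multiset_eq_of_prod_max)
    show "\<forall>x\<in>#image_mset C.anrm (C.roots P). 0 < x"
    proof
      fix y assume "y \<in># image_mset C.anrm (C.roots P)"
      then obtain x where x: "x \<in># C.roots P" "y = C.anrm x" by auto
      have "C.Irr C.F x \<in> carrier (C.F[X]\<^bsub>K\<^esub>)" using C.IrrE(1)[OF C.subfield_F roots(1,2)[OF x(1)]] .
      then have "0 < C.cnrm (C.coeff (C.Irr C.F x) 0)"
        using C.cnrm_pos[OF C.F_poly_coeff] roots(3)[OF x(1)] by blast
      then show "0 < y" by (simp add: x(2) C.anrm_def)
    qed
    show "\<forall>x\<in>#mset (map b [0..<n]). 0 < x" using b by auto
    show "size (image_mset C.anrm (C.roots P)) = size (mset (map b [0..<n]))"
      using split P(2) by (simp add: C.splitted_def P_def)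
    fix \<sigma> :: real assume \<sigma>: "0 < \<sigma>"
    have "(\<Prod>y\<in>#image_mset C.anrm (C.roots P). max y \<sigma>) = C.cgauss \<sigma> P"
      using C.cgauss_eq_prod_roots[OF P(1) Pn P(3) P0 _ \<sigma>] split by (simp add: P_def image_mset.compositionality comp_def)
    also have "\<dots> = Max ((\<lambda>j. C.cnrm (C.coeff P j) * \<sigma> ^ j) ` {..n})"
      unfolding C.cgauss_def using P(2) \<sigma> C.cnrm_nonneg[OF C.F_poly_coeff[OF P(1)]]
      by (intro C.Max_image_extend) (auto simp: C.coeff_length)
    also have "(\<lambda>j. C.cnrm (C.coeff P j) * \<sigma> ^ j) ` {..n} = (\<lambda>k. (\<Prod>i<k. b i) * \<sigma> ^ (n - k)) ` {..n}"
    proof -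
      have "{..n} = (\<lambda>k. n - k) ` {..n}"
      proof
        show "{..n} \<subseteq> (\<lambda>k. n - k) ` {..n}"
        proof
          fix j assume "j \<in> {..n}"
          then show "j \<in> (\<lambda>k. n - k) ` {..n}" by (intro image_eqI[of _ _ "n - j"]) auto
        qed
      qed auto
      then have "(\<lambda>j. C.cnrm (C.coeff P j) * \<sigma> ^ j) ` {..n}
          = (\<lambda>j. C.cnrm (C.coeff P j) * \<sigma> ^ j) ` (\<lambda>k. n - k) ` {..n}" by simp
      also have "\<dots> = (\<lambda>k. (\<Prod>i<k. b i) * \<sigma> ^ (n - k)) ` {..n}"
        unfolding image_image by (intro image_cong refl) (simp add: coeff_norm)
      finally show ?thesis .
    qed
    also have "Max \<dots> = (\<Prod>i<n. max (b i) \<sigma>)" by (rule Max_partial_prods[OF b b_mono \<sigma>])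
    also have "\<dots> = (\<Prod>y\<in>#mset (map b [0..<n]). max y \<sigma>)"
      by (simp add: prod_mset_prod_list prod.list_conv_set_nth comp_def atLeast0LessThan flip: mset_map)
    finally show "(\<Prod>y\<in>#image_mset C.anrm (C.roots P). max y \<sigma>) = (\<Prod>y\<in>#mset (map b [0..<n]). max y \<sigma>)" .
  qed
  obtain xs where xs: "mset xs = C.roots P" using ex_mset by blast
  define ls where "ls = sort_key (ext_val p K \<phi>) xs"
  have ls: "mset ls = C.roots P" by (simp add: ls_def xs)
  have sorted: "sorted (map (ext_val p K \<phi>) ls)" by (simp add: ls_def)
  have "mset (map (ext_val p K \<phi>) ls) = image_mset (ext_val p K \<phi>) (C.roots P)" by (simp add: ls)
  also have "\<dots> = image_mset (\<lambda>x. ereal (- log p (C.anrm x))) (C.roots P)"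
    by (rule image_mset_cong) (rule ext_val)
  also have "\<dots> = image_mset (\<lambda>y. ereal (- log p y)) (image_mset C.anrm (C.roots P))"
    by (simp add: image_mset.compositionality comp_def)
  also have "\<dots> = mset (map (\<lambda>i. ereal (- log p (b i))) [0..<n])"
    unfolding eq by (simp add: image_mset.compositionality comp_def)
  also have "map (\<lambda>i. ereal (- log p (b i))) [0..<n] = map (\<lambda>i. ereal (real (es ! i))) [0..<n]"
    using p1 by (simp add: b_def)
  finally have mset_eq: "mset (map (ext_val p K \<phi>) ls) = mset (map (\<lambda>i. ereal (real (es ! i))) [0..<n])" .
  have sorted_es: "sorted (map (\<lambda>i. ereal (real (es ! i))) [0..<n])"
    unfolding sorted_iff_nth_mono using es by (auto simp: sorted_nth_mono)
  have list_eq: "map (ext_val p K \<phi>) ls = map (\<lambda>i. ereal (real (es ! i))) [0..<n]"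
    using trans[OF properties_for_sort[OF mset_eq sorted, symmetric] properties_for_sort[OF refl sorted_es]] .
  have len: "length ls = n" using arg_cong[OF list_eq, of length] by simp
  have rank: "int_mat_rank A = n" by (rule int_mat_rank_smith_class[OF p es(1) A])
  obtain D where D: "smith_normal_form A D"
    "\<forall>i<n. rat_val p (rat_of_int (D $$ (i, i))) = ereal (real (es ! i))"
    using A es unfolding smith_class_def by auto
  have "rat_val p (rat_of_int (D $$ (i, i))) = ext_val p K \<phi> (ls ! i)" if "i < n" for i
    using D(2) that arg_cong[OF list_eq, of "\<lambda>l. l ! i"] len by simp
  moreover have "filter_mset (\<lambda>x. x \<noteq> \<zero>\<^bsub>K\<^esub>) (C.roots P) = C.roots P"
    using roots(4) by (simp add: filter_mset_eq_conv)
  ultimately show ?thesis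
    unfolding p_correspondent_def rank
    using D(1) ext ls sorted len unfolding P_def by (intro exI[of _ D] exI[of _ K] exI[of _ \<phi>] exI[of _ ls]) simp
qed

theorem theorem2:
  fixes n p m :: nat and \<epsilon> :: real and es :: "nat list"
  assumes "n > 0"
    and "\<epsilon> > 0"
    and "prime p"
    and "real p > 16 * (real n ^ 2 + 3 * real n) / \<epsilon>"
    and "length es = n"
    and "sorted es"
    and "m \<ge> sum_list es + 1"
  shows "real (card {A \<in> smith_class p m es. p_characterized p A})
           \<ge> (1 - \<epsilon>) * real (card (smith_class p m es))
         \<and> (\<forall>A \<in> smith_class p m es. p_characterized p A \<longrightarrow> p_correspondent p A)"
proof
  have "16 * (real n ^ 2 + 3 * real n) < \<epsilon> * real p" using assms(2,4) by (simp add: pos_divide_less_eq mult.commute)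
  moreover have "real n ^ 2 \<le> 16 * (real n ^ 2 + 3 * real n)" by simp
  ultimately have "real n ^ 2 \<le> \<epsilon> * real p" by linarith
  then show "real (card {A \<in> smith_class p m es. p_characterized p A})
      \<ge> (1 - \<epsilon>) * real (card (smith_class p m es))"
    by (intro card_p_characterized_ge[OF assms(1-3) _ assms(5-7)])
  show "\<forall>A \<in> smith_class p m es. p_characterized p A \<longrightarrow> p_correspondent p A"
    using p_characterized_imp_p_correspondent[OF assms(3,1,5-7)] by blast
qed

end
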